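(* Let $E$ be a graph and let $R$ be a commutative ring with unit. Then the following conditions are equivalent: (1) $L_R(E)$ is categorically left noetherian. (2) $L_R(E)$ is categorically right noetherian. (3) $L_R(E)$ is locally left noetherian. (4) $L_R(E)$ is locally right noetherian. (5) $R$ is noetherian and (a) $E$ does not have infinite emitters; (b) every cycle in the graph has no exit; and (c) every ray has only finitely many exits. (6) $$L_R(E)\cong\bigoplus_{i\in J_1}M_{\mathscr{O}_{p_i}}(R)\ \oplus\ \bigoplus_{j\in J_2}M_{\mathscr{O}_{p_j}}(R[x,x^{-1}]),$$ where the $p_i$ with $i\in J_1$ represent the orbits of non-eventually periodic paths and the $p_j$ with $j\in J_2$ represent the orbits of eventually periodic paths, and $R$ is noetherian.
   Context: Graphs. $E=(E^0,E^1,s,r)$ is an arbitrary directed graph with vertex set $E^0$, edge set $E^1$, source and range maps $s,r:E^1\to E^0$. A vertex $v$ is a sink if $s^{-1}(v)=\emptyset$ and an infinite emitter if $|s^{-1}(v)|=\infty$. A finite path is a sequence of edges $\alpha=\alpha_1\cdots\alpha_n$ with $r(\alpha_i)=s(\alpha_{i+1})$, of length $|\alpha|=n$, $s(\alpha)=s(\alpha_1)$, $r(\alpha)=r(\alpha_n)$; vertices are the (empty) paths of length $0$. An infinite path is an infinite sequence $\alpha_1\alpha_2\cdots$ with $r(\alpha_i)=s(\alpha_{i+1})$. A closed path is a finite path of positive length with $r(\alpha)=s(\alpha)$; a cycle is a closed path $\alpha_1\cdots\alpha_n$ in which the vertices $s(\alpha_1),\dots,s(\alpha_n)$ are distinct.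 An exit for a (finite or infinite) path $\alpha=\alpha_1\alpha_2\cdots$ is an edge $f$ such that, for some $i$, $s(f)=s(\alpha_i)$ and $f\neq\alpha_i$. A ray is an infinite path with no repeated vertex. Boundary paths. $\partial E$ is the set of all infinite paths together with all finite paths (including those of length $0$) ending in a sink or an infinite emitter. Orbits are subsets of $\partial E$: two boundary paths $p,q$ lie in the same orbit iff $p=ax$ and $q=bx$ for some finite paths $a,b$ and some $x\in\partial E$. $\mathscr{O}_p$ denotes the orbit of $p$, and one representative is taken for each orbit. A boundary path is eventually periodic if it has the form $\alpha\epsilon\epsilon\epsilon\cdots$ with $\alpha$ a finite path and $\epsilon$ a closed path. Leavitt path algebra. $L_R(E)$ is the Leavitt path algebra of $E$ over $R$: the $R$-algebra generated by $\{v:v\in E^0\}\cup\{e,e^*:e\in E^1\}$ subject to: $vw=\delta_{v,w}v$ for $v,w\in E^0$; $s(e)e=e=er(e)$ and $r(e)e^*=e^*=e^*s(e)$ for $e\in E^1$; $e^*f=\delta_{e,f}r(e)$ for $e,f\in E^1$; and $v=\sum_{s(e)=v}ee^*$ for every $v\in E^0$ with $0<|s^{-1}(v)|<\infty$. It is a ring with local units: every finite subset $x_1,\dots,x_n$ admits an idempotent $e$ with $ex_i=x_ie=x_i$ for all $i$. Chain conditions. Modules over a ring $A$ with local units are unitary ($AM=M$, resp. $MA=M$). $A$ is categorically left (right) noetherian if every finitely generated left (right) $A$-module is noetherian; $A$ is locally left (right) noetherian if $eAe$ is left (right) noetherian for every idempotent $e\in A$. Matrices. $M_X(S)$ is the ring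 of $X\times X$ matrices over $S$ with only finitely many nonzero entries. *)

theory Defs
  imports
    "HOL-Algebra.Ring_Divisibility"
    "HOL-Algebra.Generated_Groups"
    "HOL-Algebra.Module"
    "HOL-Library.Poly_Mapping"
    "HOL-Library.Omega_Words_Fun"
    "Graph_Theory.Arc_Walk"
begin

section \<open>Modules and chain conditions over rings with local units\<close>

text \<open>
  A possibly non-unital ring is a ring record whose field \<open>one\<close> is never consulted.  A module over
  it is a record of type \<open>module\<close> whose multiplicative fields \<open>mult\<close> and \<open>one\<close> are never consulted.
  The library locale \<open>module\<close> cannot be used, because it requires a commutative unital ring.
\<close>

definition has_local_units :: "('a, 'k) ring_scheme \<Rightarrow> bool" where
  "has_local_units A \<longleftrightarrow>
    (\<forall>F. finite F \<and> F \<subseteq> carrier A \<longrightarrow>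
      (\<exists>e\<in>carrier A. e \<otimes>\<^bsub>A\<^esub> e = e \<and> (\<forall>x\<in>F. e \<otimes>\<^bsub>A\<^esub> x = x \<and> x \<otimes>\<^bsub>A\<^esub> e = x)))"

locale unitary_left_module = abelian_group M
  for A :: "('a, 'k) ring_scheme" and M :: "('a, 'm, 'l) module_scheme" (structure) +
  assumes smult_closed: "\<lbrakk>a \<in> carrier A; x \<in> carrier M\<rbrakk> \<Longrightarrow> a \<odot> x \<in> carrier M"
    and smult_l_distr: "\<lbrakk>a \<in> carrier A; b \<in> carrier A; x \<in> carrier M\<rbrakk> \<Longrightarrow>
      (a \<oplus>\<^bsub>A\<^esub> b) \<odot> x = a \<odot> x \<oplus> b \<odot> x"
    and smult_r_distr: "\<lbrakk>a \<in> carrier A; x \<in> carrier M; y \<in> carrier M\<rbrakk> \<Longrightarrow>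
      a \<odot> (x \<oplus> y) = a \<odot> x \<oplus> a \<odot> y"
    and smult_assoc: "\<lbrakk>a \<in> carrier A; b \<in> carrier A; x \<in> carrier M\<rbrakk> \<Longrightarrow>
      (a \<otimes>\<^bsub>A\<^esub> b) \<odot> x = a \<odot> (b \<odot> x)"
    and unitary: "generate (add_monoid M) {a \<odot> x | a x. a \<in> carrier A \<and> x \<in> carrier M} = carrier M"

definition finitely_generated_module ::
  "('a, 'k) ring_scheme \<Rightarrow> ('a, 'm, 'l) module_scheme \<Rightarrow> bool" where
  "finitely_generated_module A M \<longleftrightarrow>
    (\<exists>S. finite S \<and> S \<subseteq> carrier M \<and> (\<forall>N. submodule N A M \<and> S \<subseteq> N \<longrightarrow> N = carrier M))"

definition noetherian_module ::
  "('a, 'k) ring_scheme \<Rightarrow> ('a, 'm, 'l) module_scheme \<Rightarrow> bool" where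
  "noetherian_module A M \<longleftrightarrow>
    (\<forall>N :: nat \<Rightarrow> 'm set. (\<forall>i. submodule (N i) A M) \<and> (\<forall>i. N i \<subseteq> N (Suc i)) \<longrightarrow>
      (\<exists>n. \<forall>i\<ge>n. N i = N n))"

text \<open>
  The submodules of the regular left module are the left ideals.
\<close>

definition regular_module :: "('a, 'k) ring_scheme \<Rightarrow> ('a, 'a) module" where
  "regular_module A = \<lparr>carrier = carrier A, monoid.mult = monoid.mult A, one = one A,
    ring.zero = ring.zero A, ring.add = ring.add A, smult = monoid.mult A\<rparr>"

definition left_noetherian :: "('a, 'k) ring_scheme \<Rightarrow> bool" where
  "left_noetherian A \<longleftrightarrow> noetherian_module A (regular_module A)"

definition corner_ring :: "('a, 'k) ring_scheme \<Rightarrow> 'a \<Rightarrow> 'a ring" where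
  "corner_ring A e = \<lparr>carrier = {e \<otimes>\<^bsub>A\<^esub> a \<otimes>\<^bsub>A\<^esub> e | a. a \<in> carrier A}, monoid.mult = monoid.mult A,
    one = e, ring.zero = ring.zero A, ring.add = ring.add A\<rparr>"

definition locally_left_noetherian :: "('a, 'k) ring_scheme \<Rightarrow> bool" where
  "locally_left_noetherian A \<longleftrightarrow>
    (\<forall>e\<in>carrier A. e \<otimes>\<^bsub>A\<^esub> e = e \<longrightarrow> left_noetherian (corner_ring A e))"

text \<open>
  A formula cannot quantify over modules on all types.  The type \<open>(nat \<Rightarrow> 'a) set\<close> is large enough:
  over a ring \<open>A\<close> with local units, a module with \<open>n\<close> generators is a quotient of \<open>A\<^sup>n\<close>, so it is
  isomorphic to a module whose elements are sets of sequences in \<open>A\<close>.  The theorem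
  \<open>categorically_left_noetherian_any_type\<close> below shows that nothing is lost.
\<close>

definition categorically_left_noetherian :: "('a, 'k) ring_scheme \<Rightarrow> bool" where
  "categorically_left_noetherian A \<longleftrightarrow>
    (\<forall>M :: ('a, (nat \<Rightarrow> 'a) set) module.
      unitary_left_module A M \<and> finitely_generated_module A M \<longrightarrow> noetherian_module A M)"

text \<open>
  Right modules over \<open>A\<close> are left modules over the opposite ring, and \<open>e A e\<close> formed in the
  opposite ring is the opposite of \<open>e A e\<close>.
\<close>

definition opposite_ring :: "('a, 'k) ring_scheme \<Rightarrow> 'a ring" where
  "opposite_ring A = \<lparr>carrier = carrier A, monoid.mult = (\<lambda>x y. y \<otimes>\<^bsub>A\<^esub> x), one = one A,
    ring.zero = ring.zero A, ring.add = ring.add A\<rparr>"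

definition categorically_right_noetherian :: "('a, 'k) ring_scheme \<Rightarrow> bool" where
  "categorically_right_noetherian A \<longleftrightarrow> categorically_left_noetherian (opposite_ring A)"

definition locally_right_noetherian :: "('a, 'k) ring_scheme \<Rightarrow> bool" where
  "locally_right_noetherian A \<longleftrightarrow> locally_left_noetherian (opposite_ring A)"

subsection \<open>The choice of carrier type for modules is immaterial\<close>

context unitary_left_module
begin
lemma smult_r_zero: "a \<in> carrier A \<Longrightarrow> a \<odot> \<zero> = \<zero>"
proof -
  assume a: "a \<in> carrier A"
  have "a \<odot> \<zero> = a \<odot> \<zero> \<oplus> a \<odot> \<zero>"
    using smult_r_distr[OF a zero_closed zero_closed] unfolding l_zero[OF zero_closed] .
  then show ?thesis
    using smult_closed[OF a zero_closed] add.r_cancel_one' by metis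
qed

lemma smult_r_neg:
  assumes "a \<in> carrier A" "x \<in> carrier M" shows "a \<odot> (\<ominus> x) = \<ominus> (a \<odot> x)"
proof -
  have "a \<odot> (\<ominus> x) \<oplus> a \<odot> x = \<zero>"
    using smult_r_distr[of a "\<ominus> x" x] smult_r_zero[of a] assms by (simp add: l_neg)
  then show ?thesis
    using assms smult_closed by (simp add: minus_equality)
qed

lemma local_unit:
  assumes "has_local_units A" and x: "x \<in> carrier M"
  shows "\<exists>e\<in>carrier A. e \<odot> x = x"
proof -
  let ?G = "{a \<odot> x | a x. a \<in> carrier A \<and> x \<in> carrier M}"
  have G: "?G \<subseteq> carrier M"
    using smult_closed by auto
  have "\<exists>F. finite F \<and> F \<subseteq> carrier A \<and>
      (\<forall>e\<in>carrier A. (\<forall>a\<in>F. e \<otimes>\<^bsub>A\<^esub> a = a) \<longrightarrow> e \<odot> y = y)"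
    if "y \<in> generate (add_monoid M) ?G" for y
    using that
  proof (induction rule: generate.induct)
    case one
    show ?case
      using smult_r_zero by (intro exI[of _ "{}"]) simp
  next
    case (incl h)
    then obtain a z where "h = a \<odot> z" "a \<in> carrier A" "z \<in> carrier M"
      by auto
    moreover from this have "e \<odot> h = h" if "e \<in> carrier A" "e \<otimes>\<^bsub>A\<^esub> a = a" for e
      using that smult_assoc[of e a z] by simp
    ultimately show ?case
      by (intro exI[of _ "{a}"]) simp
  next
    case (inv h)
    then obtain a z where h: "h = a \<odot> z" "a \<in> carrier A" "z \<in> carrier M"
      by auto
    have "e \<odot> (\<ominus> h) = \<ominus> h" if "e \<in> carrier A" "e \<otimes>\<^bsub>A\<^esub> a = a" for e
      using h that smult_assoc[of e a z] smult_r_neg[of e h] smult_closed[of a z] by simp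
    then show ?case
      using h unfolding a_inv_def by (intro exI[of _ "{a}"]) simp
  next
    case (eng h1 h2)
    obtain F1 where F1: "finite F1" "F1 \<subseteq> carrier A"
      "\<And>e. e \<in> carrier A \<Longrightarrow> (\<forall>a\<in>F1. e \<otimes>\<^bsub>A\<^esub> a = a) \<Longrightarrow> e \<odot> h1 = h1"
      using eng.IH(1) by blast
    obtain F2 where F2: "finite F2" "F2 \<subseteq> carrier A"
      "\<And>e. e \<in> carrier A \<Longrightarrow> (\<forall>a\<in>F2. e \<otimes>\<^bsub>A\<^esub> a = a) \<Longrightarrow> e \<odot> h2 = h2"
      using eng.IH(2) by blast
    have h: "h1 \<in> carrier M" "h2 \<in> carrier M"
      using eng.hyps unfolding unitary .
    show ?case
      using F1 F2 h smult_r_distr by (intro exI[of _ "F1 \<union> F2"]) simp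
  qed
  then obtain F where F: "finite F" "F \<subseteq> carrier A"
      "\<forall>e\<in>carrier A. (\<forall>a\<in>F. e \<otimes>\<^bsub>A\<^esub> a = a) \<longrightarrow> e \<odot> x = x"
    using x unfolding unitary by meson
  then show ?thesis
    using assms(1) unfolding has_local_units_def by meson
qed

lemma submoduleI:
  assumes "N \<subseteq> carrier M" "\<zero> \<in> N" "\<And>x y. x \<in> N \<Longrightarrow> y \<in> N \<Longrightarrow> x \<oplus> y \<in> N"
    "\<And>x. x \<in> N \<Longrightarrow> \<ominus> x \<in> N" "\<And>a x. a \<in> carrier A \<Longrightarrow> x \<in> N \<Longrightarrow> a \<odot> x \<in> N"
  shows "submodule N A M"
proof (intro submodule.intro subgroup.intro submodule_axioms.intro)
  show "inv\<^bsub>add_monoid M\<^esub> x \<in> N" if "x \<in> N" for x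
    using assms(4)[OF that] unfolding a_inv_def .
qed (use assms in simp_all)


end

text \<open>
  The module structure carried over along a bijection \<open>h\<close> of the carrier.
\<close>

definition transport_module :: "('m \<Rightarrow> 'n) \<Rightarrow> ('a, 'm, 'l) module_scheme \<Rightarrow> ('a, 'n) module" where
  "transport_module h M = (let g = the_inv_into (carrier M) h in
    \<lparr>carrier = h ` carrier M, monoid.mult = (\<lambda>x y. undefined), one = undefined,
     ring.zero = h \<zero>\<^bsub>M\<^esub>, ring.add = (\<lambda>x y. h (g x \<oplus>\<^bsub>M\<^esub> g y)), smult = (\<lambda>a x. h (a \<odot>\<^bsub>M\<^esub> g x))\<rparr>)"

context unitary_left_module
begin

context
  fixes h :: "'m \<Rightarrow> 'n"
  assumes inj: "inj_on h (carrier M)"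
begin

lemma transport_simps [simp]:
  "carrier (transport_module h M) = h ` carrier M"
  "\<zero>\<^bsub>transport_module h M\<^esub> = h \<zero>"
  "x \<in> carrier M \<Longrightarrow> y \<in> carrier M \<Longrightarrow> h x \<oplus>\<^bsub>transport_module h M\<^esub> h y = h (x \<oplus> y)"
  "x \<in> carrier M \<Longrightarrow> a \<odot>\<^bsub>transport_module h M\<^esub> h x = h (a \<odot> x)"
  using inj by (simp_all add: transport_module_def Let_def the_inv_into_f_f)

lemma transport_group: "abelian_group (transport_module h M)"
proof (rule abelian_groupI)
  fix x assume "x \<in> carrier (transport_module h M)"
  then obtain x' where "x = h x'" "x' \<in> carrier M"
    by auto
  then show "\<exists>y\<in>carrier (transport_module h M). y \<oplus>\<^bsub>transport_module h M\<^esub> x = \<zero>\<^bsub>transport_module h M\<^esub>"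
    by (intro bexI[of _ "h (\<ominus> x')"]) (auto simp: l_neg)
qed (auto simp: a_assoc intro!: imageI a_comm arg_cong[of _ _ h])

lemma transport_neg:
  assumes "x \<in> carrier M" shows "\<ominus>\<^bsub>transport_module h M\<^esub> h x = h (\<ominus> x)"
proof -
  interpret T: abelian_group "transport_module h M" by (rule transport_group)
  show ?thesis
    using assms by (intro T.minus_equality) (auto simp: l_neg)
qed

lemma transport_unitary: "unitary_left_module A (transport_module h M)"
proof -
  let ?T = "transport_module h M"
  interpret T: abelian_group ?T by (rule transport_group)
  let ?G = "{a \<odot> x | a x. a \<in> carrier A \<and> x \<in> carrier M}"
  let ?H = "{a \<odot>\<^bsub>?T\<^esub> x | a x. a \<in> carrier A \<and> x \<in> carrier ?T}"
  have G: "?G \<subseteq> carrier M"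
    using smult_closed by auto
  have gen: "h y \<in> generate (add_monoid ?T) ?H" if "y \<in> generate (add_monoid M) ?G" for y
    using that
  proof (induction rule: generate.induct)
    case one
    show ?case using generate.one[of "add_monoid ?T"] by simp
  next
    case (incl y)
    then show ?case by (intro generate.incl) force
  next
    case (inv y)
    then have "h y \<in> ?H" and y: "y \<in> carrier M"
      using G by force+
    then have "inv\<^bsub>add_monoid ?T\<^esub> h y \<in> generate (add_monoid ?T) ?H"
      by (intro generate.inv)
    then show ?case
      using transport_neg[OF y] by (simp add: a_inv_def)
  next
    case (eng y1 y2)
    then show ?case
      using generate.eng[of "h y1" "add_monoid ?T" ?H "h y2"] unitary by auto
  qed
  show ?thesis
  proof (intro unitary_left_module.intro transport_group unitary_left_module_axioms.intro)
    have "?H \<subseteq> carrier ?T"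
      using smult_closed by auto
    then have "generate (add_monoid ?T) ?H \<subseteq> carrier ?T"
      using T.add.generate_incl by simp
    moreover have "carrier ?T \<subseteq> generate (add_monoid ?T) ?H"
      using gen unitary by auto
    ultimately show "generate (add_monoid ?T) ?H = carrier ?T"
      by (rule subset_antisym)
  qed (auto simp: smult_closed smult_l_distr smult_r_distr smult_assoc)
qed

lemma transport_submodule:
  assumes "submodule N A M" shows "submodule (h ` N) A (transport_module h M)"
proof -
  interpret N: submodule N A M by (rule assms)
  interpret T: unitary_left_module A "transport_module h M" by (rule transport_unitary)
  have N: "N \<subseteq> carrier M" "\<zero> \<in> N"
    using N.subset N.one_closed by auto
  show ?thesis
  proof (rule T.submoduleI)
    fix x y assume "x \<in> h ` N" "y \<in> h ` N"
    then obtain x' y' where "x = h x'" "y = h y'" "x' \<in> N" "y' \<in> N"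
      by auto
    moreover from this have "x' \<oplus> y' \<in> N"
      using N.m_closed by auto
    ultimately show "x \<oplus>\<^bsub>transport_module h M\<^esub> y \<in> h ` N"
      using N by (auto simp: subset_iff)
  next
    fix x assume "x \<in> h ` N"
    then obtain x' where x: "x = h x'" "x' \<in> N" by auto
    moreover have "\<ominus> x' \<in> N"
      using N.m_inv_closed x by (auto simp: a_inv_def)
    ultimately show "\<ominus>\<^bsub>transport_module h M\<^esub> x \<in> h ` N"
      using N transport_neg by auto
  next
    fix a x assume "a \<in> carrier A" "x \<in> h ` N"
    then obtain x' where "x = h x'" "x' \<in> N" "a \<odot> x' \<in> N" by auto
    then show "a \<odot>\<^bsub>transport_module h M\<^esub> x \<in> h ` N"
      using N by auto
  qed (use N in auto)
qed

lemma transport_submodule_vimage: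
  assumes "submodule K A (transport_module h M)"
  shows "submodule {x \<in> carrier M. h x \<in> K} A M"
proof -
  interpret K: submodule K A "transport_module h M" by (rule assms)
  show ?thesis
  proof (rule submoduleI)
    fix x assume x: "x \<in> {x \<in> carrier M. h x \<in> K}"
    then have "\<ominus>\<^bsub>transport_module h M\<^esub> h x \<in> K"
      using K.m_inv_closed by (auto simp: a_inv_def)
    then show "\<ominus> x \<in> {x \<in> carrier M. h x \<in> K}"
      using x transport_neg by auto
  next
    fix x y assume xy: "x \<in> {x \<in> carrier M. h x \<in> K}" "y \<in> {x \<in> carrier M. h x \<in> K}"
    then have "h x \<oplus>\<^bsub>transport_module h M\<^esub> h y \<in> K"
      using K.m_closed[of "h x" "h y"] by simp
    then show "x \<oplus> y \<in> {x \<in> carrier M. h x \<in> K}"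
      using xy by simp
  next
    fix a x assume "a \<in> carrier A" and x: "x \<in> {x \<in> carrier M. h x \<in> K}"
    then have "a \<odot>\<^bsub>transport_module h M\<^esub> h x \<in> K" "a \<odot> x \<in> carrier M"
      using K.smult_closed[of a "h x"] smult_closed by auto
    then show "a \<odot> x \<in> {x \<in> carrier M. h x \<in> K}"
      using x by auto
  qed (use K.one_closed in auto)
qed

lemma transport_finitely_generated:
  assumes "finitely_generated_module A M"
  shows "finitely_generated_module A (transport_module h M)"
proof -
  obtain S where S: "finite S" "S \<subseteq> carrier M"
    "\<And>N. submodule N A M \<Longrightarrow> S \<subseteq> N \<Longrightarrow> N = carrier M"
    using assms unfolding finitely_generated_module_def by auto
  have "K = h ` carrier M" if K: "submodule K A (transport_module h M)" "h ` S \<subseteq> K" for K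
  proof -
    have "{x \<in> carrier M. h x \<in> K} = carrier M"
      by (rule S(3)) (use K S(2) transport_submodule_vimage in auto)
    moreover have "K \<subseteq> h ` carrier M"
      using submodule.axioms(1)[OF K(1)] subgroup.subset by fastforce
    ultimately show ?thesis by auto
  qed
  then show ?thesis
    unfolding finitely_generated_module_def using S by (intro exI[of _ "h ` S"]) auto
qed

lemma transport_noetherian:
  assumes "noetherian_module A (transport_module h M)"
  shows "noetherian_module A M"
  unfolding noetherian_module_def
proof (intro allI impI)
  fix N :: "nat \<Rightarrow> 'm set"
  assume N: "(\<forall>i. submodule (N i) A M) \<and> (\<forall>i. N i \<subseteq> N (Suc i))"
  then have sub: "N i \<subseteq> carrier M" for i
    using submodule.axioms(1) subgroup.subset by fastforce
  have "(\<forall>i. submodule (h ` N i) A (transport_module h M)) \<and> (\<forall>i. h ` N i \<subseteq> h ` N (Suc i))"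
    using N transport_submodule by (auto intro!: image_mono)
  with assms obtain n where "\<forall>i\<ge>n. h ` N i = h ` N n"
    unfolding noetherian_module_def by (elim allE[of _ "\<lambda>i. h ` N i"]) auto
  then show "\<exists>n. \<forall>i\<ge>n. N i = N n"
    using inj sub inj_on_image_eq_iff by metis
qed

end

end

theorem categorically_left_noetherian_any_type:
  fixes A :: "('a, 'k) ring_scheme" and M :: "('a, 'm, 'l) module_scheme"
  assumes A: "categorically_left_noetherian A" "has_local_units A" "abelian_group A"
    and mult: "\<And>a b. a \<in> carrier A \<Longrightarrow> b \<in> carrier A \<Longrightarrow> a \<otimes>\<^bsub>A\<^esub> b \<in> carrier A"
    and M: "unitary_left_module A M" "finitely_generated_module A M"
  shows "noetherian_module A M"
proof -
  interpret A: abelian_group A by (rule A(3))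
  interpret unitary_left_module A M by (rule M(1))
  obtain S where S: "finite S" "S \<subseteq> carrier M"
    "\<And>N. submodule N A M \<Longrightarrow> S \<subseteq> N \<Longrightarrow> N = carrier M"
    using M(2) unfolding finitely_generated_module_def by auto
  obtain ms where ms: "set ms = S"
    using finite_list[OF S(1)] by auto
  then have msM: "i < length ms \<Longrightarrow> ms ! i \<in> carrier M" for i
    using S(2) nth_mem by blast
  define W where "W = (UNIV :: nat set) \<rightarrow> carrier A"
  define ev where "ev c = (\<Oplus>\<^bsub>M\<^esub>i\<in>{..<length ms}. c i \<odot>\<^bsub>M\<^esub> ms ! i)" for c
  have Wc: "c i \<in> carrier A" if "c \<in> W" for c i
    using that by (auto simp: W_def)
  have evM: "ev c \<in> carrier M" if "c \<in> W" for c
    unfolding ev_def using msM Wc[OF that] smult_closed by (intro finsum_closed) auto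
  have ev_add: "ev (\<lambda>i. c i \<oplus>\<^bsub>A\<^esub> d i) = ev c \<oplus>\<^bsub>M\<^esub> ev d" if cd: "c \<in> W" "d \<in> W" for c d
  proof -
    have fin: "(\<lambda>i. c i \<odot>\<^bsub>M\<^esub> ms ! i) \<in> {..<length ms} \<rightarrow> carrier M"
      "(\<lambda>i. d i \<odot>\<^bsub>M\<^esub> ms ! i) \<in> {..<length ms} \<rightarrow> carrier M"
      using msM Wc[OF cd(1)] Wc[OF cd(2)] smult_closed by auto
    have "ev (\<lambda>i. c i \<oplus>\<^bsub>A\<^esub> d i) =
        (\<Oplus>\<^bsub>M\<^esub>i\<in>{..<length ms}. c i \<odot>\<^bsub>M\<^esub> ms ! i \<oplus>\<^bsub>M\<^esub> d i \<odot>\<^bsub>M\<^esub> ms ! i)"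
      unfolding ev_def using msM Wc[OF cd(1)] Wc[OF cd(2)] smult_closed smult_l_distr
      by (intro finsum_cong') auto
    then show ?thesis
      using finsum_addf[OF fin] by (simp add: ev_def)
  qed
  have ev_smult: "ev (\<lambda>i. a \<otimes>\<^bsub>A\<^esub> c i) = a \<odot>\<^bsub>M\<^esub> ev c" if "a \<in> carrier A" "c \<in> W" for a c
  proof -
    have "n \<le> length ms \<Longrightarrow> (\<Oplus>\<^bsub>M\<^esub>i\<in>{..<n}. (a \<otimes>\<^bsub>A\<^esub> c i) \<odot>\<^bsub>M\<^esub> ms ! i)
        = a \<odot>\<^bsub>M\<^esub> (\<Oplus>\<^bsub>M\<^esub>i\<in>{..<n}. c i \<odot>\<^bsub>M\<^esub> ms ! i)" for n
    proof (induction n)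
      case 0
      show ?case using smult_r_zero[OF that(1)] by simp
    next
      case (Suc n)
      have fin: "(\<lambda>i. (a \<otimes>\<^bsub>A\<^esub> c i) \<odot>\<^bsub>M\<^esub> ms ! i) \<in> {..<n} \<rightarrow> carrier M"
        "(\<lambda>i. c i \<odot>\<^bsub>M\<^esub> ms ! i) \<in> {..<n} \<rightarrow> carrier M"
        using Suc.prems msM Wc[OF that(2)] that(1) mult smult_closed by auto
      have mn: "c n \<in> carrier A" "ms ! n \<in> carrier M"
        using Suc.prems msM Wc[OF that(2)] by auto
      show ?case
        using Suc fin mn that(1) mult
        by (simp add: lessThan_Suc finsum_insert smult_closed smult_assoc smult_r_distr finsum_closed)
    qed
    then show ?thesis by (simp add: ev_def)
  qed
  have ev_unit: "ms ! j \<in> ev ` W" if j: "j < length ms" for j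
  proof -
    obtain e where e: "e \<in> carrier A" "e \<odot>\<^bsub>M\<^esub> ms ! j = ms ! j"
      using local_unit[OF A(2) msM[OF j]] by auto
    have zero_l: "\<zero>\<^bsub>A\<^esub> \<odot>\<^bsub>M\<^esub> x = \<zero>\<^bsub>M\<^esub>" if "x \<in> carrier M" for x
      using smult_l_distr[of "\<zero>\<^bsub>A\<^esub>" "\<zero>\<^bsub>A\<^esub>" x] smult_closed[of "\<zero>\<^bsub>A\<^esub>" x] that
      by (metis A.l_zero A.zero_closed add.r_cancel_one')
    have "ev (\<lambda>i. if j = i then e else \<zero>\<^bsub>A\<^esub>) =
        (\<Oplus>\<^bsub>M\<^esub>i\<in>{..<length ms}. if j = i then ms ! i else \<zero>\<^bsub>M\<^esub>)"
      unfolding ev_def using e msM zero_l by (intro finsum_cong') auto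
    also have "\<dots> = ms ! j"
      using finsum_singleton[of j "{..<length ms}" "\<lambda>i. ms ! i"] j msM by auto
    finally show ?thesis
      using e by (intro image_eqI[where x = "\<lambda>i. if j = i then e else \<zero>\<^bsub>A\<^esub>"]) (auto simp: W_def)
  qed
  have ev_zero: "\<zero>\<^bsub>M\<^esub> \<in> ev ` W"
  proof -
    have "ev (\<lambda>i. \<zero>\<^bsub>A\<^esub>) \<oplus>\<^bsub>M\<^esub> ev (\<lambda>i. \<zero>\<^bsub>A\<^esub>) = ev (\<lambda>i. \<zero>\<^bsub>A\<^esub>)"
      using ev_add[of "\<lambda>i. \<zero>\<^bsub>A\<^esub>" "\<lambda>i. \<zero>\<^bsub>A\<^esub>"] by (simp add: W_def)
    then have "ev (\<lambda>i. \<zero>\<^bsub>A\<^esub>) = \<zero>\<^bsub>M\<^esub>"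
      using evM[of "\<lambda>i. \<zero>\<^bsub>A\<^esub>"] by (simp add: W_def)
    then show ?thesis
      by (intro image_eqI[where x = "\<lambda>i. \<zero>\<^bsub>A\<^esub>"]) (auto simp: W_def)
  qed
  have ev_plus: "x \<oplus>\<^bsub>M\<^esub> y \<in> ev ` W" if xy: "x \<in> ev ` W" "y \<in> ev ` W" for x y
  proof -
    obtain c where c: "x = ev c" "c \<in> W"
      using xy(1) by auto
    obtain d where d: "y = ev d" "d \<in> W"
      using xy(2) by auto
    show ?thesis
      using ev_add[of c d] c d by (intro image_eqI[where x = "\<lambda>i. c i \<oplus>\<^bsub>A\<^esub> d i"]) (auto simp: W_def)
  qed
  have ev_neg: "\<ominus>\<^bsub>M\<^esub> x \<in> ev ` W" if x: "x \<in> ev ` W" for x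
  proof -
    obtain c where c: "x = ev c" "c \<in> W"
      using x by auto
    then have c': "(\<lambda>i. \<ominus>\<^bsub>A\<^esub> c i) \<in> W"
      by (auto simp: W_def)
    have "ev (\<lambda>i. \<zero>\<^bsub>A\<^esub>) \<oplus>\<^bsub>M\<^esub> ev (\<lambda>i. \<zero>\<^bsub>A\<^esub>) = ev (\<lambda>i. \<zero>\<^bsub>A\<^esub>)"
      using ev_add[of "\<lambda>i. \<zero>\<^bsub>A\<^esub>" "\<lambda>i. \<zero>\<^bsub>A\<^esub>"] by (simp add: W_def)
    then have "ev (\<lambda>i. \<zero>\<^bsub>A\<^esub>) = \<zero>\<^bsub>M\<^esub>"
      using evM[of "\<lambda>i. \<zero>\<^bsub>A\<^esub>"] by (simp add: W_def)
    moreover have "ev (\<lambda>i. \<ominus>\<^bsub>A\<^esub> c i \<oplus>\<^bsub>A\<^esub> c i) = ev (\<lambda>i. \<zero>\<^bsub>A\<^esub>)"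
      using c Wc by (simp add: A.l_neg)
    ultimately have "ev (\<lambda>i. \<ominus>\<^bsub>A\<^esub> c i) \<oplus>\<^bsub>M\<^esub> ev c = \<zero>\<^bsub>M\<^esub>"
      using ev_add[OF c' c(2)] by simp
    then have "\<ominus>\<^bsub>M\<^esub> x = ev (\<lambda>i. \<ominus>\<^bsub>A\<^esub> c i)"
      using c c' evM minus_equality by metis
    then show ?thesis using c' by auto
  qed
  have "submodule (ev ` W) A M"
  proof (rule submoduleI)
    fix a x assume "a \<in> carrier A" "x \<in> ev ` W"
    then obtain c where "x = ev c" "c \<in> W" "a \<in> carrier A"
      by auto
    then show "a \<odot>\<^bsub>M\<^esub> x \<in> ev ` W"
      using ev_smult[of a c] mult by (intro image_eqI[where x = "\<lambda>i. a \<otimes>\<^bsub>A\<^esub> c i"]) (auto simp: W_def)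
  qed (use evM ev_zero ev_plus ev_neg in auto)
  then have onto: "ev ` W = carrier M"
    by (rule S(3)) (use ms ev_unit in \<open>auto simp: in_set_conv_nth\<close>)
  define h where "h x = {c \<in> W. ev c = x}" for x
  have "inj_on h (carrier M)"
  proof (rule inj_onI)
    fix x y assume "x \<in> carrier M" and xy: "h x = h y"
    then have "x \<in> ev ` W"
      by (simp add: onto)
    then obtain c where "c \<in> W" "ev c = x"
      by auto
    then have "c \<in> h x" by (simp add: h_def)
    then show "x = y" unfolding xy by (auto simp: h_def \<open>ev c = x\<close>)
  qed
  then show ?thesis
    using transport_noetherian transport_unitary transport_finitely_generated[OF _ M(2)] A(1)
    unfolding categorically_left_noetherian_def by blast
qed

section \<open>Associative algebras over a commutative ring\<close>

text \<open>
  The coefficient ring is a type of class \<open>comm_ring_1\<close>, so that \<open>1 \<noteq> 0\<close>.  An algebra over it is a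
  record of type \<open>module\<close>: its fields \<open>mult\<close> and \<open>smult\<close> are the two products, and its field \<open>one\<close>
  carries no meaning, because the algebras need not have a unit.
\<close>

definition ring_of_type :: "'r :: comm_ring_1 ring" where
  "ring_of_type = \<lparr>carrier = UNIV, monoid.mult = (*), one = 1, ring.zero = 0, ring.add = (+)\<rparr>"

definition algebra_iso ::
  "('r, 'a, 'k) module_scheme \<Rightarrow> ('r, 'b, 'l) module_scheme \<Rightarrow> ('a \<Rightarrow> 'b) set" where
  "algebra_iso A B = {h. bij_betw h (carrier A) (carrier B) \<and>
    (\<forall>x\<in>carrier A. \<forall>y\<in>carrier A.
      h (x \<oplus>\<^bsub>A\<^esub> y) = h x \<oplus>\<^bsub>B\<^esub> h y \<and> h (x \<otimes>\<^bsub>A\<^esub> y) = h x \<otimes>\<^bsub>B\<^esub> h y) \<and>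
    (\<forall>c. \<forall>x\<in>carrier A. h (c \<odot>\<^bsub>A\<^esub> x) = c \<odot>\<^bsub>B\<^esub> h x)}"

definition algebra_isomorphic ::
  "('r, 'a, 'k) module_scheme \<Rightarrow> ('r, 'b, 'l) module_scheme \<Rightarrow> bool" where
  "algebra_isomorphic A B \<longleftrightarrow> algebra_iso A B \<noteq> {}"

definition algebra_direct_sum :: "'i set \<Rightarrow> ('i \<Rightarrow> ('r, 'a) module) \<Rightarrow> ('r, 'i \<Rightarrow> 'a) module" where
  "algebra_direct_sum I A = \<lparr>
    carrier = {f \<in> (\<Pi>\<^sub>E i\<in>I. carrier (A i)). finite {i \<in> I. f i \<noteq> \<zero>\<^bsub>A i\<^esub>}},
    monoid.mult = (\<lambda>f g. \<lambda>i\<in>I. f i \<otimes>\<^bsub>A i\<^esub> g i), one = undefined,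
    ring.zero = (\<lambda>i\<in>I. \<zero>\<^bsub>A i\<^esub>), ring.add = (\<lambda>f g. \<lambda>i\<in>I. f i \<oplus>\<^bsub>A i\<^esub> g i),
    smult = (\<lambda>c f. \<lambda>i\<in>I. c \<odot>\<^bsub>A i\<^esub> f i)\<rparr>"

definition algebra_binary_sum :: "('r, 'a) module \<Rightarrow> ('r, 'b) module \<Rightarrow> ('r, 'a \<times> 'b) module" where
  "algebra_binary_sum A B = \<lparr>
    carrier = carrier A \<times> carrier B,
    monoid.mult = (\<lambda>(a, b) (a', b'). (a \<otimes>\<^bsub>A\<^esub> a', b \<otimes>\<^bsub>B\<^esub> b')), one = undefined,
    ring.zero = (\<zero>\<^bsub>A\<^esub>, \<zero>\<^bsub>B\<^esub>), ring.add = (\<lambda>(a, b) (a', b'). (a \<oplus>\<^bsub>A\<^esub> a', b \<oplus>\<^bsub>B\<^esub> b')),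
    smult = (\<lambda>c (a, b). (c \<odot>\<^bsub>A\<^esub> a, c \<odot>\<^bsub>B\<^esub> b))\<rparr>"

text \<open>
  Finitely supported \<open>B \<times> B\<close> matrices over \<open>'s\<close>, extended by zero outside \<open>B \<times> B\<close>.  The map
  \<open>\<iota>\<close> is the structure map from the coefficient ring to \<open>'s\<close>.
\<close>

definition matrix_algebra :: "('r \<Rightarrow> 's :: comm_ring_1) \<Rightarrow> 'x set \<Rightarrow> ('r, 'x \<Rightarrow> 'x \<Rightarrow> 's) module" where
  "matrix_algebra \<iota> B = \<lparr>
    carrier = {m. finite {(i, j). m i j \<noteq> 0} \<and> {(i, j). m i j \<noteq> 0} \<subseteq> B \<times> B},
    monoid.mult = (\<lambda>m n i j. \<Sum>k | m i k \<noteq> 0. m i k * n k j), one = undefined,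
    ring.zero = (\<lambda>i j. 0), ring.add = (\<lambda>m n i j. m i j + n i j),
    smult = (\<lambda>c m i j. \<iota> c * m i j)\<rparr>"

text \<open>
  \<open>R[x, x\<^sup>-\<^sup>1]\<close> is the group algebra of the integers, with \<open>single n c\<close> in the role of \<open>c x\<^sup>n\<close>.
\<close>

type_synonym 'r laurent = "int \<Rightarrow>\<^sub>0 'r"

subsection \<open>Algebras presented by generators and relations\<close>

datatype (generators: 'g, 'r) alg_term =
  Gen 'g
| Zero
| Neg "('g, 'r) alg_term"
| Add "('g, 'r) alg_term" "('g, 'r) alg_term"
| Mult "('g, 'r) alg_term" "('g, 'r) alg_term"
| Scale 'r "('g, 'r) alg_term"

inductive alg_axiom :: "('g, 'r :: comm_ring_1) alg_term \<Rightarrow> ('g, 'r) alg_term \<Rightarrow> bool" where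
  "alg_axiom (Add (Add s t) u) (Add s (Add t u))"
| "alg_axiom (Add s t) (Add t s)"
| "alg_axiom (Add Zero s) s"
| "alg_axiom (Add (Neg s) s) Zero"
| "alg_axiom (Mult (Mult s t) u) (Mult s (Mult t u))"
| "alg_axiom (Mult s (Add t u)) (Add (Mult s t) (Mult s u))"
| "alg_axiom (Mult (Add s t) u) (Add (Mult s u) (Mult t u))"
| "alg_axiom (Scale c (Add s t)) (Add (Scale c s) (Scale c t))"
| "alg_axiom (Scale (c + d) s) (Add (Scale c s) (Scale d s))"
| "alg_axiom (Scale (c * d) s) (Scale c (Scale d s))"
| "alg_axiom (Scale 1 s) s"
| "alg_axiom (Scale c (Mult s t)) (Mult (Scale c s) t)"
| "alg_axiom (Scale c (Mult s t)) (Mult s (Scale c t))"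

definition alg_terms :: "'g set \<Rightarrow> ('g, 'r) alg_term set" where
  "alg_terms G = {t. generators t \<subseteq> G}"

inductive presented_eq ::
  "'g set \<Rightarrow> (('g, 'r :: comm_ring_1) alg_term \<times> ('g, 'r) alg_term) set
    \<Rightarrow> ('g, 'r) alg_term \<Rightarrow> ('g, 'r) alg_term \<Rightarrow> bool"
  for G Rel where
  axiom: "\<lbrakk>alg_axiom s t; s \<in> alg_terms G; t \<in> alg_terms G\<rbrakk> \<Longrightarrow> presented_eq G Rel s t"
| relation: "\<lbrakk>(s, t) \<in> Rel; s \<in> alg_terms G; t \<in> alg_terms G\<rbrakk> \<Longrightarrow> presented_eq G Rel s t"
| refl: "s \<in> alg_terms G \<Longrightarrow> presented_eq G Rel s s"
| sym: "presented_eq G Rel s t \<Longrightarrow> presented_eq G Rel t s"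
| trans: "\<lbrakk>presented_eq G Rel s t; presented_eq G Rel t u\<rbrakk> \<Longrightarrow> presented_eq G Rel s u"
| neg: "presented_eq G Rel s s' \<Longrightarrow> presented_eq G Rel (Neg s) (Neg s')"
| add: "\<lbrakk>presented_eq G Rel s s'; presented_eq G Rel t t'\<rbrakk>
    \<Longrightarrow> presented_eq G Rel (Add s t) (Add s' t')"
| mult: "\<lbrakk>presented_eq G Rel s s'; presented_eq G Rel t t'\<rbrakk>
    \<Longrightarrow> presented_eq G Rel (Mult s t) (Mult s' t')"
| scale: "presented_eq G Rel s s' \<Longrightarrow> presented_eq G Rel (Scale c s) (Scale c s')"

text \<open>
  The algebra (not assumed unital) with generators \<open>G\<close> and relations \<open>Rel\<close>: terms over \<open>G\<close> modulo
  the least congruence that satisfies the algebra axioms and \<open>Rel\<close>.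
\<close>

definition presented_algebra ::
  "'g set \<Rightarrow> (('g, 'r :: comm_ring_1) alg_term \<times> ('g, 'r) alg_term) set
    \<Rightarrow> ('r, ('g, 'r) alg_term set) module" where
  "presented_algebra G Rel = (let eq = {(s, t). presented_eq G Rel s t} in \<lparr>
    carrier = alg_terms G // eq,
    monoid.mult = (\<lambda>P Q. \<Union>s\<in>P. \<Union>t\<in>Q. eq `` {Mult s t}), one = undefined,
    ring.zero = eq `` {Zero},
    ring.add = (\<lambda>P Q. \<Union>s\<in>P. \<Union>t\<in>Q. eq `` {Add s t}),
    smult = (\<lambda>c P. \<Union>s\<in>P. eq `` {Scale c s})\<rparr>)"

section \<open>Graphs and boundary paths\<close>

text \<open>
  Source and range of an edge are its \<open>tail\<close> and its \<open>head\<close>.  A finite path from \<open>u\<close> to \<open>v\<close> is an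
  arc walk \<open>pre_digraph.awalk E u p v\<close>; the start vertex is part of the data because \<open>p\<close> may be
  empty.
\<close>

definition is_sink :: "('v, 'e) pre_digraph \<Rightarrow> 'v \<Rightarrow> bool" where
  "is_sink E v \<longleftrightarrow> v \<in> verts E \<and> out_arcs E v = {}"

definition infinite_emitter :: "('v, 'e) pre_digraph \<Rightarrow> 'v \<Rightarrow> bool" where
  "infinite_emitter E v \<longleftrightarrow> v \<in> verts E \<and> infinite (out_arcs E v)"

definition infinite_path :: "('v, 'e) pre_digraph \<Rightarrow> (nat \<Rightarrow> 'e) \<Rightarrow> bool" where
  "infinite_path E \<alpha> \<longleftrightarrow> (\<forall>i. \<alpha> i \<in> arcs E \<and> head E (\<alpha> i) = tail E (\<alpha> (Suc i)))"

definition closed_path :: "('v, 'e) pre_digraph \<Rightarrow> 'e list \<Rightarrow> bool" where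
  "closed_path E p \<longleftrightarrow> p \<noteq> [] \<and> (\<exists>u. pre_digraph.awalk E u p u)"

definition cycle_path :: "('v, 'e) pre_digraph \<Rightarrow> 'e list \<Rightarrow> bool" where
  "cycle_path E p \<longleftrightarrow> closed_path E p \<and> distinct (map (tail E) p)"

definition ray :: "('v, 'e) pre_digraph \<Rightarrow> (nat \<Rightarrow> 'e) \<Rightarrow> bool" where
  "ray E \<alpha> \<longleftrightarrow> infinite_path E \<alpha> \<and> inj (\<lambda>i. tail E (\<alpha> i))"

definition exits_finite :: "('v, 'e) pre_digraph \<Rightarrow> 'e list \<Rightarrow> 'e set" where
  "exits_finite E p = {f \<in> arcs E. \<exists>i<length p. tail E f = tail E (p ! i) \<and> f \<noteq> p ! i}"

definition exits_infinite :: "('v, 'e) pre_digraph \<Rightarrow> (nat \<Rightarrow> 'e) \<Rightarrow> 'e set" where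
  "exits_infinite E \<alpha> = {f \<in> arcs E. \<exists>i. tail E f = tail E (\<alpha> i) \<and> f \<noteq> \<alpha> i}"

datatype ('v, 'e) bpath = Fin_path 'v "'e list" | Inf_path "nat \<Rightarrow> 'e"

definition boundary :: "('v, 'e) pre_digraph \<Rightarrow> ('v, 'e) bpath set" where
  "boundary E = {Inf_path \<alpha> | \<alpha>. infinite_path E \<alpha>} \<union>
    {Fin_path u p | u p. \<exists>v. pre_digraph.awalk E u p v \<and> (is_sink E v \<or> infinite_emitter E v)}"

fun bpath_source :: "('v, 'e) pre_digraph \<Rightarrow> ('v, 'e) bpath \<Rightarrow> 'v" where
  "bpath_source E (Fin_path u p) = u"
| "bpath_source E (Inf_path \<alpha>) = tail E (\<alpha> 0)"

text \<open>
  \<open>prepend u a x\<close> is the concatenation of the finite path \<open>a\<close> with source \<open>u\<close> and the path \<open>x\<close>.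
\<close>

fun prepend :: "'v \<Rightarrow> 'e list \<Rightarrow> ('v, 'e) bpath \<Rightarrow> ('v, 'e) bpath" where
  "prepend u a (Fin_path v p) = Fin_path u (a @ p)"
| "prepend u a (Inf_path \<alpha>) = Inf_path (a \<frown> \<alpha>)"

definition same_orbit :: "('v, 'e) pre_digraph \<Rightarrow> ('v, 'e) bpath \<Rightarrow> ('v, 'e) bpath \<Rightarrow> bool" where
  "same_orbit E p q \<longleftrightarrow> (\<exists>x\<in>boundary E. \<exists>u a v b.
    pre_digraph.awalk E u a (bpath_source E x) \<and> pre_digraph.awalk E v b (bpath_source E x) \<and>
    p = prepend u a x \<and> q = prepend v b x)"

definition orbit_of :: "('v, 'e) pre_digraph \<Rightarrow> ('v, 'e) bpath \<Rightarrow> ('v, 'e) bpath set" where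
  "orbit_of E p = {q \<in> boundary E. same_orbit E p q}"

definition eventually_periodic :: "('v, 'e) pre_digraph \<Rightarrow> ('v, 'e) bpath \<Rightarrow> bool" where
  "eventually_periodic E p \<longleftrightarrow> (\<exists>u \<alpha> v \<epsilon>. pre_digraph.awalk E u \<alpha> v \<and>
    closed_path E \<epsilon> \<and> pre_digraph.awalk E v \<epsilon> v \<and> p = Inf_path (\<alpha> \<frown> \<epsilon>\<^sup>\<omega>))"

text \<open>
  The direct sums over orbit representatives are indexed by the orbits themselves, because each
  summand depends only on the orbit.
\<close>

definition nonperiodic_orbits :: "('v, 'e) pre_digraph \<Rightarrow> ('v, 'e) bpath set set" where
  "nonperiodic_orbits E = orbit_of E ` {p \<in> boundary E. \<not> eventually_periodic E p}"

definition periodic_orbits :: "('v, 'e) pre_digraph \<Rightarrow> ('v, 'e) bpath set set" where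
  "periodic_orbits E = orbit_of E ` {p \<in> boundary E. eventually_periodic E p}"

section \<open>Leavitt path algebras\<close>

datatype ('v, 'e) lpa_gen = Vertex 'v | Edge 'e | Ghost 'e

definition lpa_gens :: "('v, 'e) pre_digraph \<Rightarrow> ('v, 'e) lpa_gen set" where
  "lpa_gens E = Vertex ` verts E \<union> Edge ` arcs E \<union> Ghost ` arcs E"

text \<open>
  In the last relation the sum over the finite set of edges that leave \<open>v\<close> is written along an
  enumeration \<open>es\<close> of that set; different enumerations give congruent terms.
\<close>

inductive_set lpa_relations ::
  "('v, 'e) pre_digraph
    \<Rightarrow> ((('v, 'e) lpa_gen, 'r) alg_term \<times> (('v, 'e) lpa_gen, 'r) alg_term) set"
  for E :: "('v, 'e) pre_digraph" where
  vertices: "\<lbrakk>v \<in> verts E; w \<in> verts E\<rbrakk> \<Longrightarrow>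
    (Mult (Gen (Vertex v)) (Gen (Vertex w)), if v = w then Gen (Vertex v) else Zero)
      \<in> lpa_relations E"
| source_edge: "e \<in> arcs E \<Longrightarrow>
    (Mult (Gen (Vertex (tail E e))) (Gen (Edge e)), Gen (Edge e)) \<in> lpa_relations E"
| edge_range: "e \<in> arcs E \<Longrightarrow>
    (Mult (Gen (Edge e)) (Gen (Vertex (head E e))), Gen (Edge e)) \<in> lpa_relations E"
| range_ghost: "e \<in> arcs E \<Longrightarrow>
    (Mult (Gen (Vertex (head E e))) (Gen (Ghost e)), Gen (Ghost e)) \<in> lpa_relations E"
| ghost_source: "e \<in> arcs E \<Longrightarrow>
    (Mult (Gen (Ghost e)) (Gen (Vertex (tail E e))), Gen (Ghost e)) \<in> lpa_relations E"
| ghost_edge: "\<lbrakk>e \<in> arcs E; f \<in> arcs E\<rbrakk> \<Longrightarrow>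
    (Mult (Gen (Ghost e)) (Gen (Edge f)), if e = f then Gen (Vertex (head E e)) else Zero)
      \<in> lpa_relations E"
| edge_ghost_sum: "\<lbrakk>v \<in> verts E; distinct es; set es = out_arcs E v; es \<noteq> []\<rbrakk> \<Longrightarrow>
    (Gen (Vertex v), foldr (\<lambda>e. Add (Mult (Gen (Edge e)) (Gen (Ghost e)))) es Zero)
      \<in> lpa_relations E"

definition leavitt_path_algebra ::
  "('v, 'e) pre_digraph \<Rightarrow> ('r :: comm_ring_1, (('v, 'e) lpa_gen, 'r) alg_term set) module" where
  "leavitt_path_algebra E = presented_algebra (lpa_gens E) (lpa_relations E)"

end

theory Submission
  imports Defs
begin

text \<open>
  The proof follows the action of the Leavitt path algebra \<open>L\<close> on functions of boundary paths. An
  edge prepends itself to a path, a ghost edge removes itself. This representation detects that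
  elements are nonzero or distinct, which cannot be seen from the presentation.

  \<^emph>\<open>Necessity.\<close> If \<open>L\<close> is locally noetherian, then no vertex is the source of infinitely many
  finite paths that are pairwise incomparable as prefixes, because the elements \<open>a a*\<close> for such
  paths \<open>a\<close> are orthogonal idempotents, nonzero in the representation
  (\<open>prefix_antichain_not_noetherian\<close>). An infinite emitter, a cycle with an exit and a ray with
  infinitely many exits each produce such paths. Ideals of the coefficient ring are recovered from
  left ideals of a corner (\<open>locally_noetherian_coefficients\<close>).

  \<^emph>\<open>Structure.\<close> Under the three graph conditions every boundary path reaches a
  vertex from which it can be continued in one way only; call such a vertex isolated. At an
  isolated vertex the last relation reads \<open>v = e e*\<close>, so a monomial \<open>a
  b*\<close> that ends there can be prolonged and depends only on the boundary paths \<open>p = a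
  x\<close> and \<open>q = b x\<close>, where \<open>x\<close> is the unique continuation, and on
  one integer \<open>k\<close>, which counts turns around a cycle. Repeated use of \<open>v =
  \<Sum> e e*\<close> writes every vertex as a sum of such monomials; the process ends because an
  infinite path would meet an isolated vertex (\<open>wf_branching\<close>). Hence the monomials
  span \<open>L\<close> (\<open>L_unit_span\<close>), the representation shows that they are
  independent (\<open>coef_unit_el\<close>), and they multiply as matrix units indexed by the
  paths of an orbit, with \<open>k\<close> as exponent (\<open>coef_mult\<close>). If the orbit is
  not eventually periodic, only \<open>k = 0\<close> occurs; otherwise all integers do
  (\<open>triples_nonperiodic\<close>, \<open>periodic_triple\<close>). This is the isomorphism
  with matrix algebras over \<open>R\<close> and over Laurent polynomials
  (\<open>L_isomorphic_matrices\<close>).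

  \<^emph>\<open>Sufficiency.\<close> The Laurent polynomials over a noetherian ring are noetherian
  (\<open>noetherian_laurent\<close>). A column of a matrix algebra over a noetherian ring is a noetherian left
  module, because its submodules are governed by ideals of the coefficients. In a sum of matrix
  algebras every element is a sum of elements with a single nonzero row, and this makes every finitely
  generated unitary module a finite sum of quotients of columns
  (\<open>column_span_imp_categorically_noetherian\<close>).

  Categorically noetherian rings are locally noetherian
  (\<open>categorically_imp_locally_left_noetherian\<close>), which closes the circle for left modules. The
  involution that exchanges edges and ghost edges identifies \<open>L\<close> with its opposite ring and gives
  the statements for right modules (\<open>L_left_right\<close>).
\<close>

section \<open>Rings without unit and their corners\<close>

locale nonunital_ring = abelian_group A for A (structure) +
  assumes m_closed [simp, intro]: "\<lbrakk>x \<in> carrier A; y \<in> carrier A\<rbrakk> \<Longrightarrow> x \<otimes> y \<in> carrier A"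
    and m_assoc: "\<lbrakk>x \<in> carrier A; y \<in> carrier A; z \<in> carrier A\<rbrakk> \<Longrightarrow> x \<otimes> y \<otimes> z = x \<otimes> (y \<otimes> z)"
    and l_distr: "\<lbrakk>x \<in> carrier A; y \<in> carrier A; z \<in> carrier A\<rbrakk> \<Longrightarrow> (x \<oplus> y) \<otimes> z = x \<otimes> z \<oplus> y \<otimes> z"
    and r_distr: "\<lbrakk>x \<in> carrier A; y \<in> carrier A; z \<in> carrier A\<rbrakk> \<Longrightarrow> z \<otimes> (x \<oplus> y) = z \<otimes> x \<oplus> z \<otimes> y"
begin

lemma l_null [simp]: "x \<in> carrier A \<Longrightarrow> \<zero> \<otimes> x = \<zero>"
  using l_distr[of \<zero> \<zero> x] by (metis add.r_cancel_one' l_zero m_closed zero_closed)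

lemma r_null [simp]: "x \<in> carrier A \<Longrightarrow> x \<otimes> \<zero> = \<zero>"
  using r_distr[of \<zero> \<zero> x] by (metis add.r_cancel_one' l_zero m_closed zero_closed)

lemma l_minus: "\<lbrakk>x \<in> carrier A; y \<in> carrier A\<rbrakk> \<Longrightarrow> \<ominus> x \<otimes> y = \<ominus> (x \<otimes> y)"
  using l_distr[of "\<ominus> x" x y] by (simp add: l_neg minus_equality)

lemma r_minus: "\<lbrakk>x \<in> carrier A; y \<in> carrier A\<rbrakk> \<Longrightarrow> x \<otimes> \<ominus> y = \<ominus> (x \<otimes> y)"
  using r_distr[of "\<ominus> y" y x] by (simp add: l_neg minus_equality)

end

text \<open>
  Over a ring without unit, negation is not multiplication by a ring element. Here the existence
  of a left inverse replaces closure under the negation of \<open>M\<close>, which lets one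
  criterion serve for modules whose negation is computed in another structure.
\<close>

lemma submodule_iff:
  fixes M (structure)
  assumes "abelian_group M"
  shows "submodule N A M \<longleftrightarrow> N \<subseteq> carrier M \<and> \<zero> \<in> N \<and> (\<forall>x\<in>N. \<forall>y\<in>N. x \<oplus> y \<in> N) \<and>
    (\<forall>x\<in>N. \<exists>y\<in>N. y \<oplus> x = \<zero>) \<and> (\<forall>a\<in>carrier A. \<forall>x\<in>N. a \<odot> x \<in> N)" (is "?L \<longleftrightarrow> ?R")
proof -
  interpret abelian_group M by (rule assms)
  show ?thesis
  proof
    assume ?L
    then interpret submodule N A M .
    have "\<ominus> x \<in> N \<and> \<ominus> x \<oplus> x = \<zero>" if "x \<in> N" for x
    proof
      show "\<ominus> x \<in> N"
        using m_inv_closed[OF that] unfolding a_inv_def .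
      show "\<ominus> x \<oplus> x = \<zero>"
        using that subset by (intro l_neg) auto
    qed
    then show ?R
      using subset one_closed m_closed smult_closed by simp blast
  next
    assume R: ?R
    have "\<ominus> x \<in> N" if "x \<in> N" for x
      using R that minus_equality by (metis subsetD)
    then show ?L
      using R by (intro submodule.intro subgroup.intro submodule_axioms.intro) (auto simp: a_inv_def)
  qed
qed

text \<open>
  The chain condition for the submodules of \<open>M\<close> inside \<open>U\<close>, which
  spares the construction of \<open>U\<close> as a module of its own.
\<close>

definition noetherian_within ::
  "('a, 'k) ring_scheme \<Rightarrow> ('a, 'm, 'l) module_scheme \<Rightarrow> 'm set \<Rightarrow> bool" where
  "noetherian_within A M U \<longleftrightarrow>
    (\<forall>N :: nat \<Rightarrow> 'm set. (\<forall>i. submodule (N i) A M) \<and> (\<forall>i. N i \<subseteq> N (Suc i)) \<and> (\<forall>i. N i \<subseteq> U) \<longrightarrow>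
      (\<exists>n. \<forall>i\<ge>n. N i = N n))"

lemma noetherian_within_carrier:
  fixes M :: "('a, 'b, 'c) module_scheme"
  assumes "abelian_group M"
  shows "noetherian_within A M (carrier M) \<longleftrightarrow> noetherian_module A M"
proof -
  have "N \<subseteq> carrier M" if "submodule N A M" for N
    using that by (simp add: submodule_iff[OF assms])
  then have "(\<forall>i. submodule (N i) A M) \<and> (\<forall>i. N i \<subseteq> N (Suc i)) \<and> (\<forall>i. N i \<subseteq> carrier M) \<longleftrightarrow>
      (\<forall>i. submodule (N i) A M) \<and> (\<forall>i. N i \<subseteq> N (Suc i))" for N :: "nat \<Rightarrow> 'b set"
    by blast
  then show ?thesis
    unfolding noetherian_within_def noetherian_module_def by simp
qed

lemma regular_module_simps [simp]:
  "carrier (regular_module A) = carrier A" "\<zero>\<^bsub>regular_module A\<^esub> = \<zero>\<^bsub>A\<^esub>"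
  "x \<oplus>\<^bsub>regular_module A\<^esub> y = x \<oplus>\<^bsub>A\<^esub> y" "x \<odot>\<^bsub>regular_module A\<^esub> y = x \<otimes>\<^bsub>A\<^esub> y"
  by (simp_all add: regular_module_def)

lemma corner_ring_simps [simp]:
  "carrier (corner_ring A e) = {e \<otimes>\<^bsub>A\<^esub> a \<otimes>\<^bsub>A\<^esub> e | a. a \<in> carrier A}" "\<zero>\<^bsub>corner_ring A e\<^esub> = \<zero>\<^bsub>A\<^esub>"
  "x \<oplus>\<^bsub>corner_ring A e\<^esub> y = x \<oplus>\<^bsub>A\<^esub> y" "x \<otimes>\<^bsub>corner_ring A e\<^esub> y = x \<otimes>\<^bsub>A\<^esub> y"
  by (simp_all add: corner_ring_def)

lemma opposite_ring_simps [simp]: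
  "carrier (opposite_ring A) = carrier A" "\<zero>\<^bsub>opposite_ring A\<^esub> = \<zero>\<^bsub>A\<^esub>"
  "x \<oplus>\<^bsub>opposite_ring A\<^esub> y = x \<oplus>\<^bsub>A\<^esub> y" "x \<otimes>\<^bsub>opposite_ring A\<^esub> y = y \<otimes>\<^bsub>A\<^esub> x"
  by (simp_all add: opposite_ring_def)

context nonunital_ring
begin

lemma left_inverse: "x \<in> carrier A \<Longrightarrow> \<exists>y\<in>carrier A. y \<oplus> x = \<zero>"
  using l_neg a_inv_closed by blast

lemma regular_group: "abelian_group (regular_module A)"
  by (rule abelian_groupI) (simp_all add: a_ac left_inverse)

lemma regular_submodule_iff:
  "submodule N A (regular_module A) \<longleftrightarrow> N \<subseteq> carrier A \<and> \<zero> \<in> N \<and>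
    (\<forall>x\<in>N. \<forall>y\<in>N. x \<oplus> y \<in> N) \<and> (\<forall>x\<in>N. \<exists>y\<in>N. y \<oplus> x = \<zero>) \<and>
    (\<forall>a\<in>carrier A. \<forall>x\<in>N. a \<otimes> x \<in> N)"
  using submodule_iff[OF regular_group] by simp

lemma opposite_nonunital: "nonunital_ring (opposite_ring A)"
proof -
  have "abelian_group (opposite_ring A)"
    by (rule abelian_groupI) (simp_all add: a_ac left_inverse)
  then show ?thesis
    by (intro nonunital_ring.intro nonunital_ring_axioms.intro) (auto simp: m_assoc l_distr r_distr)
qed

lemma opposite_local_units: "has_local_units A \<Longrightarrow> has_local_units (opposite_ring A)"
  unfolding has_local_units_def by (simp add: conj_commute)

lemma corner_carrier_iff:
  assumes "e \<in> carrier A" "e \<otimes> e = e"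
  shows "x \<in> carrier (corner_ring A e) \<longleftrightarrow> x \<in> carrier A \<and> e \<otimes> x = x \<and> x \<otimes> e = x"
proof
  assume "x \<in> carrier (corner_ring A e)"
  then obtain a where "x = e \<otimes> a \<otimes> e" "a \<in> carrier A" by auto
  then show "x \<in> carrier A \<and> e \<otimes> x = x \<and> x \<otimes> e = x"
    using assms by (metis m_assoc m_closed)
qed (use assms m_assoc in force)

lemma corner_nonunital:
  assumes e: "e \<in> carrier A" "e \<otimes> e = e"
  shows "nonunital_ring (corner_ring A e)"
proof -
  let ?C = "corner_ring A e"
  note [simp] = corner_carrier_iff[OF e] and [simp del] = corner_ring_simps(1)
  have mult: "x \<otimes> y \<in> carrier ?C" if "x \<in> carrier ?C" "y \<in> carrier ?C" for x y
  proof -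
    have "e \<otimes> (x \<otimes> y) = x \<otimes> y" "x \<otimes> y \<otimes> e = x \<otimes> y"
      using that e m_assoc[of e x y] m_assoc[of x y e] by simp_all
    with that show ?thesis by simp
  qed
  have add: "x \<oplus> y \<in> carrier ?C" if "x \<in> carrier ?C" "y \<in> carrier ?C" for x y
    using that e by (simp add: l_distr r_distr)
  have "abelian_group ?C"
  proof (rule abelian_groupI)
    fix x assume "x \<in> carrier ?C"
    then show "\<exists>y\<in>carrier ?C. y \<oplus>\<^bsub>?C\<^esub> x = \<zero>\<^bsub>?C\<^esub>"
      using e by (intro bexI[of _ "\<ominus> x"]) (simp_all add: l_neg r_minus l_minus)
  next
    show "x \<oplus>\<^bsub>?C\<^esub> y \<in> carrier ?C" if "x \<in> carrier ?C" "y \<in> carrier ?C" for x y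
      using add[OF that] by simp
  qed (use e in \<open>simp_all add: a_ac\<close>)
  moreover have "nonunital_ring_axioms ?C"
  proof
    show "x \<otimes>\<^bsub>?C\<^esub> y \<in> carrier ?C" if "x \<in> carrier ?C" "y \<in> carrier ?C" for x y
      using mult[OF that] by simp
  qed (simp_all add: m_assoc l_distr r_distr)
  ultimately show ?thesis
    by (rule nonunital_ring.intro)
qed

text \<open>
  The left module \<open>A e\<close> is generated by \<open>e\<close>, hence noetherian, and
  left ideals of the corner \<open>e A e\<close> embed, with their inclusions, into the
  submodules of \<open>A e\<close>.
\<close>

lemma categorically_imp_locally_left_noetherian:
  assumes cat: "categorically_left_noetherian A" and lu: "has_local_units A"
  shows "locally_left_noetherian A"
  unfolding locally_left_noetherian_def left_noetherian_def noetherian_module_def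
proof (intro ballI impI allI)
  fix e and N :: "nat \<Rightarrow> 'a set"
  assume e: "e \<in> carrier A" "e \<otimes> e = e"
  let ?C = "corner_ring A e"
  assume N: "(\<forall>i. submodule (N i) ?C (regular_module ?C)) \<and> (\<forall>i. N i \<subseteq> N (Suc i))"
  interpret C: nonunital_ring ?C by (rule corner_nonunital[OF e])
  note C = corner_carrier_iff[OF e]
  define M where "M = \<lparr>carrier = {x \<in> carrier A. x \<otimes> e = x}, monoid.mult = monoid.mult A,
    one = one A, ring.zero = \<zero>, ring.add = ring.add A, smult = monoid.mult A\<rparr>"
  have M [simp]: "carrier M = {x \<in> carrier A. x \<otimes> e = x}" "\<zero>\<^bsub>M\<^esub> = \<zero>"
      "x \<oplus>\<^bsub>M\<^esub> y = x \<oplus> y" "x \<odot>\<^bsub>M\<^esub> y = x \<otimes> y" for x y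
    by (simp_all add: M_def)
  interpret M: abelian_group M
  proof (rule abelian_groupI)
    fix x assume "x \<in> carrier M"
    then show "\<exists>y\<in>carrier M. y \<oplus>\<^bsub>M\<^esub> x = \<zero>\<^bsub>M\<^esub>"
      using e by (intro bexI[of _ "\<ominus> x"]) (auto simp: l_minus l_neg)
  qed (use e in \<open>auto simp: a_ac l_distr\<close>)
  have gen: "carrier M \<subseteq> generate (add_monoid M) {a \<odot>\<^bsub>M\<^esub> x | a x. a \<in> carrier A \<and> x \<in> carrier M}"
  proof
    fix x assume x: "x \<in> carrier M"
    then obtain u where "u \<in> carrier A" "u \<otimes> x = x"
      using lu[unfolded has_local_units_def, rule_format, of "{x}"] by auto
    with x show "x \<in> generate (add_monoid M) {a \<odot>\<^bsub>M\<^esub> x | a x. a \<in> carrier A \<and> x \<in> carrier M}"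
      by (intro generate.incl) force
  qed
  have "unitary_left_module A M"
  proof (intro unitary_left_module.intro M.abelian_group_axioms unitary_left_module_axioms.intro)
    have "{a \<odot>\<^bsub>M\<^esub> x | a x. a \<in> carrier A \<and> x \<in> carrier M} \<subseteq> carrier M"
      using e by (auto simp: m_assoc)
    then have "generate (add_monoid M) {a \<odot>\<^bsub>M\<^esub> x | a x. a \<in> carrier A \<and> x \<in> carrier M} \<subseteq> carrier M"
      using M.add.generate_incl by simp
    then show "generate (add_monoid M) {a \<odot>\<^bsub>M\<^esub> x | a x. a \<in> carrier A \<and> x \<in> carrier M} = carrier M"
      using gen by (rule subset_antisym)
  qed (use e in \<open>auto simp: m_assoc l_distr r_distr\<close>)
  moreover have "finitely_generated_module A M"
    unfolding finitely_generated_module_def submodule_iff[OF M.abelian_group_axioms]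
  proof (intro exI[of _ "{e}"] conjI allI impI; (elim conjE)?)
    fix N assume "N \<subseteq> carrier M" "\<forall>a\<in>carrier A. \<forall>x\<in>N. a \<odot>\<^bsub>M\<^esub> x \<in> N" "{e} \<subseteq> N"
    then show "N = carrier M" by fastforce
  qed (use e in auto)
  ultimately have noeth: "noetherian_module A M"
    using categorically_left_noetherian_any_type[OF cat lu abelian_group_axioms] by simp
  \<comment> \<open>A left ideal \<open>I\<close> of the corner is recovered from the largest submodule of \<open>A e\<close> whose
    product with \<open>e A\<close> lies in \<open>I\<close>.\<close>
  define U where "U i = {x \<in> carrier M. \<forall>a\<in>carrier A. e \<otimes> a \<otimes> x \<in> N i}" for i
  have NC: "N i \<subseteq> carrier ?C" "\<zero> \<in> N i" "x \<in> N i \<Longrightarrow> y \<in> N i \<Longrightarrow> x \<oplus> y \<in> N i"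
      "x \<in> N i \<Longrightarrow> \<exists>y\<in>N i. y \<oplus> x = \<zero>" "a \<in> carrier ?C \<Longrightarrow> x \<in> N i \<Longrightarrow> a \<otimes> x \<in> N i" for i x y a
    using N unfolding C.regular_submodule_iff by auto
  have Nneg: "\<ominus> x \<in> N i" if "x \<in> N i" for x i
    using NC(4)[OF that] NC(1)[of i] that C minus_equality by (metis subsetD)
  have "submodule (U i) A M" for i
    unfolding submodule_iff[OF M.abelian_group_axioms]
  proof (intro conjI ballI)
    fix a x assume ax: "a \<in> carrier A" "x \<in> U i"
    have "e \<otimes> b \<otimes> (a \<otimes> x) \<in> N i" if b: "b \<in> carrier A" for b
    proof -
      have "e \<otimes> b \<otimes> (a \<otimes> x) = e \<otimes> (b \<otimes> a) \<otimes> x" "b \<otimes> a \<in> carrier A"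
        using ax b e by (simp_all add: U_def m_assoc)
      with ax show ?thesis unfolding U_def by simp
    qed
    with ax show "a \<odot>\<^bsub>M\<^esub> x \<in> U i"
      using e by (simp add: U_def m_assoc[of a x e])
  next
    fix x assume x: "x \<in> U i"
    then show "\<exists>y\<in>U i. y \<oplus>\<^bsub>M\<^esub> x = \<zero>\<^bsub>M\<^esub>"
      using e Nneg by (intro bexI[of _ "\<ominus> x"]) (auto simp: U_def l_neg l_minus r_minus)
  qed (use e NC(2,3) in \<open>auto simp: U_def l_distr r_distr\<close>)
  moreover have "U i \<subseteq> U (Suc i)" for i
    using N by (auto simp: U_def)
  ultimately obtain n where n: "\<And>i. i \<ge> n \<Longrightarrow> U i = U n"
    using noeth unfolding noetherian_module_def by blast
  have "N i = U i \<inter> carrier ?C" for i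
  proof
    show "N i \<subseteq> U i \<inter> carrier ?C"
    proof
      fix x assume x: "x \<in> N i"
      then have xC: "x \<in> carrier A" "e \<otimes> x = x" "x \<otimes> e = x"
        using NC(1) C by blast+
      have "e \<otimes> a \<otimes> x \<in> N i" if "a \<in> carrier A" for a
      proof -
        have "e \<otimes> a \<otimes> e \<in> carrier ?C" using that by auto
        then have "e \<otimes> a \<otimes> e \<otimes> x \<in> N i" by (rule NC(5)[OF _ x])
        then show ?thesis using that xC e by (simp add: m_assoc)
      qed
      then show "x \<in> U i \<inter> carrier ?C"
        using xC C by (auto simp: U_def simp del: corner_ring_simps(1))
    qed
    show "U i \<inter> carrier ?C \<subseteq> N i"
    proof
      fix x assume x: "x \<in> U i \<inter> carrier ?C"
      then have "e \<otimes> x = x" using C[of x] by blast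
      moreover from x e have "e \<otimes> e \<otimes> x \<in> N i" unfolding U_def by blast
      ultimately have "x \<in> N i" using e by simp
      then show "x \<in> N i" by simp
    qed
  qed
  then show "\<exists>n. \<forall>i\<ge>n. N i = N n"
    using n by metis
qed

end

section \<open>Finitely generated modules and noetherian columns\<close>

lemma (in unitary_left_module) smult_l_zero:
  assumes "nonunital_ring A" "x \<in> carrier M" shows "\<zero>\<^bsub>A\<^esub> \<odot> x = \<zero>"
proof -
  interpret A: nonunital_ring A by (rule assms)
  show ?thesis
    using smult_l_distr[of "\<zero>\<^bsub>A\<^esub>" "\<zero>\<^bsub>A\<^esub>" x] smult_closed[of "\<zero>\<^bsub>A\<^esub>" x] assms(2)
    by (metis A.l_zero A.zero_closed add.r_cancel_one')
qed

lemma has_local_units_surj: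
  assumes lu: "has_local_units A" and h: "h ` carrier A = carrier B"
      "\<And>x y. \<lbrakk>x \<in> carrier A; y \<in> carrier A\<rbrakk> \<Longrightarrow> h (x \<otimes>\<^bsub>A\<^esub> y) = h x \<otimes>\<^bsub>B\<^esub> h y"
  shows "has_local_units B"
  unfolding has_local_units_def
proof (intro allI impI)
  fix F assume "finite F \<and> F \<subseteq> carrier B"
  then obtain F' where F': "finite F'" "F' \<subseteq> carrier A" "F = h ` F'"
    using finite_subset_image[of F h "carrier A"] h(1) by auto
  then obtain e where e: "e \<in> carrier A" "e \<otimes>\<^bsub>A\<^esub> e = e" "\<forall>x\<in>F'. e \<otimes>\<^bsub>A\<^esub> x = x \<and> x \<otimes>\<^bsub>A\<^esub> e = x"
    using lu unfolding has_local_units_def by meson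
  have "h e \<otimes>\<^bsub>B\<^esub> x = x \<and> x \<otimes>\<^bsub>B\<^esub> h e = x" if "x \<in> F" for x
  proof -
    obtain y where "y \<in> F'" "x = h y" "y \<in> carrier A"
      using \<open>x \<in> F\<close> F' by auto
    then show ?thesis
      using e h(2)[of e y] h(2)[of y e] by simp
  qed
  moreover have "h e \<in> carrier B" "h e \<otimes>\<^bsub>B\<^esub> h e = h e"
    using e(1,2) h(1) h(2)[of e e] by auto
  ultimately show "\<exists>e\<in>carrier B. e \<otimes>\<^bsub>B\<^esub> e = e \<and> (\<forall>x\<in>F. e \<otimes>\<^bsub>B\<^esub> x = x \<and> x \<otimes>\<^bsub>B\<^esub> e = x)"
    by blast
qed

text \<open>
  A module over \<open>B\<close> becomes a module over \<open>A\<close> by restriction along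
  \<open>h\<close>. As \<open>h\<close> is onto, the submodules are the same, so generation and
  chains can be tested over \<open>A\<close>.
\<close>

lemma categorically_left_noetherian_surj:
  fixes A :: "('a, 'k) ring_scheme" and B :: "('b, 'l) ring_scheme"
  assumes A: "nonunital_ring A" "has_local_units A" "categorically_left_noetherian A"
    and h: "h ` carrier A = carrier B"
      "\<And>x y. \<lbrakk>x \<in> carrier A; y \<in> carrier A\<rbrakk> \<Longrightarrow> h (x \<oplus>\<^bsub>A\<^esub> y) = h x \<oplus>\<^bsub>B\<^esub> h y"
      "\<And>x y. \<lbrakk>x \<in> carrier A; y \<in> carrier A\<rbrakk> \<Longrightarrow> h (x \<otimes>\<^bsub>A\<^esub> y) = h x \<otimes>\<^bsub>B\<^esub> h y"
  shows "categorically_left_noetherian B"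
  unfolding categorically_left_noetherian_def
proof (intro allI impI, elim conjE)
  interpret A: nonunital_ring A by (rule A(1))
  fix M :: "('b, (nat \<Rightarrow> 'b) set) module"
  assume M: "unitary_left_module B M" "finitely_generated_module B M"
  interpret M: unitary_left_module B M by (rule M(1))
  define M' :: "('a, (nat \<Rightarrow> 'b) set) module" where
    "M' = \<lparr>carrier = carrier M, monoid.mult = monoid.mult M, one = one M, ring.zero = \<zero>\<^bsub>M\<^esub>,
      ring.add = ring.add M, smult = (\<lambda>a x. h a \<odot>\<^bsub>M\<^esub> x)\<rparr>"
  have simps': "carrier M' = carrier M" "\<zero>\<^bsub>M'\<^esub> = \<zero>\<^bsub>M\<^esub>" "x \<oplus>\<^bsub>M'\<^esub> y = x \<oplus>\<^bsub>M\<^esub> y"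
      "a \<odot>\<^bsub>M'\<^esub> x = h a \<odot>\<^bsub>M\<^esub> x" for a x y
    by (simp_all add: M'_def)
  have hc: "h a \<in> carrier B" if "a \<in> carrier A" for a
    using that h(1) by blast
  interpret M': abelian_group M'
    by (rule abelian_groupI; unfold simps') (simp_all add: M.a_ac M.add.l_inv_ex[simplified])
  have ball: "(\<forall>a\<in>carrier A. P (h a)) \<longleftrightarrow> (\<forall>b\<in>carrier B. P b)" for P
    by (simp add: h(1)[symmetric])
  have sub: "submodule N A M' \<longleftrightarrow> submodule N B M" for N
    unfolding submodule_iff[OF M'.abelian_group_axioms] submodule_iff[OF M.abelian_group_axioms] simps'
    using ball[of "\<lambda>b. \<forall>x\<in>N. b \<odot>\<^bsub>M\<^esub> x \<in> N"] by (simp only:)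
  have "unitary_left_module_axioms A M'"
  proof
    let ?G = "{a \<odot>\<^bsub>M'\<^esub> x | a x. a \<in> carrier A \<and> x \<in> carrier M'}"
    have "?G \<subseteq> carrier M'"
      unfolding simps' using hc M.smult_closed by blast
    then have "generate (add_monoid M') ?G \<subseteq> carrier M'"
      using M'.add.generate_incl by simp
    moreover have "carrier M' \<subseteq> generate (add_monoid M') ?G"
    proof
      fix x assume x: "x \<in> carrier M'"
      then obtain b where "b \<in> carrier B" "b \<odot>\<^bsub>M\<^esub> x = x"
        using M.local_unit[OF has_local_units_surj[OF A(2) h(1,3)]] unfolding simps' by blast
      moreover from this(1) obtain a where "a \<in> carrier A" "b = h a"
        using h(1) by blast
      ultimately have "x = a \<odot>\<^bsub>M'\<^esub> x" "a \<in> carrier A"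
        unfolding simps' by simp_all
      with x show "x \<in> generate (add_monoid M') ?G"
        by (intro generate.incl) blast
    qed
    ultimately show "generate (add_monoid M') ?G = carrier M'"
      by (rule subset_antisym)
  qed (simp_all only: simps' hc h(2,3) M.smult_closed M.smult_l_distr M.smult_r_distr M.smult_assoc)
  then have "unitary_left_module A M'"
    by (intro unitary_left_module.intro M'.abelian_group_axioms)
  moreover have "finitely_generated_module A M'"
    using M(2) unfolding finitely_generated_module_def sub simps' .
  ultimately have "noetherian_module A M'"
    using categorically_left_noetherian_any_type[OF A(3,2) A.abelian_group_axioms] by simp
  then show "noetherian_module B M"
    unfolding noetherian_module_def sub .
qed

text \<open>
  Isomorphisms carry idempotents to idempotents and corners to corners.
\<close>

lemma locally_left_noetherian_bij:
  fixes A :: "('a, 'k) ring_scheme" and B :: "('b, 'l) ring_scheme"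
  assumes A: "nonunital_ring A" "nonunital_ring B" "locally_left_noetherian A"
    and h: "bij_betw h (carrier A) (carrier B)"
      "\<And>x y. \<lbrakk>x \<in> carrier A; y \<in> carrier A\<rbrakk> \<Longrightarrow> h (x \<oplus>\<^bsub>A\<^esub> y) = h x \<oplus>\<^bsub>B\<^esub> h y"
      "\<And>x y. \<lbrakk>x \<in> carrier A; y \<in> carrier A\<rbrakk> \<Longrightarrow> h (x \<otimes>\<^bsub>A\<^esub> y) = h x \<otimes>\<^bsub>B\<^esub> h y"
  shows "locally_left_noetherian B"
  unfolding locally_left_noetherian_def left_noetherian_def noetherian_module_def
proof (intro ballI impI allI)
  interpret A: nonunital_ring A by (rule A(1))
  interpret B: nonunital_ring B by (rule A(2))
  fix f and N :: "nat \<Rightarrow> 'b set"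
  assume f: "f \<in> carrier B" "f \<otimes>\<^bsub>B\<^esub> f = f"
  let ?C = "corner_ring B f"
  assume N: "(\<forall>i. submodule (N i) ?C (regular_module ?C)) \<and> (\<forall>i. N i \<subseteq> N (Suc i))"
  have im: "h ` carrier A = carrier B" and inj: "inj_on h (carrier A)"
    using h(1) by (simp_all add: bij_betw_def)
  have hc: "h a \<in> carrier B" if "a \<in> carrier A" for a
    using that im by blast
  obtain e where e: "e \<in> carrier A" "f = h e"
    using f(1) im by blast
  then have ee: "e \<otimes>\<^bsub>A\<^esub> e = e"
    using f h(3) inj by (metis A.m_closed inj_onD)
  have h0: "h \<zero>\<^bsub>A\<^esub> = \<zero>\<^bsub>B\<^esub>"
    using h(2)[of "\<zero>\<^bsub>A\<^esub>" "\<zero>\<^bsub>A\<^esub>"] hc by (metis A.l_zero A.zero_closed B.add.r_cancel_one')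
  interpret C: nonunital_ring ?C by (rule B.corner_nonunital[OF f])
  interpret D: nonunital_ring "corner_ring A e" by (rule A.corner_nonunital[OF e(1) ee])
  note C = B.corner_carrier_iff[OF f] and D = A.corner_carrier_iff[OF e(1) ee]
  note corner_ring_simps(1) [simp del]
  have CD: "h a \<in> carrier ?C \<longleftrightarrow> a \<in> carrier (corner_ring A e)" if "a \<in> carrier A" for a
    using that e inj h(3) hc unfolding C D by (metis A.m_closed inj_onD)
  have NC: "N i \<subseteq> carrier ?C" "\<zero>\<^bsub>B\<^esub> \<in> N i" "x \<in> N i \<Longrightarrow> y \<in> N i \<Longrightarrow> x \<oplus>\<^bsub>B\<^esub> y \<in> N i"
      "x \<in> N i \<Longrightarrow> \<exists>y\<in>N i. y \<oplus>\<^bsub>B\<^esub> x = \<zero>\<^bsub>B\<^esub>" "a \<in> carrier ?C \<Longrightarrow> x \<in> N i \<Longrightarrow> a \<otimes>\<^bsub>B\<^esub> x \<in> N i" for i x y a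
    using N unfolding C.regular_submodule_iff by auto
  define K where "K i = {a \<in> carrier A. h a \<in> N i}" for i
  have KD: "K i \<subseteq> carrier (corner_ring A e)" for i
    using NC(1) CD unfolding K_def by blast
  have hK: "h ` K i = N i" for i
    using NC(1)[of i] im C unfolding K_def by (auto simp: image_iff) (metis imageE subsetD)
  have "submodule (K i) (corner_ring A e) (regular_module (corner_ring A e))" for i
    unfolding D.regular_submodule_iff
  proof (intro conjI ballI KD)
    fix x assume x: "x \<in> K i"
    then obtain y where "y \<in> N i" "y \<oplus>\<^bsub>B\<^esub> h x = \<zero>\<^bsub>B\<^esub>"
      using NC(4)[of "h x"] unfolding K_def by blast
    moreover from this obtain y' where "y' \<in> K i" "y = h y'"
      using hK by blast
    ultimately show "\<exists>y\<in>K i. y \<oplus>\<^bsub>corner_ring A e\<^esub> x = \<zero>\<^bsub>corner_ring A e\<^esub>"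
      using x h(2) h0 inj unfolding K_def
      by (intro bexI[of _ y']) (auto intro: inj_onD)
  qed (use NC(2,3,5) h(2,3) h0 CD D in \<open>simp_all add: K_def\<close>)
  moreover have "\<forall>i. K i \<subseteq> K (Suc i)"
    using N unfolding K_def by blast
  ultimately obtain n where "\<forall>i\<ge>n. K i = K n"
    using A(3) e ee unfolding locally_left_noetherian_def left_noetherian_def noetherian_module_def
    by blast
  then show "\<exists>n. \<forall>i\<ge>n. N i = N n"
    using hK by metis
qed

text \<open>
  Here \<open>{x. x e = x}\<close> is the left ideal \<open>A e\<close>; for a diagonal matrix
  unit it consists of the matrices supported in one column.
\<close>

definition noetherian_column :: "('a, 'k) ring_scheme \<Rightarrow> 'a \<Rightarrow> bool" where
  "noetherian_column A e \<longleftrightarrow> e \<in> carrier A \<and> e \<otimes>\<^bsub>A\<^esub> e = e \<and>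
    noetherian_within A (regular_module A) {x \<in> carrier A. x \<otimes>\<^bsub>A\<^esub> e = x}"

text \<open>
  The last hypothesis says that \<open>h\<close> maps \<open>A e\<close> onto the column of
  \<open>h e\<close>, so a chain of submodules of that column is determined by its preimages in
  \<open>A e\<close>.
\<close>

lemma noetherian_column_hom:
  assumes A: "nonunital_ring A" and B: "nonunital_ring B"
    and h: "\<And>x. x \<in> carrier A \<Longrightarrow> h x \<in> carrier B"
      "\<And>x y. \<lbrakk>x \<in> carrier A; y \<in> carrier A\<rbrakk> \<Longrightarrow> h (x \<oplus>\<^bsub>A\<^esub> y) = h x \<oplus>\<^bsub>B\<^esub> h y"
      "\<And>x y. \<lbrakk>x \<in> carrier A; y \<in> carrier A\<rbrakk> \<Longrightarrow> h (x \<otimes>\<^bsub>A\<^esub> y) = h x \<otimes>\<^bsub>B\<^esub> h y"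
    and e: "noetherian_column A e"
    and col: "\<And>x. \<lbrakk>x \<in> carrier B; x \<otimes>\<^bsub>B\<^esub> h e = x\<rbrakk> \<Longrightarrow> x \<in> h ` carrier A"
  shows "noetherian_column B (h e)"
proof -
  interpret A: nonunital_ring A by (rule A)
  interpret B: nonunital_ring B by (rule B)
  have h0: "h \<zero>\<^bsub>A\<^esub> = \<zero>\<^bsub>B\<^esub>"
    using h(2)[of "\<zero>\<^bsub>A\<^esub>" "\<zero>\<^bsub>A\<^esub>"] h(1) by (metis A.l_zero A.zero_closed B.add.r_cancel_one')
  have eA: "e \<in> carrier A" "e \<otimes>\<^bsub>A\<^esub> e = e"
    and noeth: "noetherian_within A (regular_module A) {x \<in> carrier A. x \<otimes>\<^bsub>A\<^esub> e = x}"
    using e by (simp_all add: noetherian_column_def)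
  have "noetherian_within B (regular_module B) {x \<in> carrier B. x \<otimes>\<^bsub>B\<^esub> h e = x}"
    unfolding noetherian_within_def
  proof (intro allI impI; elim conjE)
    fix N assume N: "\<forall>i::nat. submodule (N i) B (regular_module B)" "\<forall>i. N i \<subseteq> N (Suc i)"
      "\<forall>i. N i \<subseteq> {x \<in> carrier B. x \<otimes>\<^bsub>B\<^esub> h e = x}"
    have NB: "N i \<subseteq> carrier B" "\<zero>\<^bsub>B\<^esub> \<in> N i" "x \<in> N i \<Longrightarrow> y \<in> N i \<Longrightarrow> x \<oplus>\<^bsub>B\<^esub> y \<in> N i"
        "x \<in> N i \<Longrightarrow> \<exists>y\<in>N i. y \<oplus>\<^bsub>B\<^esub> x = \<zero>\<^bsub>B\<^esub>" "a \<in> carrier B \<Longrightarrow> x \<in> N i \<Longrightarrow> a \<otimes>\<^bsub>B\<^esub> x \<in> N i" for i x y a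
      using N(1) unfolding B.regular_submodule_iff by auto
    define K where "K i = {a \<in> carrier A. a \<otimes>\<^bsub>A\<^esub> e = a \<and> h a \<in> N i}" for i
    have hK: "h ` K i = N i" for i
    proof
      show "N i \<subseteq> h ` K i"
      proof
        fix x assume x: "x \<in> N i"
        then have xe: "x \<in> carrier B" "x \<otimes>\<^bsub>B\<^esub> h e = x"
          using N(3) by blast+
        then obtain a where a: "a \<in> carrier A" "x = h a"
          using col by blast
        then have "h (a \<otimes>\<^bsub>A\<^esub> e) = x"
          using xe eA h(3) by simp
        moreover have "a \<otimes>\<^bsub>A\<^esub> e \<otimes>\<^bsub>A\<^esub> e = a \<otimes>\<^bsub>A\<^esub> e"
          using a eA by (simp add: A.m_assoc)
        ultimately show "x \<in> h ` K i"
          using x a(1) eA(1) unfolding K_def by (intro image_eqI[of _ _ "a \<otimes>\<^bsub>A\<^esub> e"]) simp_all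
      qed
    qed (auto simp: K_def)
    have hneg: "h (\<ominus>\<^bsub>A\<^esub> x) \<oplus>\<^bsub>B\<^esub> h x = \<zero>\<^bsub>B\<^esub>" if "x \<in> carrier A" for x
      using h(2)[of "\<ominus>\<^bsub>A\<^esub> x" x] that h0 by (simp add: A.l_neg)
    have "submodule (K i) A (regular_module A)" for i
      unfolding A.regular_submodule_iff
    proof (intro conjI ballI)
      fix x assume x: "x \<in> K i"
      then have x': "x \<in> carrier A" "x \<otimes>\<^bsub>A\<^esub> e = x" "h x \<in> N i"
        by (simp_all add: K_def)
      then obtain y where y: "y \<in> N i" "y \<oplus>\<^bsub>B\<^esub> h x = \<zero>\<^bsub>B\<^esub>"
        using NB(4)[of "h x"] by blast
      then have "y \<in> carrier B" using NB(1) by blast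
      then have "y = h (\<ominus>\<^bsub>A\<^esub> x)"
        using y(2) hneg[OF x'(1)] x'(1) h(1) B.add.r_cancel by (metis A.a_inv_closed)
      then have "\<ominus>\<^bsub>A\<^esub> x \<in> K i"
        using x' y(1) eA by (simp add: K_def A.l_minus)
      then show "\<exists>y\<in>K i. y \<oplus>\<^bsub>A\<^esub> x = \<zero>\<^bsub>A\<^esub>"
        using A.l_neg[OF x'(1)] by blast
    qed (use eA NB(2,3,5) h h0 in \<open>auto simp: K_def A.l_distr A.m_assoc\<close>)
    moreover have "\<forall>i. K i \<subseteq> K (Suc i)" "\<forall>i. K i \<subseteq> {x \<in> carrier A. x \<otimes>\<^bsub>A\<^esub> e = x}"
      using N(2) unfolding K_def by blast+
    ultimately obtain n where "\<forall>i\<ge>n. K i = K n"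
      using noeth unfolding noetherian_within_def by blast
    then show "\<exists>n. \<forall>i\<ge>n. N i = N n"
      using hK by metis
  qed
  then show ?thesis
    using eA h(1) h(3)[of e e] by (simp add: noetherian_column_def)
qed

text \<open>
  The additive span of the elements that some idempotent with a noetherian column fixes on the
  left. In a matrix ring these are the matrices with a single nonzero row, and every finitely
  supported matrix is a sum of such.
\<close>

inductive_set column_span :: "('a, 'k) ring_scheme \<Rightarrow> 'a set" for A where
  column: "\<lbrakk>b \<in> carrier A; noetherian_column A e; e \<otimes>\<^bsub>A\<^esub> b = b\<rbrakk> \<Longrightarrow> b \<in> column_span A"
| zero: "\<zero>\<^bsub>A\<^esub> \<in> column_span A"
| add: "\<lbrakk>b \<in> column_span A; c \<in> column_span A\<rbrakk> \<Longrightarrow> b \<oplus>\<^bsub>A\<^esub> c \<in> column_span A"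

context unitary_left_module
begin

text \<open>
  If \<open>e m = m\<close>, then \<open>A m\<close> is the image of \<open>A e\<close> under
  \<open>a \<mapsto> a m\<close>, so \<open>U + A m\<close> is an extension of a quotient of
  \<open>A e\<close> by \<open>U\<close>. The two chain conditions combine as they do for any
  extension.
\<close>

lemma noetherian_within_add_cyclic:
  assumes A: "nonunital_ring A"
    and U: "submodule U A M" "noetherian_within A M U"
    and e: "noetherian_column A e" and m: "m \<in> carrier M" "e \<odot> m = m"
  shows "\<exists>V. submodule V A M \<and> noetherian_within A M V \<and> U \<subseteq> V \<and> m \<in> V"
proof -
  interpret A: nonunital_ring A by (rule A)
  note sub = submodule_iff[OF abelian_group_axioms]
  have eA: "e \<in> carrier A" "e \<otimes>\<^bsub>A\<^esub> e = e"
    and noeth: "noetherian_within A (regular_module A) {x \<in> carrier A. x \<otimes>\<^bsub>A\<^esub> e = x}"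
    using e by (simp_all add: noetherian_column_def)
  have Uc: "U \<subseteq> carrier M" "\<zero> \<in> U" "x \<in> U \<Longrightarrow> y \<in> U \<Longrightarrow> x \<oplus> y \<in> U"
      "x \<in> U \<Longrightarrow> \<exists>y\<in>U. y \<oplus> x = \<zero>" "a \<in> carrier A \<Longrightarrow> x \<in> U \<Longrightarrow> a \<odot> x \<in> U" for x y a
    using U(1) unfolding sub by auto
  have UM: "u \<in> carrier M" if "u \<in> U" for u using Uc(1) that by blast
  have neg: "\<ominus> x \<in> N" if "submodule N A M" "x \<in> N" for x N
    using that submodule.axioms(1)[OF that(1)] subgroup.m_inv_closed by (fastforce simp: a_inv_def)
  have aneg: "(\<ominus>\<^bsub>A\<^esub> a) \<odot> x \<oplus> a \<odot> x = \<zero>" if "a \<in> carrier A" "x \<in> carrier M" for a x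
    using smult_l_distr[of "\<ominus>\<^bsub>A\<^esub> a" a x] that smult_l_zero[OF A] by (simp add: A.l_neg)
  define V where "V = {u \<oplus> a \<odot> m | u a. u \<in> U \<and> a \<in> carrier A}"
  have VI: "u \<oplus> a \<odot> m \<in> V" if "u \<in> U" "a \<in> carrier A" for u a
    using that unfolding V_def by blast
  have "submodule V A M"
    unfolding sub
  proof (intro conjI ballI)
    show "V \<subseteq> carrier M"
      using UM smult_closed m(1) unfolding V_def by auto
    show "\<zero> \<in> V"
      using VI[OF Uc(2) A.zero_closed] smult_l_zero[OF A m(1)] by simp
  next
    fix x y assume "x \<in> V" "y \<in> V"
    then obtain u a v b where x: "x = u \<oplus> a \<odot> m" "u \<in> U" "a \<in> carrier A"
      and y: "y = v \<oplus> b \<odot> m" "v \<in> U" "b \<in> carrier A"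
      unfolding V_def by blast
    have "x \<oplus> y = (u \<oplus> v) \<oplus> (a \<oplus>\<^bsub>A\<^esub> b) \<odot> m"
      using x y UM m(1) smult_closed by (simp add: smult_l_distr a_ac)
    then show "x \<oplus> y \<in> V"
      using VI[of "u \<oplus> v" "a \<oplus>\<^bsub>A\<^esub> b"] x y Uc(3) by simp
  next
    fix x assume "x \<in> V"
    then obtain u a where x: "x = u \<oplus> a \<odot> m" "u \<in> U" "a \<in> carrier A"
      unfolding V_def by blast
    obtain v where v: "v \<in> U" "v \<oplus> u = \<zero>" using Uc(4)[OF x(2)] by blast
    have c: "(\<ominus>\<^bsub>A\<^esub> a) \<odot> m \<in> carrier M" "a \<odot> m \<in> carrier M" "u \<in> carrier M" "v \<in> carrier M"
      using x v m(1) smult_closed UM by auto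
    have "(v \<oplus> (\<ominus>\<^bsub>A\<^esub> a) \<odot> m) \<oplus> x = (v \<oplus> u) \<oplus> ((\<ominus>\<^bsub>A\<^esub> a) \<odot> m \<oplus> a \<odot> m)"
      unfolding x(1) using c by (simp add: a_ac)
    then have "(v \<oplus> (\<ominus>\<^bsub>A\<^esub> a) \<odot> m) \<oplus> x = \<zero>"
      using aneg[OF x(3) m(1)] v(2) by simp
    then show "\<exists>y\<in>V. y \<oplus> x = \<zero>"
      using VI[OF v(1), of "\<ominus>\<^bsub>A\<^esub> a"] x(3) by blast
  next
    fix b x assume b: "b \<in> carrier A" and "x \<in> V"
    then obtain u a where x: "x = u \<oplus> a \<odot> m" "u \<in> U" "a \<in> carrier A"
      unfolding V_def by blast
    have "b \<odot> x = b \<odot> u \<oplus> (b \<otimes>\<^bsub>A\<^esub> a) \<odot> m"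
      using x b UM m(1) smult_closed by (simp add: smult_r_distr smult_assoc)
    then show "b \<odot> x \<in> V"
      using VI[of "b \<odot> u" "b \<otimes>\<^bsub>A\<^esub> a"] x b Uc(5) by simp
  qed
  moreover have "noetherian_within A M V"
    unfolding noetherian_within_def
  proof (intro allI impI; elim conjE)
    fix N assume N: "\<forall>i::nat. submodule (N i) A M" "\<forall>i. N i \<subseteq> N (Suc i)" "\<forall>i. N i \<subseteq> V"
    have Nc: "N i \<subseteq> carrier M" "\<zero> \<in> N i" "x \<in> N i \<Longrightarrow> y \<in> N i \<Longrightarrow> x \<oplus> y \<in> N i"
        "x \<in> N i \<Longrightarrow> \<exists>y\<in>N i. y \<oplus> x = \<zero>" "a \<in> carrier A \<Longrightarrow> x \<in> N i \<Longrightarrow> a \<odot> x \<in> N i" for i x y a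
      using N(1) unfolding sub by auto
    have mono: "N i \<subseteq> N j" if "i \<le> j" for i j
      using N(2) that lift_Suc_mono_le[of N i j] by blast
    have "submodule (N i \<inter> U) A M" for i
        unfolding sub
    proof (intro conjI ballI)
      fix x assume x: "x \<in> N i \<inter> U"
      then have "\<ominus> x \<in> N i \<inter> U" "\<ominus> x \<oplus> x = \<zero>"
        using neg[OF N(1)[rule_format]] neg[OF U(1)] l_neg UM by auto
      then show "\<exists>y\<in>N i \<inter> U. y \<oplus> x = \<zero>" by blast
    qed (use Uc Nc in auto)
    then obtain n1 where n1: "\<And>i. i \<ge> n1 \<Longrightarrow> N i \<inter> U = N n1 \<inter> U"
      using U(2)[unfolded noetherian_within_def, rule_format, of "\<lambda>i. N i \<inter> U"] N(2) by blast
    \<comment> \<open>The coefficients \<open>a\<close> in \<open>A e\<close> for which \<open>a m\<close>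
      lies in \<open>N i\<close> up to an element of \<open>U\<close>.\<close>
    define K where "K i = {a \<in> carrier A. a \<otimes>\<^bsub>A\<^esub> e = a \<and> (\<exists>u\<in>U. u \<oplus> a \<odot> m \<in> N i)}" for i
    have "submodule (K i) A (regular_module A)" for i
      unfolding A.regular_submodule_iff
    proof (intro conjI ballI)
      show "\<zero>\<^bsub>A\<^esub> \<in> K i"
        using Nc(2) Uc(2) smult_l_zero[OF A m(1)] eA by (auto simp: K_def intro!: bexI[of _ \<zero>])
    next
      fix a b assume "a \<in> K i" "b \<in> K i"
      then obtain u v where a: "a \<in> carrier A" "a \<otimes>\<^bsub>A\<^esub> e = a" "u \<in> U" "u \<oplus> a \<odot> m \<in> N i"
        and b: "b \<in> carrier A" "b \<otimes>\<^bsub>A\<^esub> e = b" "v \<in> U" "v \<oplus> b \<odot> m \<in> N i"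
        unfolding K_def by blast
      have "(u \<oplus> a \<odot> m) \<oplus> (v \<oplus> b \<odot> m) = (u \<oplus> v) \<oplus> (a \<oplus>\<^bsub>A\<^esub> b) \<odot> m"
        using a b UM m(1) smult_closed by (simp add: smult_l_distr a_ac)
      then have "(u \<oplus> v) \<oplus> (a \<oplus>\<^bsub>A\<^esub> b) \<odot> m \<in> N i"
        using Nc(3)[OF a(4) b(4)] by simp
      then show "a \<oplus>\<^bsub>A\<^esub> b \<in> K i"
        using a b eA Uc(3)[OF a(3) b(3)] by (auto simp: K_def A.l_distr)
    next
      fix a assume "a \<in> K i"
      then obtain u where a: "a \<in> carrier A" "a \<otimes>\<^bsub>A\<^esub> e = a" "u \<in> U" "u \<oplus> a \<odot> m \<in> N i"
        unfolding K_def by blast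
      have "\<ominus> (a \<odot> m) = (\<ominus>\<^bsub>A\<^esub> a) \<odot> m"
        using aneg[OF a(1) m(1)] a(1) m(1) smult_closed by (intro minus_equality) auto
      then have "\<ominus> (u \<oplus> a \<odot> m) = \<ominus> u \<oplus> (\<ominus>\<^bsub>A\<^esub> a) \<odot> m"
        using a UM m(1) smult_closed by (simp add: minus_add)
      then have "\<ominus>\<^bsub>A\<^esub> a \<in> K i"
        using a eA neg[OF N(1)[rule_format] a(4)] neg[OF U(1) a(3)] by (auto simp: K_def A.l_minus)
      then show "\<exists>y\<in>K i. y \<oplus>\<^bsub>A\<^esub> a = \<zero>\<^bsub>A\<^esub>"
        using A.l_neg[OF a(1)] by blast
    next
      fix b a assume b: "b \<in> carrier A" and "a \<in> K i"
      then obtain u where a: "a \<in> carrier A" "a \<otimes>\<^bsub>A\<^esub> e = a" "u \<in> U" "u \<oplus> a \<odot> m \<in> N i"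
        unfolding K_def by blast
      have "b \<odot> (u \<oplus> a \<odot> m) = b \<odot> u \<oplus> (b \<otimes>\<^bsub>A\<^esub> a) \<odot> m"
        using a b UM m(1) smult_closed by (simp add: smult_r_distr smult_assoc)
      then show "b \<otimes>\<^bsub>A\<^esub> a \<in> K i"
        using a b eA Nc(5)[OF b a(4)] Uc(5)[OF b a(3)] by (auto simp: K_def A.m_assoc)
    qed (auto simp: K_def)
    moreover have "K i \<subseteq> K (Suc i)" for i
      using N(2) unfolding K_def by blast
    moreover have "K i \<subseteq> {x \<in> carrier A. x \<otimes>\<^bsub>A\<^esub> e = x}" for i
      unfolding K_def by blast
    ultimately obtain n2 where n2: "\<And>i. i \<ge> n2 \<Longrightarrow> K i = K n2"
      using noeth unfolding noetherian_within_def by blast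
    define n where "n = max n1 n2"
    have "N i \<subseteq> N n" if i: "i \<ge> n" for i
    proof
      fix x assume x: "x \<in> N i"
      then obtain u a where u: "u \<in> U" and a: "a \<in> carrier A" and xu: "x = u \<oplus> a \<odot> m"
        using N(3) unfolding V_def by blast
      have ae: "(a \<otimes>\<^bsub>A\<^esub> e) \<odot> m = a \<odot> m"
        using a eA m smult_assoc[of a e m] by simp
      have "a \<otimes>\<^bsub>A\<^esub> e \<in> K i"
        using x u xu a eA ae unfolding K_def by (auto simp: A.m_assoc)
      then have "a \<otimes>\<^bsub>A\<^esub> e \<in> K n"
        using i n2[of i] n2[of n] by (simp add: n_def)
      then obtain v where v: "v \<in> U" "v \<oplus> a \<odot> m \<in> N n"
      proof -
        assume *: "\<And>v. v \<in> U \<Longrightarrow> v \<oplus> a \<odot> m \<in> N n \<Longrightarrow> thesis"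
        assume "a \<otimes>\<^bsub>A\<^esub> e \<in> K n"
        then have "\<exists>u\<in>U. u \<oplus> a \<odot> m \<in> N n" by (simp add: K_def ae)
        with * show thesis by auto
      qed
      have c: "u \<in> carrier M" "v \<in> carrier M" "a \<odot> m \<in> carrier M"
        using u v UM a m(1) smult_closed by auto
      have "x \<oplus> \<ominus> (v \<oplus> a \<odot> m) = u \<oplus> \<ominus> v"
        unfolding xu using c by (simp add: minus_add a_ac r_neg)
      moreover have "x \<oplus> \<ominus> (v \<oplus> a \<odot> m) \<in> N i"
        using x v(2) mono[OF i] neg[OF N(1)[rule_format]] by (intro Nc(3)) auto
      moreover have "u \<oplus> \<ominus> v \<in> U"
        using u v(1) neg[OF U(1)] by (intro Uc(3))
      ultimately have "u \<oplus> \<ominus> v \<in> N n"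
        using n1[of i] n1[of n] i unfolding n_def by (metis IntD1 IntI max.bounded_iff max.cobounded1)
      then have "(u \<oplus> \<ominus> v) \<oplus> (v \<oplus> a \<odot> m) \<in> N n"
        using v(2) by (rule Nc(3))
      moreover have "(u \<oplus> \<ominus> v) \<oplus> (v \<oplus> a \<odot> m) = x"
        unfolding xu using c by (simp add: a_assoc l_neg r_neg1)
      ultimately show "x \<in> N n" by simp
    qed
    then show "\<exists>n. \<forall>i\<ge>n. N i = N n"
      using mono by blast
  qed
  moreover have "U \<subseteq> V"
  proof
    fix u assume u: "u \<in> U"
    then show "u \<in> V"
      using VI[OF u A.zero_closed] smult_l_zero[OF A m(1)] UM by simp
  qed
  moreover have "m \<in> V"
    using VI[OF Uc(2) eA(1)] m by simp
  ultimately show ?thesis by blast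
qed

end

text \<open>
  A generator \<open>s\<close> equals \<open>b s\<close> for a local unit \<open>b\<close>.
  Writing \<open>b\<close> as a sum of elements \<open>b'\<close> with \<open>e b' = b'\<close>
  exhibits the module as a finite sum of cyclic modules \<open>A (b' s)\<close>, each a quotient
  of a noetherian column.
\<close>

lemma column_span_imp_categorically_noetherian:
  assumes A: "nonunital_ring A" "has_local_units A" and span: "carrier A \<subseteq> column_span A"
  shows "categorically_left_noetherian A"
  unfolding categorically_left_noetherian_def
proof (intro allI impI, elim conjE)
  fix M :: "('a, (nat \<Rightarrow> 'a) set) module"
  assume M: "unitary_left_module A M" "finitely_generated_module A M"
  interpret A: nonunital_ring A by (rule A(1))
  interpret M: unitary_left_module A M by (rule M(1))
  note sub = submodule_iff[OF M.abelian_group_axioms]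
  have grow: "\<exists>V. submodule V A M \<and> noetherian_within A M V \<and> U \<subseteq> V \<and> b \<odot>\<^bsub>M\<^esub> x \<in> V"
    if "b \<in> column_span A" "submodule U A M" "noetherian_within A M U" "x \<in> carrier M" for b U x
    using that
  proof (induction arbitrary: U rule: column_span.induct)
    case (column b e)
    have "e \<odot>\<^bsub>M\<^esub> (b \<odot>\<^bsub>M\<^esub> x) = b \<odot>\<^bsub>M\<^esub> x" "e \<in> carrier A"
      using column M.smult_assoc[of e b x] by (auto simp: noetherian_column_def)
    then show ?case
      using M.noetherian_within_add_cyclic[OF A(1) column.prems(1,2) column.hyps(2), of "b \<odot>\<^bsub>M\<^esub> x"]
        column M.smult_closed by blast
  next
    case zero
    then show ?case
      using M.smult_l_zero[OF A(1) zero.prems(3)] unfolding sub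
      by (intro exI[of _ U]) simp
  next
    case (add b c)
    have "d \<in> carrier A" if "d \<in> column_span A" for d
      using that by (induction rule: column_span.induct) auto
    then have bc: "b \<in> carrier A" "c \<in> carrier A"
      using add.hyps by blast+
    obtain V where V: "submodule V A M" "noetherian_within A M V" "U \<subseteq> V" "b \<odot>\<^bsub>M\<^esub> x \<in> V"
      using add.IH(1)[OF add.prems] by blast
    obtain W where W: "submodule W A M" "noetherian_within A M W" "V \<subseteq> W" "c \<odot>\<^bsub>M\<^esub> x \<in> W"
      using add.IH(2)[OF V(1,2) add.prems(3)] by blast
    have "(b \<oplus>\<^bsub>A\<^esub> c) \<odot>\<^bsub>M\<^esub> x \<in> W"
      using W(1,3,4) V(4) M.smult_l_distr[OF bc add.prems(3)] unfolding sub by auto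
    then show ?case
      using V(3) W by blast
  qed
  obtain S where S: "finite S" "S \<subseteq> carrier M"
    "\<And>N. submodule N A M \<Longrightarrow> S \<subseteq> N \<Longrightarrow> N = carrier M"
    using M(2) unfolding finitely_generated_module_def by blast
  have "\<exists>V. submodule V A M \<and> noetherian_within A M V \<and> S \<subseteq> V"
    using S(1,2)
  proof (induction rule: finite_induct)
    case empty
    have "submodule {\<zero>\<^bsub>M\<^esub>} A M"
      unfolding sub using M.smult_r_zero by auto
    moreover have "noetherian_within A M {\<zero>\<^bsub>M\<^esub>}"
      unfolding noetherian_within_def
    proof (intro allI impI, elim conjE)
      fix N assume "\<forall>i::nat. submodule (N i) A M" "\<forall>i. N i \<subseteq> {\<zero>\<^bsub>M\<^esub>}"
      then have "N i = {\<zero>\<^bsub>M\<^esub>}" for i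
        unfolding sub by (intro subset_antisym) auto
      then show "\<exists>n. \<forall>i\<ge>n. N i = N n" by simp
    qed
    ultimately show ?case by blast
  next
    case (insert s S)
    then obtain U where U: "submodule U A M" "noetherian_within A M U" "S \<subseteq> U" by blast
    obtain b where b: "b \<in> carrier A" "b \<odot>\<^bsub>M\<^esub> s = s"
      using M.local_unit[OF A(2)] insert.prems by blast
    obtain V where "submodule V A M" "noetherian_within A M V" "U \<subseteq> V" "b \<odot>\<^bsub>M\<^esub> s \<in> V"
      using grow[OF _ U(1,2), of b s] b(1) span insert.prems by blast
    then show ?case
      using b(2) U(3) by auto
  qed
  then show "noetherian_module A M"
    using S(3) noetherian_within_carrier[OF M.abelian_group_axioms] by metis
qed

section \<open>Noetherian coefficients and Laurent polynomials\<close>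

definition ideal_set :: "'s :: comm_ring_1 set \<Rightarrow> bool" where
  "ideal_set I \<longleftrightarrow> 0 \<in> I \<and> (\<forall>x\<in>I. \<forall>y\<in>I. x + y \<in> I) \<and> (\<forall>x\<in>I. \<forall>c. c * x \<in> I)"

text \<open>
  The ascending chain condition on ideals, phrased for the ring of all elements of a type.
\<close>

definition noetherian_type :: "'s :: comm_ring_1 itself \<Rightarrow> bool" where
  "noetherian_type _ \<longleftrightarrow> (\<forall>N :: nat \<Rightarrow> 's set. (\<forall>i. ideal_set (N i)) \<and> (\<forall>i. N i \<subseteq> N (Suc i)) \<longrightarrow>
    (\<exists>n. \<forall>i\<ge>n. N i = N n))"

lemma ring_of_type_simps [simp]:
  "carrier ring_of_type = UNIV" "x \<oplus>\<^bsub>ring_of_type\<^esub> y = x + y" "x \<otimes>\<^bsub>ring_of_type\<^esub> y = x * y"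
  "\<zero>\<^bsub>ring_of_type\<^esub> = 0" "\<one>\<^bsub>ring_of_type\<^esub> = 1"
  by (simp_all add: ring_of_type_def)

lemma ring_of_type_cring: "cring (ring_of_type :: 's :: comm_ring_1 ring)"
proof (rule cringI)
  show "abelian_group (ring_of_type :: 's ring)"
    by (rule abelian_groupI) (auto simp: algebra_simps intro: exI[of _ "- x" for x])
  show "comm_monoid (ring_of_type :: 's ring)"
    by (rule comm_monoidI) (auto simp: algebra_simps)
qed (auto simp: algebra_simps)

interpretation ring_of_type: cring "ring_of_type :: 's :: comm_ring_1 ring"
  by (rule ring_of_type_cring)

lemma ideal_set_minus: "ideal_set I \<Longrightarrow> x \<in> I \<Longrightarrow> - x \<in> I"
  unfolding ideal_set_def by (metis mult_minus1)

lemma ring_of_type_minus: "\<ominus>\<^bsub>ring_of_type\<^esub> x = - (x :: 's :: comm_ring_1)"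
  by (rule ring_of_type.minus_equality) auto

lemma ideal_ring_of_type: "ideal I (ring_of_type :: 's :: comm_ring_1 ring) \<longleftrightarrow> ideal_set I"
proof
  assume "ideal I (ring_of_type :: 's ring)"
  then interpret ideal I "ring_of_type :: 's ring" .
  show "ideal_set I"
    using a_closed zero_closed I_l_closed unfolding ideal_set_def by auto
next
  assume I: "ideal_set I"
  have inv: "inv\<^bsub>add_monoid ring_of_type\<^esub> x = - x" for x :: 's
    using ring_of_type_minus[of x] unfolding a_inv_def .
  show "ideal I (ring_of_type :: 's ring)"
  proof (rule idealI)
    show "subgroup I (add_monoid (ring_of_type :: 's ring))"
    proof
      show "inv\<^bsub>add_monoid ring_of_type\<^esub> x \<in> I" if "x \<in> I" for x
        unfolding inv using ideal_set_minus[OF I that] .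
    qed (use I in \<open>auto simp: ideal_set_def\<close>)
  qed (use I in \<open>auto simp: ideal_set_def mult.commute ring_of_type.ring_axioms\<close>)
qed

text \<open>
  The ring locale demands that ideals be finitely generated; the two conditions are equivalent
  by the usual argument, choosing successive elements outside the ideal generated so far.
\<close>

lemma noetherian_ring_of_type:
  "noetherian_ring (ring_of_type :: 's :: comm_ring_1 ring) \<longleftrightarrow> noetherian_type TYPE('s)"
proof
  assume "noetherian_ring (ring_of_type :: 's ring)"
  then interpret noetherian_ring "ring_of_type :: 's ring" .
  show "noetherian_type TYPE('s)"
    unfolding noetherian_type_def
  proof (intro allI impI, elim conjE)
    fix N :: "nat \<Rightarrow> 's set" assume N: "\<forall>i. ideal_set (N i)" "\<forall>i. N i \<subseteq> N (Suc i)"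
    have mono: "N i \<subseteq> N j" if "i \<le> j" for i j
      using N(2) that lift_Suc_mono_le[of N i j] by blast
    have "subset.chain {I. ideal I (ring_of_type :: 's ring)} (range N)"
      unfolding subset_chain_def using N(1) mono nat_le_linear
      by (simp add: image_subset_iff ideal_ring_of_type) blast
    then have "\<Union>(range N) \<in> range N"
      by (intro ideal_chain_is_trivial) auto
    then obtain n where n: "\<Union>(range N) = N n" by blast
    have "N i = N n" if "i \<ge> n" for i
      using mono[OF that] n by blast
    then show "\<exists>n. \<forall>i\<ge>n. N i = N n" by blast
  qed
next
  assume acc: "noetherian_type TYPE('s)"
  show "noetherian_ring (ring_of_type :: 's ring)"
  proof (rule ring_of_type.noetherian_ringI, rule ccontr)
    fix I assume I: "ideal I (ring_of_type :: 's ring)"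
    let ?Idl = "genideal (ring_of_type :: 's ring)"
    assume no: "\<not> (\<exists>A\<subseteq>carrier (ring_of_type :: 's ring). finite A \<and> I = ?Idl A)"
    define F where "F = rec_nat {} (\<lambda>_ F. insert (SOME a. a \<in> I - ?Idl F) F)"
    have F: "F 0 = {}" "F (Suc n) = insert (SOME a. a \<in> I - ?Idl (F n)) (F n)" for n
      by (simp_all add: F_def)
    have sub: "?Idl S \<subseteq> I" if "S \<subseteq> I" for S
      using ring_of_type.genideal_minimal[OF I that] .
    have pick: "(SOME a. a \<in> I - ?Idl S) \<in> I - ?Idl S" if "finite S" "S \<subseteq> I" for S
    proof -
      have "\<exists>a. a \<in> I - ?Idl S"
        using no sub[OF that(2)] that(1) by auto
      then show ?thesis by (rule someI_ex)
    qed
    have FI: "finite (F n) \<and> F n \<subseteq> I" for n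
      by (induction n) (use pick F in auto)
    have "?Idl (F n) \<subseteq> ?Idl (F (Suc n))" for n
      using ring_of_type.genideal_self[of "F (Suc n)"] ring_of_type.genideal_ideal[of "F (Suc n)"]
      by (intro ring_of_type.genideal_minimal) (auto simp: F(2))
    moreover have "ideal_set (?Idl (F n))" for n
      using ring_of_type.genideal_ideal[of "F n"] by (simp add: ideal_ring_of_type)
    ultimately obtain n where "\<forall>i\<ge>n. ?Idl (F i) = ?Idl (F n)"
      using acc[unfolded noetherian_type_def, rule_format, of "\<lambda>n. ?Idl (F n)"] by blast
    then have "?Idl (F (Suc n)) = ?Idl (F n)" by (meson le_Suc_eq le_refl)
    moreover have "(SOME a. a \<in> I - ?Idl (F n)) \<in> ?Idl (F (Suc n))"
      using ring_of_type.genideal_self[of "F (Suc n)"] by (auto simp: F(2))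
    ultimately show False
      using pick FI by blast
  qed
qed

lemma lookup_times_sum:
  fixes f g :: "int \<Rightarrow>\<^sub>0 'r :: comm_ring_1"
  assumes K: "finite K" "Poly_Mapping.keys f \<subseteq> K"
  shows "Poly_Mapping.lookup (f * g) k = (\<Sum>i\<in>K. Poly_Mapping.lookup f i * Poly_Mapping.lookup g (k - i))"
proof -
  have "Sum_any (\<lambda>q. Poly_Mapping.lookup g q when k = l + q) = Poly_Mapping.lookup g (k - l)" for l
  proof -
    have "k = l + q \<longleftrightarrow> q = k - l" for q by auto
    then show ?thesis by simp
  qed
  then have "Poly_Mapping.lookup (f * g) k = Sum_any (\<lambda>l. Poly_Mapping.lookup f l * Poly_Mapping.lookup g (k - l))"
    by (simp add: times_poly_mapping.rep_eq prod_fun_def)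
  also have "\<dots> = (\<Sum>i\<in>K. Poly_Mapping.lookup f i * Poly_Mapping.lookup g (k - i))"
    using K by (intro Sum_any.expand_superset) (auto simp: in_keys_iff subset_iff dest: mult_not_zero)
  finally show ?thesis .
qed

lemma lookup_single_times:
  fixes f :: "int \<Rightarrow>\<^sub>0 'r :: comm_ring_1"
  shows "Poly_Mapping.lookup (Poly_Mapping.single n c * f) k = c * Poly_Mapping.lookup f (k - n)"
  by (subst lookup_times_sum[of "{n}"]) (auto simp: keys_single)

text \<open>
  Hilbert's basis theorem for Laurent polynomials. Multiplication by a power of the variable is
  invertible, so an ideal is determined by its members with exponents \<open>\<ge> 0\<close>,
  and for these the classical comparison of leading coefficients applies.
\<close>

lemma noetherian_laurent:
  assumes acc: "noetherian_type TYPE('r :: comm_ring_1)"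
  shows "noetherian_type TYPE('r laurent)"
  unfolding noetherian_type_def
proof (intro allI impI, elim conjE)
  fix J :: "nat \<Rightarrow> 'r laurent set"
  assume J: "\<forall>i. ideal_set (J i)" "\<forall>i. J i \<subseteq> J (Suc i)"
  have Jc: "0 \<in> J i" "f \<in> J i \<Longrightarrow> g \<in> J i \<Longrightarrow> f + g \<in> J i" "f \<in> J i \<Longrightarrow> h * f \<in> J i" for i f g h
    using J(1) unfolding ideal_set_def by auto
  have mono: "J i \<subseteq> J j" if "i \<le> j" for i j
    using J(2) that lift_Suc_mono_le[of J i j] by blast
  \<comment> \<open>The coefficients at \<open>d\<close> of those members of \<open>J i\<close> whose
    exponents lie between \<open>0\<close> and \<open>d\<close>. The family is increasing in
    both indices.\<close>
  define lead where "lead i d = {Poly_Mapping.lookup f (int d) | f. f \<in> J i \<and> Poly_Mapping.keys f \<subseteq> {0..int d}}" for i d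
  have ideal: "ideal_set (lead i d)" for i d
    unfolding ideal_set_def
  proof (intro conjI ballI allI)
    show "0 \<in> lead i d"
      using Jc(1) unfolding lead_def by (force intro: exI[of _ 0])
  next
    fix x y assume "x \<in> lead i d" "y \<in> lead i d"
    then obtain f g where "x = Poly_Mapping.lookup f (int d)" "f \<in> J i" "Poly_Mapping.keys f \<subseteq> {0..int d}"
      "y = Poly_Mapping.lookup g (int d)" "g \<in> J i" "Poly_Mapping.keys g \<subseteq> {0..int d}"
      unfolding lead_def by blast
    then show "x + y \<in> lead i d"
      using Jc(2)[of f i g] Poly_Mapping.keys_add[of f g] unfolding lead_def
      by (intro CollectI exI[of _ "f + g"]) (auto simp: lookup_add)
  next
    fix x c assume "x \<in> lead i d"
    then obtain f where f: "x = Poly_Mapping.lookup f (int d)" "f \<in> J i" "Poly_Mapping.keys f \<subseteq> {0..int d}"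
      unfolding lead_def by blast
    have "Poly_Mapping.keys (Poly_Mapping.single 0 c * f) \<subseteq> Poly_Mapping.keys f"
      by (auto simp: in_keys_iff lookup_single_times)
    then show "c * x \<in> lead i d"
      using Jc(3)[OF f(2)] f unfolding lead_def
      by (intro CollectI exI[of _ "Poly_Mapping.single 0 c * f"]) (auto simp: lookup_single_times)
  qed
  have lead_mono: "lead i d \<subseteq> lead j d'" if ij: "i \<le> j" "d \<le> d'" for i j d d'
  proof
    fix x assume "x \<in> lead i d"
    then obtain f where f: "x = Poly_Mapping.lookup f (int d)" "f \<in> J j" "Poly_Mapping.keys f \<subseteq> {0..int d}"
      using mono[OF ij(1)] unfolding lead_def by blast
    let ?g = "Poly_Mapping.single (int d' - int d) 1 * f"
    have "Poly_Mapping.keys ?g \<subseteq> {0..int d'}"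
      using f(3) ij(2) by (force simp: in_keys_iff lookup_single_times)
    then show "x \<in> lead j d'"
      using Jc(3)[OF f(2)] f(1) unfolding lead_def
      by (intro CollectI exI[of _ ?g]) (simp add: lookup_single_times)
  qed
  obtain n where n: "\<And>i. i \<ge> n \<Longrightarrow> lead i i = lead n n"
    using acc[unfolded noetherian_type_def, rule_format, of "\<lambda>i. lead i i"] ideal lead_mono by auto
  have "\<exists>s. \<forall>i\<ge>s. lead i d = lead s d" for d
    using acc[unfolded noetherian_type_def, rule_format, of "\<lambda>i. lead i d"] ideal lead_mono by auto
  then obtain s where s: "\<And>d i. i \<ge> s d \<Longrightarrow> lead i d = lead (s d) d" by metis
  \<comment> \<open>The diagonal chain settles all degrees above \<open>n\<close> at once; the finitely many
    others are treated one by one.\<close>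
  define M where "M = Max (insert n (s ` {..n}))"
  have M: "n \<le> M" "d \<le> n \<Longrightarrow> s d \<le> M" for d
    unfolding M_def by (rule Max_ge; simp)+
  have stable: "lead i d = lead M d" if i: "i \<ge> M" for i d
  proof (cases "d \<le> n")
    case True
    then have "s d \<le> M" by (rule M(2))
    then show ?thesis using s[of d i] s[of d M] i by (metis le_trans)
  next
    case False
    have "lead i d \<subseteq> lead (max i d) (max i d)" by (rule lead_mono) auto
    also have "\<dots> = lead n n" by (rule n) (use False in simp)
    also have "\<dots> \<subseteq> lead M d" using M(1) False by (intro lead_mono) auto
    finally show ?thesis using lead_mono[of M i d d] i by auto
  qed
  have low: "f \<in> J M" if "i \<ge> M" "f \<in> J i" "Poly_Mapping.keys f \<subseteq> {0..<int d}" for i f d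
    using that(2,3)
  proof (induction d arbitrary: f)
    case 0
    then have "f = 0" by simp
    then show ?case using Jc(1) by simp
  next
    case (Suc d)
    have "{0..<int (Suc d)} = {0..int d}" by auto
    then have fkeys: "Poly_Mapping.keys f \<subseteq> {0..int d}" using Suc.prems(2) by simp
    then have "Poly_Mapping.lookup f (int d) \<in> lead M d"
      using Suc.prems(1) stable[OF that(1)] unfolding lead_def by blast
    then obtain g where g: "Poly_Mapping.lookup f (int d) = Poly_Mapping.lookup g (int d)" "g \<in> J M" "Poly_Mapping.keys g \<subseteq> {0..int d}"
      unfolding lead_def by blast
    have "f - g \<in> J i"
      using Jc(2)[OF Suc.prems(1), of "-1 * g"] Jc(3)[of g i "-1"] g(2) mono[OF that(1)] by auto
    moreover have "Poly_Mapping.keys (f - g) \<subseteq> {0..<int d}"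
    proof
      fix k assume k: "k \<in> Poly_Mapping.keys (f - g)"
      then have "k \<noteq> int d" using g(1) by (auto simp: in_keys_iff lookup_minus)
      moreover have "k \<in> {0..int d}" using k fkeys g(3) keys_diff[of f g] by blast
      ultimately show "k \<in> {0..<int d}" by auto
    qed
    ultimately have "f - g \<in> J M" by (rule Suc.IH)
    then show ?case using Jc(2)[OF _ g(2), of "f - g"] by simp
  qed
  have "J i = J M" if i: "i \<ge> M" for i
  proof
    show "J M \<subseteq> J i" by (rule mono[OF i])
    show "J i \<subseteq> J M"
    proof
      fix f assume f: "f \<in> J i"
      obtain b where b: "\<And>k. k \<in> Poly_Mapping.keys f \<Longrightarrow> - b \<le> k \<and> k < b"
      proof
        fix k assume "k \<in> Poly_Mapping.keys f"
        then have "\<bar>k\<bar> \<le> Max (abs ` Poly_Mapping.keys f)" by (intro Max_ge) auto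
        then show "- (Max (abs ` Poly_Mapping.keys f) + 1) \<le> k \<and> k < Max (abs ` Poly_Mapping.keys f) + 1"
          by auto
      qed
      let ?g = "Poly_Mapping.single b 1 * f"
      have "Poly_Mapping.keys ?g \<subseteq> {0..<int (nat (2 * b))}"
        using b by (force simp: in_keys_iff lookup_single_times)
      then have "?g \<in> J M"
        using low[OF i, of ?g] Jc(3)[OF f] by blast
      then have "Poly_Mapping.single (- b) 1 * ?g \<in> J M" by (rule Jc(3))
      moreover have "Poly_Mapping.single (- b) 1 * ?g = f"
        by (simp add: mult.assoc[symmetric] mult_single)
      ultimately show "f \<in> J M" by simp
    qed
  qed
  then show "\<exists>n. \<forall>i\<ge>n. J i = J n" by blast
qed

section \<open>Matrix algebras and direct sums\<close>

lemma matrix_algebra_simps [simp]: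
  "m \<in> carrier (matrix_algebra \<iota> B) \<longleftrightarrow> finite {(i, j). m i j \<noteq> 0} \<and> {(i, j). m i j \<noteq> 0} \<subseteq> B \<times> B"
  "\<zero>\<^bsub>matrix_algebra \<iota> B\<^esub> = (\<lambda>i j. 0)"
  "m \<oplus>\<^bsub>matrix_algebra \<iota> B\<^esub> n = (\<lambda>i j. m i j + n i j)"
  "m \<otimes>\<^bsub>matrix_algebra \<iota> B\<^esub> n = (\<lambda>i j. \<Sum>k | m i k \<noteq> 0. m i k * n k j)"
  "c \<odot>\<^bsub>matrix_algebra \<iota> B\<^esub> m = (\<lambda>i j. \<iota> c * m i j)"
  by (simp_all add: matrix_algebra_def)

lemma matrix_carrierI:
  assumes "finite S" "S \<subseteq> B \<times> B" "\<And>i j. m i j \<noteq> 0 \<Longrightarrow> (i, j) \<in> S"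
  shows "m \<in> carrier (matrix_algebra \<iota> B)"
proof -
  have "{(i, j). m i j \<noteq> 0} \<subseteq> S" using assms(3) by auto
  then show ?thesis
    using finite_subset[OF _ assms(1)] subset_trans[OF _ assms(2)] by simp
qed

lemma finite_row: "finite {(i, j). m i j \<noteq> 0} \<Longrightarrow> finite {k. m i k \<noteq> (0 :: 's :: zero)}"
  by (rule finite_subset[of _ "snd ` {(i, j). m i j \<noteq> 0}"]) force+

lemma matrix_mult_sum:
  fixes m n :: "'x \<Rightarrow> 'x \<Rightarrow> 's :: comm_ring_1"
  assumes "finite K" "{k. m i k \<noteq> 0} \<subseteq> K"
  shows "(\<Sum>k | m i k \<noteq> 0. m i k * n k j) = (\<Sum>k\<in>K. m i k * n k j)"
  using assms by (intro sum.mono_neutral_left) auto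

lemma matrix_nonunital: "nonunital_ring (matrix_algebra \<iota> (B :: 'x set) :: ('r, 'x \<Rightarrow> 'x \<Rightarrow> 's :: comm_ring_1) module)"
proof -
  let ?M = "matrix_algebra \<iota> B :: ('r, 'x \<Rightarrow> 'x \<Rightarrow> 's) module"
  have add: "(\<lambda>i j. m i j + n i j) \<in> carrier ?M" if "m \<in> carrier ?M" "n \<in> carrier ?M" for m n
  proof -
    have "m i j \<noteq> 0 \<or> n i j \<noteq> 0" if "m i j + n i j \<noteq> 0" for i j
      using that by auto
    with that show ?thesis
      by (intro matrix_carrierI[of "{(i, j). m i j \<noteq> 0} \<union> {(i, j). n i j \<noteq> 0}"]) auto
  qed
  have mult: "(\<lambda>i j. \<Sum>k | m i k \<noteq> 0. m i k * n k j) \<in> carrier ?M"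
    if "m \<in> carrier ?M" "n \<in> carrier ?M" for m n
  proof (rule matrix_carrierI)
    show "finite (fst ` {(i, j). m i j \<noteq> 0} \<times> snd ` {(i, j). n i j \<noteq> 0})"
      using that by simp
    show "fst ` {(i, j). m i j \<noteq> 0} \<times> snd ` {(i, j). n i j \<noteq> 0} \<subseteq> B \<times> B"
      using that by fastforce
    fix i j assume "(\<Sum>k | m i k \<noteq> 0. m i k * n k j) \<noteq> 0"
    then obtain k where "m i k * n k j \<noteq> 0"
      by (meson sum.neutral)
    then have "m i k \<noteq> 0" "n k j \<noteq> 0" by auto
    then show "(i, j) \<in> fst ` {(i, j). m i j \<noteq> 0} \<times> snd ` {(i, j). n i j \<noteq> 0}" by force
  qed
  have "abelian_group ?M"
  proof (rule abelian_groupI)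
    fix m assume "m \<in> carrier ?M"
    then show "\<exists>n\<in>carrier ?M. n \<oplus>\<^bsub>?M\<^esub> m = \<zero>\<^bsub>?M\<^esub>"
      by (intro bexI[of _ "\<lambda>i j. - m i j"]) simp_all
  next
    show "m \<oplus>\<^bsub>?M\<^esub> n \<in> carrier ?M" if "m \<in> carrier ?M" "n \<in> carrier ?M" for m n
      using add[OF that] by simp
  qed (simp_all add: algebra_simps)
  moreover have "nonunital_ring_axioms ?M"
  proof
    show "m \<otimes>\<^bsub>?M\<^esub> n \<in> carrier ?M" if "m \<in> carrier ?M" "n \<in> carrier ?M" for m n
      using mult[OF that] by simp
  next
    fix m n l assume m: "m \<in> carrier ?M" and n: "n \<in> carrier ?M" and l: "l \<in> carrier ?M"
    show "m \<otimes>\<^bsub>?M\<^esub> n \<otimes>\<^bsub>?M\<^esub> l = m \<otimes>\<^bsub>?M\<^esub> (n \<otimes>\<^bsub>?M\<^esub> l)"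
    proof (intro ext)
      fix i j
      let ?K = "{k. m i k \<noteq> 0}" and ?K' = "snd ` {(i, j). n i j \<noteq> 0}"
      have K: "finite ?K" by (rule finite_row) (use m in simp)
      have K': "finite ?K'" by (rule finite_imageI) (use n in simp)
      have nK: "n k x \<noteq> 0 \<Longrightarrow> x \<in> ?K'" for k x by force
      have "{x. (m \<otimes>\<^bsub>?M\<^esub> n) i x \<noteq> 0} \<subseteq> ?K'"
      proof
        fix x assume "x \<in> {x. (m \<otimes>\<^bsub>?M\<^esub> n) i x \<noteq> 0}"
        then have "(\<Sum>k | m i k \<noteq> 0. m i k * n k x) \<noteq> 0" by simp
        then obtain k where "m i k * n k x \<noteq> 0" by (meson sum.neutral)
        then have "n k x \<noteq> 0" by auto
        then show "x \<in> ?K'" by (rule nK)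
      qed
      then have "(m \<otimes>\<^bsub>?M\<^esub> n \<otimes>\<^bsub>?M\<^esub> l) i j = (\<Sum>x\<in>?K'. (m \<otimes>\<^bsub>?M\<^esub> n) i x * l x j)"
        unfolding matrix_algebra_simps(4)[of _ _ "m \<otimes>\<^bsub>?M\<^esub> n" l] by (rule matrix_mult_sum[OF K'])
      also have "\<dots> = (\<Sum>x\<in>?K'. \<Sum>k\<in>?K. m i k * (n k x * l x j))"
        by (simp add: sum_distrib_right mult.assoc)
      also have "\<dots> = (\<Sum>k\<in>?K. \<Sum>x\<in>?K'. m i k * (n k x * l x j))"
        by (rule sum.swap)
      also have "\<dots> = (\<Sum>k\<in>?K. m i k * (\<Sum>x\<in>?K'. n k x * l x j))"
        by (simp add: sum_distrib_left)
      also have "\<dots> = (\<Sum>k\<in>?K. m i k * (n \<otimes>\<^bsub>?M\<^esub> l) k j)"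
      proof (rule sum.cong[OF HOL.refl])
        fix k
        have "{x. n k x \<noteq> 0} \<subseteq> ?K'" using nK by blast
        then show "m i k * (\<Sum>x\<in>?K'. n k x * l x j) = m i k * (n \<otimes>\<^bsub>?M\<^esub> l) k j"
          using matrix_mult_sum[OF K', of n k l j] by simp
      qed
      finally show "(m \<otimes>\<^bsub>?M\<^esub> n \<otimes>\<^bsub>?M\<^esub> l) i j = (m \<otimes>\<^bsub>?M\<^esub> (n \<otimes>\<^bsub>?M\<^esub> l)) i j" by simp
    qed
  next
    fix m n l assume m: "m \<in> carrier ?M" and n: "n \<in> carrier ?M" and l: "l \<in> carrier ?M"
    show "(m \<oplus>\<^bsub>?M\<^esub> n) \<otimes>\<^bsub>?M\<^esub> l = m \<otimes>\<^bsub>?M\<^esub> l \<oplus>\<^bsub>?M\<^esub> n \<otimes>\<^bsub>?M\<^esub> l"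
    proof (intro ext)
      fix i j
      let ?K = "{k. m i k \<noteq> 0} \<union> {k. n i k \<noteq> 0}"
      have K: "finite ?K" using m n finite_row[of m i] finite_row[of n i] by simp
      have "{k. m i k + n i k \<noteq> 0} \<subseteq> ?K" by auto
      then show "((m \<oplus>\<^bsub>?M\<^esub> n) \<otimes>\<^bsub>?M\<^esub> l) i j = (m \<otimes>\<^bsub>?M\<^esub> l \<oplus>\<^bsub>?M\<^esub> n \<otimes>\<^bsub>?M\<^esub> l) i j"
        using matrix_mult_sum[OF K, of "\<lambda>i j. m i j + n i j" i l j]
          matrix_mult_sum[OF K, of m i l j] matrix_mult_sum[OF K, of n i l j]
        by (simp add: distrib_right sum.distrib)
    qed
  qed (simp add: distrib_left sum.distrib)
  ultimately show ?thesis by (rule nonunital_ring.intro)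
qed

definition matrix_unit :: "'x \<Rightarrow> 'x \<Rightarrow> 's :: zero \<Rightarrow> 'x \<Rightarrow> 'x \<Rightarrow> 's" where
  "matrix_unit p q c = (\<lambda>i j. if i = p \<and> j = q then c else 0)"

lemma matrix_unit_in_carrier [simp]:
  "p \<in> B \<Longrightarrow> q \<in> B \<Longrightarrow> matrix_unit p q c \<in> carrier (matrix_algebra \<iota> B)"
  by (rule matrix_carrierI[of "{(p, q)}"]) (auto simp: matrix_unit_def split: if_splits)

lemma matrix_unit_mult:
  fixes m :: "'x \<Rightarrow> 'x \<Rightarrow> 's :: comm_ring_1"
  shows "matrix_unit p q c \<otimes>\<^bsub>matrix_algebra \<iota> B\<^esub> m = (\<lambda>i j. if i = p then c * m q j else 0)"
proof (intro ext)
  fix i j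
  show "(matrix_unit p q c \<otimes>\<^bsub>matrix_algebra \<iota> B\<^esub> m) i j = (if i = p then c * m q j else 0)"
  proof -
    have "(matrix_unit p q c \<otimes>\<^bsub>matrix_algebra \<iota> B\<^esub> m) i j = (\<Sum>k\<in>{q}. matrix_unit p q c i k * m k j)"
      unfolding matrix_algebra_simps(4)
      by (rule matrix_mult_sum) (auto simp: matrix_unit_def split: if_splits)
    then show ?thesis by (simp add: matrix_unit_def)
  qed
qed

lemma mult_matrix_unit:
  fixes m :: "'x \<Rightarrow> 'x \<Rightarrow> 's :: comm_ring_1"
  assumes "m \<in> carrier (matrix_algebra \<iota> B)"
  shows "m \<otimes>\<^bsub>matrix_algebra \<iota> B\<^esub> matrix_unit q r c = (\<lambda>i j. if j = r then m i q * c else 0)"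
proof (intro ext)
  fix i j
  have K: "finite (insert q {k. m i k \<noteq> 0})" using assms finite_row[of m i] by simp
  have "(m \<otimes>\<^bsub>matrix_algebra \<iota> B\<^esub> matrix_unit q r c) i j =
      (\<Sum>k\<in>insert q {k. m i k \<noteq> 0}. m i k * matrix_unit q r c k j)"
    unfolding matrix_algebra_simps(4) by (rule matrix_mult_sum[OF K]) auto
  also have "\<dots> = (\<Sum>k\<in>insert q {k. m i k \<noteq> 0}. if k = q then (if j = r then m i q * c else 0) else 0)"
    by (intro sum.cong) (auto simp: matrix_unit_def)
  also have "\<dots> = (if j = r then m i q * c else 0)"
    by (subst sum.delta[OF K]) simp
  finally show "(m \<otimes>\<^bsub>matrix_algebra \<iota> B\<^esub> matrix_unit q r c) i j = (if j = r then m i q * c else 0)" .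
qed

text \<open>
  A submodule of the column at \<open>p\<close> is determined by the ideal of its entries in row
  \<open>p\<close>: matrix units move every entry of the column to row \<open>p\<close> and
  back.
\<close>

lemma matrix_column_noetherian:
  fixes \<iota> :: "'r \<Rightarrow> 's :: comm_ring_1"
  assumes acc: "noetherian_type TYPE('s)" and p: "p \<in> B"
  shows "noetherian_column (matrix_algebra \<iota> B) (matrix_unit p p 1)"
proof -
  let ?M = "matrix_algebra \<iota> B"
  interpret M: nonunital_ring ?M by (rule matrix_nonunital)
  note [simp del] = matrix_algebra_simps(1,4)
  have "noetherian_within ?M (regular_module ?M) {x \<in> carrier ?M. x \<otimes>\<^bsub>?M\<^esub> matrix_unit p p 1 = x}"
    unfolding noetherian_within_def
  proof (intro allI impI; elim conjE)
    fix N assume N: "\<forall>i::nat. submodule (N i) ?M (regular_module ?M)" "\<forall>i. N i \<subseteq> N (Suc i)"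
      "\<forall>i. N i \<subseteq> {x \<in> carrier ?M. x \<otimes>\<^bsub>?M\<^esub> matrix_unit p p 1 = x}"
    have Nc: "(\<lambda>i j. 0) \<in> N i" "x \<in> N i \<Longrightarrow> y \<in> N i \<Longrightarrow> (\<lambda>i j. x i j + y i j) \<in> N i"
        "a \<in> carrier ?M \<Longrightarrow> x \<in> N i \<Longrightarrow> a \<otimes>\<^bsub>?M\<^esub> x \<in> N i" for i x y a
      using N(1) unfolding M.regular_submodule_iff by auto
    have mono: "N i \<subseteq> N j" if "i \<le> j" for i j
      using N(2) that lift_Suc_mono_le[of N i j] by blast
    define K where "K i = {c. matrix_unit p p c \<in> N i}" for i
    have "ideal_set (K i)" for i
      unfolding ideal_set_def
    proof (intro conjI ballI allI)
      show "0 \<in> K i" using Nc(1)[of i] by (simp add: K_def matrix_unit_def)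
    next
      fix c d assume "c \<in> K i" "d \<in> K i"
      then have "(\<lambda>i j. matrix_unit p p c i j + matrix_unit p p d i j) \<in> N i"
        using Nc(2) by (simp add: K_def)
      moreover have "(\<lambda>i j. matrix_unit p p c i j + matrix_unit p p d i j) = matrix_unit p p (c + d)"
        by (auto simp: matrix_unit_def fun_eq_iff)
      ultimately show "c + d \<in> K i" by (simp add: K_def)
    next
      fix c d assume "c \<in> K i"
      then have "matrix_unit p p d \<otimes>\<^bsub>?M\<^esub> matrix_unit p p c \<in> N i"
        using Nc(3) p by (simp add: K_def)
      moreover have "matrix_unit p p d \<otimes>\<^bsub>?M\<^esub> matrix_unit p p c = matrix_unit p p (d * c)"
        unfolding matrix_unit_mult by (auto simp: matrix_unit_def fun_eq_iff)
      ultimately show "d * c \<in> K i" by (simp add: K_def)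
    qed
    moreover have "K i \<subseteq> K (Suc i)" for i
      using N(2) unfolding K_def by blast
    ultimately obtain n where n: "\<And>i. i \<ge> n \<Longrightarrow> K i = K n"
      using acc[unfolded noetherian_type_def, rule_format, of K] by blast
    have "N i \<subseteq> N n" if i: "i \<ge> n" for i
    proof
      fix x assume x: "x \<in> N i"
      then have xc: "x \<in> carrier ?M" "x \<otimes>\<^bsub>?M\<^esub> matrix_unit p p 1 = x"
        using N(3) by blast+
      have x0: "x r j = 0" if "j \<noteq> p" for r j
        using fun_cong[OF fun_cong[OF xc(2)], of r j] that by (simp add: mult_matrix_unit[OF xc(1)])
      have row: "matrix_unit q p (x q p) \<in> N n" if q: "q \<in> B" for q
      proof -
        have "matrix_unit p q 1 \<otimes>\<^bsub>?M\<^esub> x = matrix_unit p p (x q p)"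
          unfolding matrix_unit_mult using x0 by (auto simp: matrix_unit_def fun_eq_iff)
        moreover have "matrix_unit p q 1 \<otimes>\<^bsub>?M\<^esub> x \<in> N i"
          using x p q by (intro Nc(3)) simp_all
        ultimately have "x q p \<in> K n"
          using n[OF i] by (auto simp: K_def)
        then have "matrix_unit q p 1 \<otimes>\<^bsub>?M\<^esub> matrix_unit p p (x q p) \<in> N n"
          using p q by (intro Nc(3)) (simp_all add: K_def)
        moreover have "matrix_unit q p 1 \<otimes>\<^bsub>?M\<^esub> matrix_unit p p (x q p) = matrix_unit q p (x q p)"
          unfolding matrix_unit_mult by (auto simp: matrix_unit_def fun_eq_iff)
        ultimately show ?thesis by simp
      qed
      have part: "finite Q \<Longrightarrow> Q \<subseteq> B \<Longrightarrow> (\<lambda>i j. if i \<in> Q then x i j else 0) \<in> N n" for Q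
      proof (induction rule: finite_induct)
        case empty
        then show ?case using Nc(1) by simp
      next
        case (insert q Q)
        then have "(\<lambda>i j. matrix_unit q p (x q p) i j + (if i \<in> Q then x i j else 0)) \<in> N n"
          using row by (intro Nc(2)) auto
        moreover have "(\<lambda>i j. matrix_unit q p (x q p) i j + (if i \<in> Q then x i j else 0)) =
            (\<lambda>i j. if i \<in> insert q Q then x i j else 0)"
          using insert.hyps x0 by (auto simp: matrix_unit_def fun_eq_iff)
        ultimately show ?case by simp
      qed
      let ?Q = "fst ` {(i, j). x i j \<noteq> 0}"
      have "finite ?Q" "?Q \<subseteq> B"
        using xc(1) by (auto simp: matrix_algebra_simps(1))
      then have "(\<lambda>i j. if i \<in> ?Q then x i j else 0) \<in> N n" by (rule part)
      moreover have "(\<lambda>i j. if i \<in> ?Q then x i j else 0) = x"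
        by (force simp: fun_eq_iff image_iff)
      ultimately show "x \<in> N n" by simp
    qed
    then show "\<exists>n. \<forall>i\<ge>n. N i = N n"
      using mono by blast
  qed
  moreover have "matrix_unit p p 1 \<otimes>\<^bsub>?M\<^esub> matrix_unit p p (1 :: 's) = matrix_unit p p 1"
    unfolding matrix_unit_mult by (auto simp: matrix_unit_def fun_eq_iff)
  ultimately show ?thesis
    using p by (simp add: noetherian_column_def)
qed

text \<open>
  Each entry is a matrix with a single nonzero row, so a finitely supported matrix is a sum of
  elements of columns.
\<close>

lemma matrix_column_span:
  fixes \<iota> :: "'r \<Rightarrow> 's :: comm_ring_1" and B :: "'x set"
  assumes "noetherian_type TYPE('s)"
  shows "carrier (matrix_algebra \<iota> B) \<subseteq> column_span (matrix_algebra \<iota> B)"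
proof
  let ?M = "matrix_algebra \<iota> B"
  note [simp del] = matrix_algebra_simps(1,4)
  fix m :: "'x \<Rightarrow> 'x \<Rightarrow> 's" assume m: "m \<in> carrier ?M"
  have "finite Q \<Longrightarrow> Q \<subseteq> B \<times> B \<Longrightarrow> (\<lambda>i j. if (i, j) \<in> Q then m i j else 0) \<in> column_span ?M" for Q
  proof (induction rule: finite_induct)
    case empty
    then show ?case using column_span.zero[of ?M] by simp
  next
    case (insert x Q)
    obtain p q where x: "x = (p, q)" by (cases x)
    then have pq: "p \<in> B" "q \<in> B" using insert.prems by auto
    have "matrix_unit p p 1 \<otimes>\<^bsub>?M\<^esub> matrix_unit p q (m p q) = matrix_unit p q (m p q)"
      unfolding matrix_unit_mult by (auto simp: matrix_unit_def fun_eq_iff)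
    from column_span.column[OF matrix_unit_in_carrier[OF pq] matrix_column_noetherian[OF assms pq(1)] this]
    have "matrix_unit p q (m p q) \<in> column_span ?M" .
    then have "matrix_unit p q (m p q) \<oplus>\<^bsub>?M\<^esub> (\<lambda>i j. if (i, j) \<in> Q then m i j else 0) \<in> column_span ?M"
      using insert by (intro column_span.add) auto
    moreover have "matrix_unit p q (m p q) \<oplus>\<^bsub>?M\<^esub> (\<lambda>i j. if (i, j) \<in> Q then m i j else 0) =
        (\<lambda>i j. if (i, j) \<in> insert x Q then m i j else 0)"
      using insert.hyps x by (auto simp: matrix_unit_def fun_eq_iff)
    ultimately show ?case by simp
  qed
  from this[of "{(i, j). m i j \<noteq> 0}"] have "(\<lambda>i j. if (i, j) \<in> {(i, j). m i j \<noteq> 0} then m i j else 0) \<in> column_span ?M"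
    using m by (simp add: matrix_algebra_simps(1))
  moreover have "(\<lambda>i j. if (i, j) \<in> {(i, j). m i j \<noteq> 0} then m i j else 0) = m"
    by (auto simp: fun_eq_iff)
  ultimately show "m \<in> column_span ?M" by simp
qed

text \<open>
  This transports column spans from a summand to a direct sum.
\<close>

lemma column_span_hom:
  assumes A: "nonunital_ring A" and B: "nonunital_ring B"
    and h: "\<And>x. x \<in> carrier A \<Longrightarrow> h x \<in> carrier B" "h \<zero>\<^bsub>A\<^esub> = \<zero>\<^bsub>B\<^esub>"
      "\<And>x y. \<lbrakk>x \<in> carrier A; y \<in> carrier A\<rbrakk> \<Longrightarrow> h (x \<oplus>\<^bsub>A\<^esub> y) = h x \<oplus>\<^bsub>B\<^esub> h y"
      "\<And>x y. \<lbrakk>x \<in> carrier A; y \<in> carrier A\<rbrakk> \<Longrightarrow> h (x \<otimes>\<^bsub>A\<^esub> y) = h x \<otimes>\<^bsub>B\<^esub> h y"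
    and col: "\<And>e x. \<lbrakk>e \<in> carrier A; x \<in> carrier B; x \<otimes>\<^bsub>B\<^esub> h e = x\<rbrakk> \<Longrightarrow> x \<in> h ` carrier A"
    and x: "x \<in> column_span A"
  shows "h x \<in> column_span B"
proof -
  interpret A: nonunital_ring A by (rule A)
  have "x \<in> carrier A \<and> h x \<in> column_span B"
    using x
  proof (induction rule: column_span.induct)
    case (column b e)
    then have e: "e \<in> carrier A" by (simp add: noetherian_column_def)
    have "noetherian_column B (h e)"
      using noetherian_column_hom[OF A B h(1,3,4) column(2)] col[OF e] by blast
    then show ?case
      using column h(1) h(4)[OF e column(1)] by (auto intro: column_span.column[where e = "h e"])
  qed (use h in \<open>auto intro: column_span.zero column_span.add\<close>)
  then show ?thesis by blast
qed

lemma direct_sum_simps [simp]: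
  "f \<in> carrier (algebra_direct_sum I A) \<longleftrightarrow> f \<in> (\<Pi>\<^sub>E i\<in>I. carrier (A i)) \<and> finite {i \<in> I. f i \<noteq> \<zero>\<^bsub>A i\<^esub>}"
  "\<zero>\<^bsub>algebra_direct_sum I A\<^esub> = (\<lambda>i\<in>I. \<zero>\<^bsub>A i\<^esub>)"
  "f \<oplus>\<^bsub>algebra_direct_sum I A\<^esub> g = (\<lambda>i\<in>I. f i \<oplus>\<^bsub>A i\<^esub> g i)"
  "f \<otimes>\<^bsub>algebra_direct_sum I A\<^esub> g = (\<lambda>i\<in>I. f i \<otimes>\<^bsub>A i\<^esub> g i)"
  "c \<odot>\<^bsub>algebra_direct_sum I A\<^esub> f = (\<lambda>i\<in>I. c \<odot>\<^bsub>A i\<^esub> f i)"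
  by (simp_all add: algebra_direct_sum_def)

lemma binary_sum_simps [simp]:
  "carrier (algebra_binary_sum A B) = carrier A \<times> carrier B"
  "\<zero>\<^bsub>algebra_binary_sum A B\<^esub> = (\<zero>\<^bsub>A\<^esub>, \<zero>\<^bsub>B\<^esub>)"
  "x \<oplus>\<^bsub>algebra_binary_sum A B\<^esub> y = (fst x \<oplus>\<^bsub>A\<^esub> fst y, snd x \<oplus>\<^bsub>B\<^esub> snd y)"
  "x \<otimes>\<^bsub>algebra_binary_sum A B\<^esub> y = (fst x \<otimes>\<^bsub>A\<^esub> fst y, snd x \<otimes>\<^bsub>B\<^esub> snd y)"
  "c \<odot>\<^bsub>algebra_binary_sum A B\<^esub> x = (c \<odot>\<^bsub>A\<^esub> fst x, c \<odot>\<^bsub>B\<^esub> snd x)"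
  by (simp_all add: algebra_binary_sum_def split: prod.splits)

lemma binary_sum_nonunital:
  assumes "nonunital_ring A" "nonunital_ring B"
  shows "nonunital_ring (algebra_binary_sum A B)"
proof -
  interpret A: nonunital_ring A by (rule assms)
  interpret B: nonunital_ring B by (rule assms)
  have "abelian_group (algebra_binary_sum A B)"
  proof (rule abelian_groupI)
    fix x assume "x \<in> carrier (algebra_binary_sum A B)"
    then show "\<exists>y\<in>carrier (algebra_binary_sum A B). y \<oplus>\<^bsub>algebra_binary_sum A B\<^esub> x = \<zero>\<^bsub>algebra_binary_sum A B\<^esub>"
      by (intro bexI[of _ "(\<ominus>\<^bsub>A\<^esub> fst x, \<ominus>\<^bsub>B\<^esub> snd x)"]) (auto simp: A.l_neg B.l_neg)
  qed (auto simp: A.a_ac B.a_ac)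
  then show ?thesis
    by (intro nonunital_ring.intro nonunital_ring_axioms.intro)
      (auto simp: A.m_assoc A.l_distr A.r_distr B.m_assoc B.l_distr B.r_distr)
qed

lemma binary_sum_column_span:
  assumes A: "nonunital_ring A" and B: "nonunital_ring B"
    and span: "carrier A \<subseteq> column_span A" "carrier B \<subseteq> column_span B"
  shows "carrier (algebra_binary_sum A B) \<subseteq> column_span (algebra_binary_sum A B)"
proof
  let ?S = "algebra_binary_sum A B"
  interpret A: nonunital_ring A by (rule A)
  interpret B: nonunital_ring B by (rule B)
  note S = binary_sum_nonunital[OF A B]
  fix x assume x: "x \<in> carrier ?S"
  have "(fst x, \<zero>\<^bsub>B\<^esub>) \<in> column_span ?S"
    by (rule column_span_hom[OF A S, of "\<lambda>a. (a, \<zero>\<^bsub>B\<^esub>)"]) (use x span in \<open>auto simp: image_iff\<close>)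
  moreover have "(\<zero>\<^bsub>A\<^esub>, snd x) \<in> column_span ?S"
    by (rule column_span_hom[OF B S, of "\<lambda>b. (\<zero>\<^bsub>A\<^esub>, b)"]) (use x span in \<open>auto simp: image_iff\<close>)
  ultimately have "(fst x, \<zero>\<^bsub>B\<^esub>) \<oplus>\<^bsub>?S\<^esub> (\<zero>\<^bsub>A\<^esub>, snd x) \<in> column_span ?S"
    by (rule column_span.add)
  then show "x \<in> column_span ?S" using x by auto
qed

lemma direct_sum_carrierI:
  assumes "\<And>i. i \<in> I \<Longrightarrow> g i \<in> carrier (A i)" "finite S" "\<And>i. i \<in> I \<Longrightarrow> i \<notin> S \<Longrightarrow> g i = \<zero>\<^bsub>A i\<^esub>"
  shows "(\<lambda>i\<in>I. g i) \<in> carrier (algebra_direct_sum I A)"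
proof -
  have "{i \<in> I. (\<lambda>i\<in>I. g i) i \<noteq> \<zero>\<^bsub>A i\<^esub>} \<subseteq> S" using assms(3) by auto
  then have "finite {i \<in> I. (\<lambda>i\<in>I. g i) i \<noteq> \<zero>\<^bsub>A i\<^esub>}"
    using assms(2) by (rule finite_subset)
  then show ?thesis using assms(1) by (simp add: PiE_iff)
qed

lemma direct_sum_carrierD:
  assumes "f \<in> carrier (algebra_direct_sum I A)"
  shows "i \<in> I \<Longrightarrow> f i \<in> carrier (A i)" "(\<lambda>i\<in>I. f i) = f" "finite {i \<in> I. f i \<noteq> \<zero>\<^bsub>A i\<^esub>}"
  using assms by (auto simp: PiE_iff extensional_restrict)

lemma direct_sum_nonunital:
  assumes A: "\<And>i. i \<in> I \<Longrightarrow> nonunital_ring (A i)"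
  shows "nonunital_ring (algebra_direct_sum I A)"
proof -
  let ?S = "algebra_direct_sum I A"
  note [simp del] = direct_sum_simps(1)
  note D = direct_sum_carrierD[where I = I and A = A]
  have gr: "abelian_group (A i)" if "i \<in> I" for i
    using A[OF that] by (rule nonunital_ring.axioms(1))
  note mon = abelian_group.axioms(1)[OF gr]
  note ax = abelian_monoid.zero_closed[OF mon] abelian_monoid.l_zero[OF mon] abelian_monoid.a_closed[OF mon]
    nonunital_ring.l_null[OF A] nonunital_ring.m_closed[OF A]
    abelian_group.a_inv_closed[OF gr] abelian_group.l_neg[OF gr]
  have neg_zero: "\<ominus>\<^bsub>A i\<^esub> \<zero>\<^bsub>A i\<^esub> = \<zero>\<^bsub>A i\<^esub>" if "i \<in> I" for i
    using abelian_group.minus_equality[OF gr[OF that]] ax(1,2)[OF that] by blast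
  have "abelian_group ?S"
  proof (rule abelian_groupI)
    fix f assume f: "f \<in> carrier ?S"
    have "(\<lambda>i\<in>I. \<ominus>\<^bsub>A i\<^esub> f i) \<in> carrier ?S"
      using D(1,3)[OF f] ax neg_zero by (intro direct_sum_carrierI[of I _ A "{i \<in> I. f i \<noteq> \<zero>\<^bsub>A i\<^esub>}"]) auto
    moreover have "(\<lambda>i\<in>I. \<ominus>\<^bsub>A i\<^esub> f i) \<oplus>\<^bsub>?S\<^esub> f = \<zero>\<^bsub>?S\<^esub>"
      unfolding direct_sum_simps(2-4) using D(1)[OF f] ax by (intro restrict_ext) simp
    ultimately show "\<exists>g\<in>carrier ?S. g \<oplus>\<^bsub>?S\<^esub> f = \<zero>\<^bsub>?S\<^esub>" by blast
    have "(\<lambda>i\<in>I. (\<lambda>i\<in>I. \<zero>\<^bsub>A i\<^esub>) i \<oplus>\<^bsub>A i\<^esub> f i) = (\<lambda>i\<in>I. f i)"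
      using D(1)[OF f] ax by (intro restrict_ext) simp
    then show "\<zero>\<^bsub>?S\<^esub> \<oplus>\<^bsub>?S\<^esub> f = f"
      using D(2)[OF f] unfolding direct_sum_simps(2-4) by simp
  next
    fix f g assume f: "f \<in> carrier ?S" and g: "g \<in> carrier ?S"
    show "f \<oplus>\<^bsub>?S\<^esub> g \<in> carrier ?S"
      unfolding direct_sum_simps(3)
      using D(1,3)[OF f] D(1,3)[OF g] ax
      by (intro direct_sum_carrierI[of I _ A "{i \<in> I. f i \<noteq> \<zero>\<^bsub>A i\<^esub>} \<union> {i \<in> I. g i \<noteq> \<zero>\<^bsub>A i\<^esub>}"]) auto
    show "f \<oplus>\<^bsub>?S\<^esub> g = g \<oplus>\<^bsub>?S\<^esub> f"
      unfolding direct_sum_simps(2-4) using D(1)[OF f] D(1)[OF g] abelian_monoid.a_comm[OF mon]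
      by (intro restrict_ext) simp
  next
    fix f g h assume f: "f \<in> carrier ?S" and g: "g \<in> carrier ?S" and h: "h \<in> carrier ?S"
    show "f \<oplus>\<^bsub>?S\<^esub> g \<oplus>\<^bsub>?S\<^esub> h = f \<oplus>\<^bsub>?S\<^esub> (g \<oplus>\<^bsub>?S\<^esub> h)"
      unfolding direct_sum_simps(2-4) using D(1)[OF f] D(1)[OF g] D(1)[OF h] abelian_monoid.a_assoc[OF mon]
      by (intro restrict_ext) simp
  next
    show "\<zero>\<^bsub>?S\<^esub> \<in> carrier ?S"
      unfolding direct_sum_simps(2) using ax by (intro direct_sum_carrierI[of I _ A "{}"]) auto
  qed
  moreover have "nonunital_ring_axioms ?S"
  proof
    fix f g assume f: "f \<in> carrier ?S" and g: "g \<in> carrier ?S"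
    show "f \<otimes>\<^bsub>?S\<^esub> g \<in> carrier ?S"
      unfolding direct_sum_simps(4) using D(1,3)[OF f] D(1)[OF g] ax
      by (intro direct_sum_carrierI[of I _ A "{i \<in> I. f i \<noteq> \<zero>\<^bsub>A i\<^esub>}"]) auto
  next
    fix f g h assume f: "f \<in> carrier ?S" and g: "g \<in> carrier ?S" and h: "h \<in> carrier ?S"
    note c = D(1)[OF f] D(1)[OF g] D(1)[OF h]
    show "f \<otimes>\<^bsub>?S\<^esub> g \<otimes>\<^bsub>?S\<^esub> h = f \<otimes>\<^bsub>?S\<^esub> (g \<otimes>\<^bsub>?S\<^esub> h)"
      unfolding direct_sum_simps(2-4) using c nonunital_ring.m_assoc[OF A] by (intro restrict_ext) simp
    show "(f \<oplus>\<^bsub>?S\<^esub> g) \<otimes>\<^bsub>?S\<^esub> h = f \<otimes>\<^bsub>?S\<^esub> h \<oplus>\<^bsub>?S\<^esub> g \<otimes>\<^bsub>?S\<^esub> h"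
      unfolding direct_sum_simps(2-4) using c nonunital_ring.l_distr[OF A] by (intro restrict_ext) simp
    show "h \<otimes>\<^bsub>?S\<^esub> (f \<oplus>\<^bsub>?S\<^esub> g) = h \<otimes>\<^bsub>?S\<^esub> f \<oplus>\<^bsub>?S\<^esub> h \<otimes>\<^bsub>?S\<^esub> g"
      unfolding direct_sum_simps(2-4) using c nonunital_ring.r_distr[OF A] by (intro restrict_ext) simp
  qed
  ultimately show ?thesis by (rule nonunital_ring.intro)
qed

lemma direct_sum_column_span:
  assumes A: "\<And>i. i \<in> I \<Longrightarrow> nonunital_ring (A i)"
    and span: "\<And>i. i \<in> I \<Longrightarrow> carrier (A i) \<subseteq> column_span (A i)"
  shows "carrier (algebra_direct_sum I A) \<subseteq> column_span (algebra_direct_sum I A)"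
proof
  let ?S = "algebra_direct_sum I A"
  have S: "nonunital_ring ?S" by (rule direct_sum_nonunital[OF A])
  have gr: "abelian_group (A i)" if "i \<in> I" for i
    using A[OF that] by (rule nonunital_ring.axioms(1))
  note zero = abelian_monoid.zero_closed[OF abelian_group.axioms(1)[OF gr]]
    abelian_monoid.l_zero[OF abelian_group.axioms(1)[OF gr]]
    abelian_monoid.r_zero[OF abelian_group.axioms(1)[OF gr]]
    nonunital_ring.l_null[OF A] nonunital_ring.r_null[OF A]
  note [simp del] = direct_sum_simps(1)
  note D = direct_sum_carrierD[where I = I and A = A]
  define inj where "inj i a = (\<lambda>j\<in>I. if j = i then a else \<zero>\<^bsub>A j\<^esub>)" for i a
  have span_inj: "inj i a \<in> column_span ?S" if i: "i \<in> I" and a: "a \<in> carrier (A i)" for i a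
  proof (rule column_span_hom[OF A[OF i] S, of "inj i"])
    show "a \<in> column_span (A i)" using span[OF i] a by blast
    show "inj i \<zero>\<^bsub>A i\<^esub> = \<zero>\<^bsub>?S\<^esub>"
      unfolding inj_def direct_sum_simps(2) by (rule restrict_ext) simp
    show "inj i x \<in> carrier ?S" if "x \<in> carrier (A i)" for x
      unfolding inj_def using that zero(1) by (intro direct_sum_carrierI[of I _ A "{i}"]) auto
    fix x y assume xy: "x \<in> carrier (A i)" "y \<in> carrier (A i)"
    show "inj i (x \<oplus>\<^bsub>A i\<^esub> y) = inj i x \<oplus>\<^bsub>?S\<^esub> inj i y"
      unfolding inj_def direct_sum_simps(3) using zero(1,2) by (intro restrict_ext) simp
    show "inj i (x \<otimes>\<^bsub>A i\<^esub> y) = inj i x \<otimes>\<^bsub>?S\<^esub> inj i y"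
      unfolding inj_def direct_sum_simps(4) using zero(1,4) by (intro restrict_ext) simp
  next
    fix e x assume e: "e \<in> carrier (A i)" and x: "x \<in> carrier ?S" "x \<otimes>\<^bsub>?S\<^esub> inj i e = x"
    have "x j = \<zero>\<^bsub>A j\<^esub>" if "j \<in> I" "j \<noteq> i" for j
      using fun_cong[OF x(2), of j] D(1)[OF x(1) that(1)] that zero(5) by (simp add: inj_def)
    then have "inj i (x i) = (\<lambda>j\<in>I. x j)"
      unfolding inj_def by (intro restrict_ext) simp
    then have "x = inj i (x i)"
      using D(2)[OF x(1)] by simp
    moreover have "x i \<in> carrier (A i)" using D(1)[OF x(1) i] .
    ultimately show "x \<in> inj i ` carrier (A i)" by blast
  qed
  fix f assume f: "f \<in> carrier ?S"
  note fi = D(1)[OF f]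
  define part where "part Q = (\<lambda>i\<in>I. if i \<in> Q then f i else \<zero>\<^bsub>A i\<^esub>)" for Q
  have "finite Q \<Longrightarrow> Q \<subseteq> I \<Longrightarrow> part Q \<in> column_span ?S" for Q
  proof (induction rule: finite_induct)
    case empty
    have "part {} = \<zero>\<^bsub>?S\<^esub>"
      unfolding part_def direct_sum_simps(2) by (rule restrict_ext) simp
    then show ?case by (simp only: column_span.zero)
  next
    case (insert q Q)
    then have q: "q \<in> I" "part Q \<in> column_span ?S" by auto
    have "inj q (f q) \<oplus>\<^bsub>?S\<^esub> part Q \<in> column_span ?S"
      by (rule column_span.add[OF span_inj[OF q(1) fi[OF q(1)]] q(2)])
    moreover have "inj q (f q) \<oplus>\<^bsub>?S\<^esub> part Q = part (insert q Q)"
      unfolding inj_def part_def direct_sum_simps(3)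
      using insert.hyps zero(1,2,3) fi by (intro restrict_ext) auto
    ultimately show ?case by (simp only:)
  qed
  from this[OF D(3)[OF f]] have "part {i \<in> I. f i \<noteq> \<zero>\<^bsub>A i\<^esub>} \<in> column_span ?S"
    by simp
  moreover have "part {i \<in> I. f i \<noteq> \<zero>\<^bsub>A i\<^esub>} = (\<lambda>i\<in>I. f i)"
    unfolding part_def by (rule restrict_ext) simp
  ultimately show "f \<in> column_span ?S" by (simp only: D(2)[OF f])
qed

section \<open>Presented algebras\<close>

locale nonunital_algebra = nonunital_ring A
  for A :: "('r :: comm_ring_1, 'a, 'k) module_scheme" (structure) +
  assumes scale_closed [simp, intro]: "x \<in> carrier A \<Longrightarrow> c \<odot> x \<in> carrier A"
    and scale_r_distr: "\<lbrakk>x \<in> carrier A; y \<in> carrier A\<rbrakk> \<Longrightarrow> c \<odot> (x \<oplus> y) = c \<odot> x \<oplus> c \<odot> y"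
    and scale_l_distr: "x \<in> carrier A \<Longrightarrow> (c + d) \<odot> x = c \<odot> x \<oplus> d \<odot> x"
    and scale_scale: "x \<in> carrier A \<Longrightarrow> (c * d) \<odot> x = c \<odot> (d \<odot> x)"
    and scale_one [simp]: "x \<in> carrier A \<Longrightarrow> 1 \<odot> x = x"
    and scale_l_mult: "\<lbrakk>x \<in> carrier A; y \<in> carrier A\<rbrakk> \<Longrightarrow> (c \<odot> x) \<otimes> y = c \<odot> (x \<otimes> y)"
    and scale_r_mult: "\<lbrakk>x \<in> carrier A; y \<in> carrier A\<rbrakk> \<Longrightarrow> x \<otimes> (c \<odot> y) = c \<odot> (x \<otimes> y)"
begin

lemma scale_zero_l [simp]: "x \<in> carrier A \<Longrightarrow> 0 \<odot> x = \<zero>"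
  using scale_l_distr[of x 0 0] by (metis add.r_cancel_one' add_0 scale_closed)

lemma scale_zero_r [simp]: "c \<odot> \<zero> = \<zero>"
  using scale_r_distr[of \<zero> \<zero> c] by (metis add.r_cancel_one' l_zero scale_closed zero_closed)

end

lemma alg_terms_simps [simp]:
  "Gen g \<in> alg_terms G \<longleftrightarrow> g \<in> G" "Zero \<in> alg_terms G"
  "Neg s \<in> alg_terms G \<longleftrightarrow> s \<in> alg_terms G"
  "Add s t \<in> alg_terms G \<longleftrightarrow> s \<in> alg_terms G \<and> t \<in> alg_terms G"
  "Mult s t \<in> alg_terms G \<longleftrightarrow> s \<in> alg_terms G \<and> t \<in> alg_terms G"
  "Scale c s \<in> alg_terms G \<longleftrightarrow> s \<in> alg_terms G"
  by (auto simp: alg_terms_def)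

definition term_class ::
  "'g set \<Rightarrow> (('g, 'r :: comm_ring_1) alg_term \<times> ('g, 'r) alg_term) set
    \<Rightarrow> ('g, 'r) alg_term \<Rightarrow> ('g, 'r) alg_term set" where
  "term_class G Rel t = {u. presented_eq G Rel t u}"

lemma term_class_eqI: "presented_eq G Rel s t \<Longrightarrow> term_class G Rel s = term_class G Rel t"
  unfolding term_class_def by (auto intro: presented_eq.sym presented_eq.trans)

lemma term_class_eq_iff:
  "t \<in> alg_terms G \<Longrightarrow> term_class G Rel s = term_class G Rel t \<longleftrightarrow> presented_eq G Rel s t"
  using term_class_eqI[of G Rel s t] presented_eq.refl[of t G Rel]
  unfolding term_class_def by auto

lemma carrier_presented_algebra:
  "carrier (presented_algebra G Rel) = term_class G Rel ` alg_terms G"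
  unfolding presented_algebra_def quotient_def Let_def term_class_def by auto

lemma UN_term_class:
  assumes "s \<in> alg_terms G" "\<And>s'. presented_eq G Rel s s' \<Longrightarrow> F s' = C"
  shows "(\<Union>s'\<in>term_class G Rel s. F s') = C"
  using assms presented_eq.refl[of s G Rel] unfolding term_class_def by auto

lemma presented_algebra_ops:
  shows "\<zero>\<^bsub>presented_algebra G Rel\<^esub> = term_class G Rel Zero"
    and "\<lbrakk>s \<in> alg_terms G; t \<in> alg_terms G\<rbrakk> \<Longrightarrow>
      term_class G Rel s \<oplus>\<^bsub>presented_algebra G Rel\<^esub> term_class G Rel t = term_class G Rel (Add s t)"
    and "\<lbrakk>s \<in> alg_terms G; t \<in> alg_terms G\<rbrakk> \<Longrightarrow>
      term_class G Rel s \<otimes>\<^bsub>presented_algebra G Rel\<^esub> term_class G Rel t = term_class G Rel (Mult s t)"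
    and "s \<in> alg_terms G \<Longrightarrow>
      c \<odot>\<^bsub>presented_algebra G Rel\<^esub> term_class G Rel s = term_class G Rel (Scale c s)"
proof -
  have cl: "{(s, t). presented_eq G Rel s t} `` {u} = term_class G Rel u" for u
    by (auto simp: term_class_def)
  show "\<zero>\<^bsub>presented_algebra G Rel\<^esub> = term_class G Rel Zero"
    unfolding presented_algebra_def Let_def cl by simp
  show "term_class G Rel s \<oplus>\<^bsub>presented_algebra G Rel\<^esub> term_class G Rel t = term_class G Rel (Add s t)"
    if "s \<in> alg_terms G" "t \<in> alg_terms G" for s t
    using that unfolding presented_algebra_def Let_def cl
    by (simp, intro UN_term_class) (auto intro!: term_class_eqI presented_eq.add intro: presented_eq.sym)
  show "term_class G Rel s \<otimes>\<^bsub>presented_algebra G Rel\<^esub> term_class G Rel t = term_class G Rel (Mult s t)"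
    if "s \<in> alg_terms G" "t \<in> alg_terms G" for s t
    using that unfolding presented_algebra_def Let_def cl
    by (simp, intro UN_term_class) (auto intro!: term_class_eqI presented_eq.mult intro: presented_eq.sym)
  show "c \<odot>\<^bsub>presented_algebra G Rel\<^esub> term_class G Rel s = term_class G Rel (Scale c s)"
    if "s \<in> alg_terms G" for s
    using that unfolding presented_algebra_def Let_def cl
    by (simp, intro UN_term_class) (auto intro!: term_class_eqI presented_eq.scale intro: presented_eq.sym)
qed

lemma presented_algebra_cases:
  assumes "x \<in> carrier (presented_algebra G Rel)"
  obtains t where "t \<in> alg_terms G" "x = term_class G Rel t"
  using assms unfolding carrier_presented_algebra by blast

lemma term_class_axiom:
  "\<lbrakk>alg_axiom s t; s \<in> alg_terms G; t \<in> alg_terms G\<rbrakk> \<Longrightarrow> term_class G Rel s = term_class G Rel t"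
  by (intro term_class_eqI presented_eq.axiom)

lemma presented_nonunital_algebra: "nonunital_algebra (presented_algebra G Rel)"
proof -
  let ?A = "presented_algebra G Rel" and ?cl = "term_class G Rel"
  note ops = presented_algebra_ops[where G = G and Rel = Rel]
  note cases = presented_algebra_cases[where G = G and Rel = Rel]
  note ax = alg_axiom.intros[THEN term_class_axiom[where G = G and Rel = Rel]]
  have in_carrier [simp]: "t \<in> alg_terms G \<Longrightarrow> ?cl t \<in> carrier ?A" for t
    by (simp add: carrier_presented_algebra)
  have "abelian_group ?A"
  proof (rule abelian_groupI)
    fix x assume "x \<in> carrier ?A"
    then obtain t where t: "t \<in> alg_terms G" "x = ?cl t" by (rule cases)
    have "?cl (Neg t) \<oplus>\<^bsub>?A\<^esub> x = \<zero>\<^bsub>?A\<^esub>"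
      unfolding t(2) using t(1) by (simp add: ops ax(4))
    with t show "\<exists>y\<in>carrier ?A. y \<oplus>\<^bsub>?A\<^esub> x = \<zero>\<^bsub>?A\<^esub>"
      by (intro bexI[of _ "?cl (Neg t)"]) simp_all
  qed ((elim cases)?; simp add: ops; (rule ax; simp)?)+
  moreover have "nonunital_ring_axioms ?A"
    by standard (elim cases; simp add: ops; (rule ax; simp)?)+
  ultimately have "nonunital_ring ?A"
    by (rule nonunital_ring.intro)
  moreover have "nonunital_algebra_axioms ?A"
    by standard (elim cases; simp add: ops; (rule ax ax[symmetric]; simp)?)+
  ultimately show ?thesis
    by (rule nonunital_algebra.intro)
qed

text \<open>The function induced on the presented algebra by a function on terms.\<close>

definition lift_terms :: "'g set \<Rightarrow> (('g, 'r :: comm_ring_1) alg_term \<times> ('g, 'r) alg_term) set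
    \<Rightarrow> (('g, 'r) alg_term \<Rightarrow> 'b) \<Rightarrow> ('g, 'r) alg_term set \<Rightarrow> 'b" where
  "lift_terms G Rel f x = f (SOME t. t \<in> alg_terms G \<and> x = term_class G Rel t)"

lemma lift_terms_class:
  assumes "\<And>s t. presented_eq G Rel s t \<Longrightarrow> f s = f t" "t \<in> alg_terms G"
  shows "lift_terms G Rel f (term_class G Rel t) = f t"
proof -
  let ?s = "SOME s. s \<in> alg_terms G \<and> term_class G Rel t = term_class G Rel s"
  have "?s \<in> alg_terms G \<and> term_class G Rel t = term_class G Rel ?s"
    by (rule someI[of _ t]) (simp add: assms(2))
  then have "presented_eq G Rel t ?s"
    using term_class_eq_iff by blast
  then show ?thesis
    using assms(1) unfolding lift_terms_def by metis
qed

section \<open>Boundary paths\<close>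

lemma infinite_path_build:
  "infinite_path E (e ## \<alpha>) \<longleftrightarrow> e \<in> arcs E \<and> head E e = tail E (\<alpha> 0) \<and> infinite_path E \<alpha>"
  (is "?L \<longleftrightarrow> ?R")
proof
  assume L: ?L
  have i: "(e ## \<alpha>) i \<in> arcs E \<and> head E ((e ## \<alpha>) i) = tail E ((e ## \<alpha>) (Suc i))" for i
    using L unfolding infinite_path_def by blast
  show ?R
    using i[of 0] i[of "Suc _"] by (simp add: infinite_path_def)
next
  assume R: ?R
  show ?L
    unfolding infinite_path_def
  proof
    show "(e ## \<alpha>) i \<in> arcs E \<and> head E ((e ## \<alpha>) i) = tail E ((e ## \<alpha>) (Suc i))" for i
      using R by (cases i) (auto simp: infinite_path_def)
  qed
qed

context wf_digraph
begin

lemma awalk_append: "awalk u (a @ b) w \<longleftrightarrow> (\<exists>v. awalk u a v \<and> awalk v b w)"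
  by (induction a arbitrary: u) (auto simp: awalk_Cons_iff awalk_Nil_iff dest: awalk_hd_in_verts)

declare awalk_append_iff [simp del]

fun first_arc :: "('a, 'b) bpath \<Rightarrow> 'b option" where
  "first_arc (Fin_path u []) = None"
| "first_arc (Fin_path u (e # p)) = Some e"
| "first_arc (Inf_path \<alpha>) = Some (\<alpha> 0)"

fun rest :: "('a, 'b) bpath \<Rightarrow> ('a, 'b) bpath" where
  "rest (Fin_path u []) = Fin_path u []"
| "rest (Fin_path u (e # p)) = Fin_path (head G e) p"
| "rest (Inf_path \<alpha>) = Inf_path (suffix 1 \<alpha>)"

abbreviation source :: "('a, 'b) bpath \<Rightarrow> 'a" where "source \<equiv> bpath_source G"

definition arc_cons :: "'b \<Rightarrow> ('a, 'b) bpath \<Rightarrow> ('a, 'b) bpath" where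
  "arc_cons e x = prepend (tail G e) [e] x"

lemma source_in_verts: "p \<in> boundary G \<Longrightarrow> source p \<in> verts G"
  by (auto simp: boundary_def infinite_path_def dest: awalk_hd_in_verts)

lemma first_arc_cons [simp]: "first_arc (arc_cons e x) = Some e"
  by (cases x) (simp_all add: arc_cons_def)

lemma source_arc_cons [simp]: "source (arc_cons e x) = tail G e"
  by (cases x) (simp_all add: arc_cons_def)

lemma rest_arc_cons: "source x = head G e \<Longrightarrow> rest (arc_cons e x) = x"
  by (cases x) (auto simp: arc_cons_def)

lemma arc_cons_boundary:
  assumes "e \<in> arcs G" "x \<in> boundary G" "source x = head G e"
  shows "arc_cons e x \<in> boundary G"
proof (cases x)
  case (Fin_path u p)
  then show ?thesis
    using assms by (auto simp: boundary_def arc_cons_def awalk_Cons_iff)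
next
  case (Inf_path \<alpha>)
  then show ?thesis
    using assms by (auto simp: boundary_def arc_cons_def infinite_path_build)
qed

lemma boundary_cases:
  assumes "p \<in> boundary G"
  obtains (stop) u where "p = Fin_path u []" "is_sink G u \<or> infinite_emitter G u" "u \<in> verts G"
  | (step) e x where "e \<in> arcs G" "x \<in> boundary G" "source x = head G e" "p = arc_cons e x"
proof (cases p)
  case (Fin_path u q)
  then obtain v where v: "awalk u q v" "is_sink G v \<or> infinite_emitter G v"
    using assms by (auto simp: boundary_def)
  show ?thesis
  proof (cases q)
    case Nil
    with v Fin_path show ?thesis
      by (intro stop) (auto simp: awalk_Nil_iff)
  next
    case (Cons e r)
    with v Fin_path show ?thesis
      by (intro step[of e "Fin_path (head G e) r"]) (auto simp: awalk_Cons_iff boundary_def arc_cons_def)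
  qed
next
  case (Inf_path \<alpha>)
  then have "infinite_path G (\<alpha> 0 ## suffix (Suc 0) \<alpha>)"
    using assms by (auto simp: boundary_def)
  then have "\<alpha> 0 \<in> arcs G" "infinite_path G (suffix (Suc 0) \<alpha>)" "head G (\<alpha> 0) = tail G (\<alpha> 1)"
    unfolding infinite_path_build by auto
  then show ?thesis
    using Inf_path by (intro step[of "\<alpha> 0" "Inf_path (suffix (Suc 0) \<alpha>)"])
      (auto simp: boundary_def arc_cons_def)
qed

lemma first_arc_Some:
  assumes "p \<in> boundary G" "first_arc p = Some e"
  shows "e \<in> arcs G" "rest p \<in> boundary G" "source (rest p) = head G e" "p = arc_cons e (rest p)"
    "source p = tail G e"
proof -
  have "e \<in> arcs G \<and> rest p \<in> boundary G \<and> source (rest p) = head G e \<and> p = arc_cons e (rest p) \<and>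
      source p = tail G e"
    using assms(1)
  proof (cases rule: boundary_cases)
    case (step f x)
    then show ?thesis using assms(2) by (simp add: rest_arc_cons)
  qed (use assms(2) in simp)
  then show "e \<in> arcs G" "rest p \<in> boundary G" "source (rest p) = head G e" "p = arc_cons e (rest p)"
      "source p = tail G e"
    by simp_all
qed

lemma prepend_Nil [simp]: "prepend (source x) [] x = x"
  by (cases x) simp_all

lemma prepend_Cons: "prepend (tail G e) (e # a) x = arc_cons e (prepend (head G e) a x)"
  by (cases x) (simp_all add: arc_cons_def)

lemma prepend_append: "prepend u (a @ b) x = prepend u a (prepend v b x)"
  by (cases x) simp_all

lemma prepend_boundary:
  assumes "awalk u a (source x)" "x \<in> boundary G"
  shows "prepend u a x \<in> boundary G \<and> source (prepend u a x) = u"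
  using assms(1)
proof (induction a arbitrary: u)
  case Nil
  then show ?case using assms(2) by (auto simp: awalk_Nil_iff)
next
  case (Cons e a)
  then have "u = tail G e" "e \<in> arcs G" "awalk (head G e) a (source x)"
    by (auto simp: awalk_Cons_iff)
  with Cons.IH show ?case
    using arc_cons_boundary by (simp add: prepend_Cons)
qed

text \<open>
  Two factorisations of one boundary path are comparable: the shorter initial segment is a
  prefix of the longer one, and the difference passes to the tail.
\<close>

lemma prepend_eq_imp_prefix:
  assumes "prepend u a x = prepend u' b y" "awalk u a (source x)" "awalk u' b (source y)"
    "x \<in> boundary G" "y \<in> boundary G" "length a \<le> length b"
  shows "u = u' \<and> (\<exists>t. b = a @ t \<and> x = prepend (source x) t y \<and> awalk (source x) t (source y))"
  using assms(1,2,3,6)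
proof (induction a arbitrary: u u' b)
  case Nil
  then have u: "u = source x" by (simp add: awalk_Nil_iff)
  then have x: "x = prepend u' b y"
    using Nil.prems(1) by simp
  then have u': "u' = source x"
    using prepend_boundary[OF Nil.prems(3) assms(5)] by simp
  show ?case
  proof (intro conjI exI[of _ b])
    show "u = u'" unfolding u u' ..
    show "x = prepend (source x) b y" unfolding u'[symmetric] by (rule x)
    show "awalk (source x) b (source y)" unfolding u'[symmetric] by (rule Nil.prems(3))
  qed simp
next
  case (Cons e a)
  then obtain f c where b: "b = f # c" by (cases b) auto
  have e: "u = tail G e" "awalk (head G e) a (source x)" and f: "u' = tail G f" "awalk (head G f) c (source y)"
    using Cons.prems(2,3) b by (auto simp: awalk_Cons_iff)
  have eq: "arc_cons e (prepend (head G e) a x) = arc_cons f (prepend (head G f) c y)"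
    using Cons.prems(1) unfolding b e(1) f(1) prepend_Cons .
  then have "e = f"
    using first_arc_cons by (metis option.inject)
  moreover have "prepend (head G e) a x = prepend (head G f) c y"
    using eq prepend_boundary[OF e(2) assms(4)] prepend_boundary[OF f(2) assms(5)] rest_arc_cons by metis
  ultimately show ?case
    using Cons.IH[OF _ e(2) f(2)] Cons.prems(4) b e(1) f(1) by auto
qed

text \<open>
  Either a sink can be reached, or edges can be chosen forever.
\<close>

lemma boundary_path_exists:
  assumes v: "v \<in> verts G"
  shows "\<exists>x\<in>boundary G. source x = v"
proof (cases "\<exists>a u. awalk v a u \<and> is_sink G u")
  case True
  then obtain a u where "awalk v a u" "is_sink G u" by blast
  then show ?thesis
    by (intro bexI[of _ "Fin_path v a"]) (auto simp: boundary_def)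
next
  case False
  define nxt where "nxt u = (SOME e. e \<in> out_arcs G u)" for u
  have nxt: "nxt u \<in> arcs G" "tail G (nxt u) = u" if "awalk v a u" for a u
  proof -
    have "\<exists>e. e \<in> out_arcs G u"
      using False that awalk_last_in_verts[OF that] unfolding is_sink_def by blast
    then have "nxt u \<in> out_arcs G u"
      unfolding nxt_def by (rule someI_ex)
    then show "nxt u \<in> arcs G" "tail G (nxt u) = u" by auto
  qed
  define \<alpha> where "\<alpha> = rec_nat (nxt v) (\<lambda>_ e. nxt (head G e))"
  have \<alpha>: "\<alpha> 0 = nxt v" "\<alpha> (Suc i) = nxt (head G (\<alpha> i))" for i
    by (simp_all add: \<alpha>_def)
  have reach: "\<exists>a. awalk v a (head G (\<alpha> i)) \<and> \<alpha> i \<in> arcs G" for i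
  proof (induction i)
    case 0
    have "awalk v [] v" using v by (simp add: awalk_Nil_iff)
    then have "awalk v [\<alpha> 0] (head G (\<alpha> 0))" "\<alpha> 0 \<in> arcs G"
      using nxt[of "[]" v] v by (auto simp: \<alpha> awalk_simps)
    then show ?case by blast
  next
    case (Suc i)
    then obtain a where a: "awalk v a (head G (\<alpha> i))" by blast
    then have "awalk v (a @ [\<alpha> (Suc i)]) (head G (\<alpha> (Suc i)))" "\<alpha> (Suc i) \<in> arcs G"
      using nxt[OF a] by (auto simp: awalk_append awalk_simps \<alpha>(2) intro!: exI[of _ "head G (\<alpha> i)"])
    then show ?case by blast
  qed
  have "infinite_path G \<alpha>"
    unfolding infinite_path_def
  proof
    fix i
    obtain a where "awalk v a (head G (\<alpha> i))" "\<alpha> i \<in> arcs G" using reach by blast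
    then show "\<alpha> i \<in> arcs G \<and> head G (\<alpha> i) = tail G (\<alpha> (Suc i))"
      using nxt(2) by (simp add: \<alpha>(2))
  qed
  moreover have "tail G (\<alpha> 0) = v"
    using nxt(2)[of "[]" v] v by (simp add: \<alpha>(1) awalk_Nil_iff)
  ultimately show ?thesis
    by (intro bexI[of _ "Inf_path \<alpha>"]) (auto simp: boundary_def)
qed

end

section \<open>The action on functions of boundary paths\<close>

context wf_digraph
begin

text \<open>
  The boundary path representation, twisted by integers. On the point function at \<open>(q,
  k)\<close>, an edge \<open>e\<close> prepends \<open>e\<close> to \<open>q\<close> and raises
  \<open>k\<close> by \<open>w e\<close>, a ghost edge removes a leading \<open>e\<close> and
  lowers \<open>k\<close>, and a vertex is the projection to paths that start there. The integer
  tells apart the powers of a cycle, which act alike on an eventually periodic path. All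
  functions are allowed, so no finiteness of supports has to be tracked.
\<close>

fun gen_act :: "('b \<Rightarrow> int) \<Rightarrow> ('a, 'b) lpa_gen
    \<Rightarrow> (('a, 'b) bpath \<times> int \<Rightarrow> 'r :: comm_ring_1) \<Rightarrow> ('a, 'b) bpath \<times> int \<Rightarrow> 'r" where
  "gen_act w (Vertex v) f (p, k) = (if p \<in> boundary G \<and> source p = v then f (p, k) else 0)"
| "gen_act w (Edge e) f (p, k) =
    (if p \<in> boundary G \<and> first_arc p = Some e then f (rest p, k - w e) else 0)"
| "gen_act w (Ghost e) f (p, k) =
    (if p \<in> boundary G \<and> source p = head G e then f (arc_cons e p, k + w e) else 0)"

primrec rho :: "('b \<Rightarrow> int) \<Rightarrow> (('a, 'b) lpa_gen, 'r :: comm_ring_1) alg_term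
    \<Rightarrow> (('a, 'b) bpath \<times> int \<Rightarrow> 'r) \<Rightarrow> ('a, 'b) bpath \<times> int \<Rightarrow> 'r" where
  "rho w (Gen g) f x = gen_act w g f x"
| "rho w Zero f x = 0"
| "rho w (Neg s) f x = - rho w s f x"
| "rho w (Add s t) f x = rho w s f x + rho w t f x"
| "rho w (Mult s t) f x = rho w s (rho w t f) x"
| "rho w (Scale c s) f x = c * rho w s f x"

lemma gen_act_linear:
  "gen_act w g (\<lambda>x. f x + h x) x = gen_act w g f x + gen_act w g h x"
  "gen_act w g (\<lambda>x. c * f x) x = c * gen_act w g f x"
  "gen_act w g (\<lambda>(p, k). f (p, k - l)) (p, k) = gen_act w g f (p, k - l)"
  by (cases g; cases x; simp add: algebra_simps)+

lemma rho_add: "rho w t (\<lambda>x. f x + h x) x = rho w t f x + rho w t h x"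
proof (induction t arbitrary: f h x)
  case (Mult s t)
  have "rho w t (\<lambda>x. f x + h x) = (\<lambda>x. rho w t f x + rho w t h x)"
    using Mult.IH(2) by (intro ext)
  then show ?case using Mult.IH(1) by simp
qed (simp_all add: gen_act_linear algebra_simps)

lemma rho_scale: "rho w t (\<lambda>x. c * f x) x = c * rho w t f x"
proof (induction t arbitrary: f x)
  case (Mult s t)
  have "rho w t (\<lambda>x. c * f x) = (\<lambda>x. c * rho w t f x)"
    using Mult.IH(2) by (intro ext)
  then show ?case using Mult.IH(1) by simp
qed (simp_all add: gen_act_linear algebra_simps)

lemma rho_shift: "rho w t (\<lambda>(p, k). f (p, k - l)) (p, k) = rho w t f (p, k - l)"
proof (induction t arbitrary: f p k)
  case (Mult s t)
  have "rho w t (\<lambda>(p, k). f (p, k - l)) = (\<lambda>(p, k). rho w t f (p, k - l))"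
    using Mult.IH(2) by (intro ext) auto
  then show ?case using Mult.IH(1) by simp
qed (simp_all only: rho.simps gen_act_linear)

lemma rho_zero: "rho w t (\<lambda>x. 0) x = 0"
  using rho_scale[of w t 0 "\<lambda>x. 0" x] by simp

lemma rho_sum: "finite I \<Longrightarrow> rho w t (\<lambda>x. \<Sum>i\<in>I. f i x) x = (\<Sum>i\<in>I. rho w t (f i) x)"
  by (induction I rule: finite_induct) (simp_all add: rho_zero rho_add)

lemma rho_edge_ghost_sum:
  assumes "distinct es" "set es \<subseteq> arcs G"
  shows "rho w (foldr (\<lambda>e. Add (Mult (Gen (Edge e)) (Gen (Ghost e)))) es Zero) f (p, k) =
    (if p \<in> boundary G \<and> (\<exists>e\<in>set es. first_arc p = Some e) then f (p, k) else 0)"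
  using assms
proof (induction es)
  case (Cons e es)
  have "first_arc p = Some e \<Longrightarrow> p \<in> boundary G \<Longrightarrow>
      rest p \<in> boundary G \<and> source (rest p) = head G e \<and> arc_cons e (rest p) = p"
    using first_arc_Some by metis
  with Cons show ?case by auto
qed simp

text \<open>
  A boundary path that starts at a vertex emitting finitely many edges, but at least one, cannot
  stop there, so it has a first edge. This is why the last family of relations holds in the
  representation.
\<close>

lemma boundary_source_regular:
  assumes p: "p \<in> boundary G" and v: "out_arcs G v \<noteq> {}" "finite (out_arcs G v)"
  shows "source p = v \<longleftrightarrow> (\<exists>e\<in>out_arcs G v. first_arc p = Some e)"
  using p
proof (cases rule: boundary_cases)
  case (stop u)
  then show ?thesis
    using v by (auto simp: is_sink_def infinite_emitter_def)
qed auto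

lemma rho_relation:
  assumes "(s, t) \<in> lpa_relations G"
  shows "rho w s f (p, k) = rho w t f (p, k)"
  using assms
proof cases
  case (edge_ghost_sum v es)
  have "finite (out_arcs G v)" "out_arcs G v \<noteq> {}"
    using edge_ghost_sum by (metis List.finite_set set_empty)+
  moreover have "set es \<subseteq> arcs G"
    using edge_ghost_sum(5) by auto
  ultimately show ?thesis
    unfolding edge_ghost_sum(1,2) using edge_ghost_sum(4,5)
    by (simp add: rho_edge_ghost_sum boundary_source_regular cong: conj_cong)
next
  case (ghost_edge e f)
  then show ?thesis
    using arc_cons_boundary by (simp add: rest_arc_cons)
next
  case (edge_range e)
  then show ?thesis
    using first_arc_Some by auto
next
  case (ghost_source e)
  then show ?thesis
    using arc_cons_boundary by simp
next
  case (source_edge e)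
  then show ?thesis
    using first_arc_Some by auto
qed auto

lemma rho_axiom: "alg_axiom s t \<Longrightarrow> rho w s f x = rho w t f x"
proof (induction rule: alg_axiom.induct)
  case (5 s t u)
  have "rho w (Mult t u) f = rho w t (rho w u f)" by (intro ext) simp
  then show ?case by simp
next
  case (6 s t u)
  have "rho w (Add t u) f = (\<lambda>x. rho w t f x + rho w u f x)" by (intro ext) simp
  then show ?case by (simp add: rho_add)
next
  case (13 c s t)
  have "rho w (Scale c t) f = (\<lambda>x. c * rho w t f x)" by (intro ext) simp
  then show ?case by (simp add: rho_scale)
qed (simp_all add: algebra_simps)

lemma rho_presented_eq:
  "presented_eq (lpa_gens G) (lpa_relations G) s t \<Longrightarrow> rho w s = rho w t"
proof (induction rule: presented_eq.induct)
  case (axiom s t)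
  then show ?case by (intro ext rho_axiom)
next
  case (relation s t)
  then show ?case by (intro ext) (auto simp: rho_relation)
qed (auto intro!: ext)

abbreviation L :: "('r :: comm_ring_1, (('a, 'b) lpa_gen, 'r) alg_term set) module" where
  "L \<equiv> presented_algebra (lpa_gens G) (lpa_relations G)"

abbreviation cl :: "(('a, 'b) lpa_gen, 'r :: comm_ring_1) alg_term \<Rightarrow> (('a, 'b) lpa_gen, 'r) alg_term set" where
  "cl \<equiv> term_class (lpa_gens G) (lpa_relations G)"

text \<open>
  The representation descends to the presented algebra because every relation holds for the
  generators.
\<close>

definition act :: "('b \<Rightarrow> int) \<Rightarrow> (('a, 'b) lpa_gen, 'r :: comm_ring_1) alg_term set
    \<Rightarrow> (('a, 'b) bpath \<times> int \<Rightarrow> 'r) \<Rightarrow> ('a, 'b) bpath \<times> int \<Rightarrow> 'r" where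
  "act w = lift_terms (lpa_gens G) (lpa_relations G) (rho w)"

lemma act_cl: "t \<in> alg_terms (lpa_gens G) \<Longrightarrow> act w (cl t) = rho w t"
  unfolding act_def by (rule lift_terms_class[OF rho_presented_eq])

lemma L_cases:
  assumes "z \<in> carrier L"
  obtains t where "t \<in> alg_terms (lpa_gens G)" "z = cl t"
  using assms by (rule presented_algebra_cases)

lemma cl_in_L [simp]: "t \<in> alg_terms (lpa_gens G) \<Longrightarrow> cl t \<in> carrier L"
  by (simp add: carrier_presented_algebra)

lemmas L_ops = presented_algebra_ops[where G = "lpa_gens G" and Rel = "lpa_relations G"]

lemma act_simps:
  "act w \<zero>\<^bsub>L\<^esub> f x = 0"
  "\<lbrakk>y \<in> carrier L; z \<in> carrier L\<rbrakk> \<Longrightarrow> act w (y \<oplus>\<^bsub>L\<^esub> z) f x = act w y f x + act w z f x"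
  "\<lbrakk>y \<in> carrier L; z \<in> carrier L\<rbrakk> \<Longrightarrow> act w (y \<otimes>\<^bsub>L\<^esub> z) f x = act w y (act w z f) x"
  "z \<in> carrier L \<Longrightarrow> act w (c \<odot>\<^bsub>L\<^esub> z) f x = c * act w z f x"
  by (auto elim!: L_cases simp: L_ops act_cl)

lemma act_linear:
  assumes "z \<in> carrier L"
  shows "act w z (\<lambda>x. f x + h x) x = act w z f x + act w z h x"
    "act w z (\<lambda>x. c * f x) x = c * act w z f x" "act w z (\<lambda>x. 0) x = 0"
    "act w z (\<lambda>(p, k). f (p, k - l)) (p, k) = act w z f (p, k - l)"
    "finite I \<Longrightarrow> act w z (\<lambda>x. \<Sum>i\<in>I. F i x) x = (\<Sum>i\<in>I. act w z (F i) x)"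
  using assms by (auto elim!: L_cases simp: act_cl rho_add rho_scale rho_zero rho_shift rho_sum)

definition vtx where "vtx v = cl (Gen (Vertex v))"
definition edg where "edg e = cl (Gen (Edge e))"
definition gho where "gho e = cl (Gen (Ghost e))"

lemma gens_simps [simp]:
  "Vertex v \<in> lpa_gens G \<longleftrightarrow> v \<in> verts G" "Edge e \<in> lpa_gens G \<longleftrightarrow> e \<in> arcs G"
  "Ghost e \<in> lpa_gens G \<longleftrightarrow> e \<in> arcs G"
  by (auto simp: lpa_gens_def)

lemma gens_in_L [simp]:
  "v \<in> verts G \<Longrightarrow> vtx v \<in> carrier L" "e \<in> arcs G \<Longrightarrow> edg e \<in> carrier L"
  "e \<in> arcs G \<Longrightarrow> gho e \<in> carrier L"
  by (simp_all add: vtx_def edg_def gho_def)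

lemma cl_relation:
  "\<lbrakk>(s, t) \<in> lpa_relations G; s \<in> alg_terms (lpa_gens G); t \<in> alg_terms (lpa_gens G)\<rbrakk> \<Longrightarrow> cl s = cl t"
  by (intro term_class_eqI presented_eq.relation)

lemma L_relations:
  "\<lbrakk>v \<in> verts G; u \<in> verts G\<rbrakk> \<Longrightarrow> vtx v \<otimes>\<^bsub>L\<^esub> vtx u = (if v = u then vtx v else \<zero>\<^bsub>L\<^esub>)"
  "e \<in> arcs G \<Longrightarrow> vtx (tail G e) \<otimes>\<^bsub>L\<^esub> edg e = edg e"
  "e \<in> arcs G \<Longrightarrow> edg e \<otimes>\<^bsub>L\<^esub> vtx (head G e) = edg e"
  "e \<in> arcs G \<Longrightarrow> vtx (head G e) \<otimes>\<^bsub>L\<^esub> gho e = gho e"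
  "e \<in> arcs G \<Longrightarrow> gho e \<otimes>\<^bsub>L\<^esub> vtx (tail G e) = gho e"
  "\<lbrakk>e \<in> arcs G; f \<in> arcs G\<rbrakk> \<Longrightarrow> gho e \<otimes>\<^bsub>L\<^esub> edg f = (if e = f then vtx (head G e) else \<zero>\<^bsub>L\<^esub>)"
proof -
  note rel = lpa_relations.intros[THEN cl_relation]
  show "vtx v \<otimes>\<^bsub>L\<^esub> vtx u = (if v = u then vtx v else \<zero>\<^bsub>L\<^esub>)" if "v \<in> verts G" "u \<in> verts G" for u v
    using rel(1)[OF that] that by (cases "v = u") (simp_all add: vtx_def L_ops)
  show "gho e \<otimes>\<^bsub>L\<^esub> edg f = (if e = f then vtx (head G e) else \<zero>\<^bsub>L\<^esub>)" if "e \<in> arcs G" "f \<in> arcs G" for e f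
    using rel(6)[OF that] that by (cases "e = f") (simp_all add: vtx_def edg_def gho_def L_ops)
qed (simp_all add: vtx_def edg_def gho_def L_ops lpa_relations.intros[THEN cl_relation])

lemma L_edge_ghost_sum:
  assumes "v \<in> verts G" "distinct es" "set es = out_arcs G v" "es \<noteq> []"
  shows "(vtx v :: (('a, 'b) lpa_gen, 'r :: comm_ring_1) alg_term set) = foldr (\<lambda>e x. (edg e \<otimes>\<^bsub>L\<^esub> gho e) \<oplus>\<^bsub>L\<^esub> x) es \<zero>\<^bsub>L\<^esub>"
proof -
  let ?t = "\<lambda>es. foldr (\<lambda>e. Add (Mult (Gen (Edge e)) (Gen (Ghost e)))) es Zero
    :: (('a, 'b) lpa_gen, 'r) alg_term"
  have t: "set es \<subseteq> arcs G \<Longrightarrow> ?t es \<in> alg_terms (lpa_gens G) \<and>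
      cl (?t es) = foldr (\<lambda>e x. (edg e \<otimes>\<^bsub>L\<^esub> gho e) \<oplus>\<^bsub>L\<^esub> x) es \<zero>\<^bsub>L\<^esub>" for es
  proof (induction es)
    case (Cons e es)
    then have e: "e \<in> arcs G" "?t es \<in> alg_terms (lpa_gens G)"
      and IH: "foldr (\<lambda>e x. (edg e \<otimes>\<^bsub>L\<^esub> gho e) \<oplus>\<^bsub>L\<^esub> x) es \<zero>\<^bsub>L\<^esub> = cl (?t es)"
      by simp_all
    show ?case
      unfolding foldr_Cons o_apply IH using e by (simp add: edg_def gho_def L_ops)
  qed (simp add: L_ops)
  have E: "set es \<subseteq> arcs G" using assms(3) by auto
  have "cl (Gen (Vertex v)) = cl (?t es)"
    using assms(1) t[of es] E by (intro cl_relation lpa_relations.edge_ghost_sum assms) simp_all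
  then show ?thesis
    using t[OF E] by (simp add: vtx_def)
qed


interpretation L: nonunital_algebra L
  by (rule presented_nonunital_algebra)

subsection \<open>Local units\<close>

primrec vertex_sum :: "'a list \<Rightarrow> (('a, 'b) lpa_gen, 'r :: comm_ring_1) alg_term set" where
  "vertex_sum [] = \<zero>\<^bsub>L\<^esub>"
| "vertex_sum (v # vs) = vtx v \<oplus>\<^bsub>L\<^esub> vertex_sum vs"

lemma vertex_sum_in_L [simp]: "set vs \<subseteq> verts G \<Longrightarrow> vertex_sum vs \<in> carrier L"
  by (induction vs) auto

lemma vertex_sum_vtx_aux:
  "distinct vs \<Longrightarrow> set vs \<subseteq> verts G \<Longrightarrow> v \<in> verts G \<Longrightarrow>
    vertex_sum vs \<otimes>\<^bsub>L\<^esub> vtx v = (if v \<in> set vs then vtx v else \<zero>\<^bsub>L\<^esub>) \<and>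
    vtx v \<otimes>\<^bsub>L\<^esub> vertex_sum vs = (if v \<in> set vs then vtx v else \<zero>\<^bsub>L\<^esub>)"
  by (induction vs) (auto simp: L.l_distr L.r_distr L_relations)

lemmas vertex_sum_vtx = vertex_sum_vtx_aux[THEN conjunct1] vertex_sum_vtx_aux[THEN conjunct2]

text \<open>
  Quantifying over all enumerations of larger vertex sets makes supports of several elements
  combine by union.
\<close>

definition supported_by :: "'a set \<Rightarrow> (('a, 'b) lpa_gen, 'r :: comm_ring_1) alg_term set \<Rightarrow> bool" where
  "supported_by F z \<longleftrightarrow> (\<forall>vs. distinct vs \<and> F \<subseteq> set vs \<and> set vs \<subseteq> verts G \<longrightarrow>
    vertex_sum vs \<otimes>\<^bsub>L\<^esub> z = z \<and> z \<otimes>\<^bsub>L\<^esub> vertex_sum vs = z)"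

lemma supported_by_mono: "supported_by F z \<Longrightarrow> F \<subseteq> F' \<Longrightarrow> supported_by F' z"
  unfolding supported_by_def by blast

lemma supported_by_gen:
  assumes z: "z \<in> carrier L" and u: "u \<in> verts G" "v \<in> verts G"
    and uz: "vtx u \<otimes>\<^bsub>L\<^esub> z = z" and zv: "z \<otimes>\<^bsub>L\<^esub> vtx v = z"
  shows "supported_by {u, v} z"
  unfolding supported_by_def
proof (intro allI impI)
  fix vs assume vs: "distinct vs \<and> {u, v} \<subseteq> set vs \<and> set vs \<subseteq> verts G"
  then have s: "vertex_sum vs \<in> carrier L" by simp
  have "vertex_sum vs \<otimes>\<^bsub>L\<^esub> (vtx u \<otimes>\<^bsub>L\<^esub> z) = vtx u \<otimes>\<^bsub>L\<^esub> z"
    using vs u z s by (simp add: L.m_assoc[symmetric] vertex_sum_vtx)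
  moreover have "(z \<otimes>\<^bsub>L\<^esub> vtx v) \<otimes>\<^bsub>L\<^esub> vertex_sum vs = z \<otimes>\<^bsub>L\<^esub> vtx v"
    using vs u z s by (simp add: L.m_assoc vertex_sum_vtx)
  ultimately show "vertex_sum vs \<otimes>\<^bsub>L\<^esub> z = z \<and> z \<otimes>\<^bsub>L\<^esub> vertex_sum vs = z"
    unfolding uz zv by simp
qed

lemma term_supported:
  fixes t :: "(('a, 'b) lpa_gen, 'r :: comm_ring_1) alg_term"
  assumes "t \<in> alg_terms (lpa_gens G)"
  shows "\<exists>F. finite F \<and> F \<subseteq> verts G \<and> supported_by F (cl t)"
  using assms
proof (induction t)
  case (Gen g)
  then show ?case
  proof (cases g)
    case (Vertex v)
    then show ?thesis
      using Gen supported_by_gen[of "vtx v" v v]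
      by (intro exI[of _ "{v, v}"]) (simp add: L_relations flip: vtx_def)
  next
    case (Edge e)
    then show ?thesis
      using Gen supported_by_gen[of "edg e" "tail G e" "head G e"]
      by (intro exI[of _ "{tail G e, head G e}"]) (simp add: L_relations flip: edg_def)
  next
    case (Ghost e)
    then show ?thesis
      using Gen supported_by_gen[of "gho e" "head G e" "tail G e"]
      by (intro exI[of _ "{head G e, tail G e}"]) (simp add: L_relations flip: gho_def)
  qed
next
  case Zero
  have "supported_by {} (\<zero>\<^bsub>L\<^esub> :: (('a, 'b) lpa_gen, 'r) alg_term set)"
    unfolding supported_by_def by simp
  then show ?case by (intro exI[of _ "{}"]) (simp add: L_ops)
next
  case (Neg t)
  then obtain F where F: "finite F" "F \<subseteq> verts G" "supported_by F (cl t)" by auto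
  have t: "cl t \<in> carrier L" "cl (Neg t) = \<ominus>\<^bsub>L\<^esub> cl t"
  proof -
    show t: "cl t \<in> carrier L" using Neg.prems by simp
    have n: "cl (Neg t) \<in> carrier L" using Neg.prems by simp
    have "cl (Neg t) \<oplus>\<^bsub>L\<^esub> cl t = \<zero>\<^bsub>L\<^esub>"
      using Neg.prems by (simp add: L_ops term_class_axiom[OF alg_axiom.intros(4)])
    from L.minus_equality[OF this t n] show "cl (Neg t) = \<ominus>\<^bsub>L\<^esub> cl t" ..
  qed
  have "supported_by F (cl (Neg t))"
    using F(3) unfolding supported_by_def t(2) by (auto simp: L.r_minus L.l_minus t(1))
  then show ?case using F by blast
next
  case (Add s t)
  then obtain F F' where F: "finite F" "F \<subseteq> verts G" "supported_by F (cl s)"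
    and F': "finite F'" "F' \<subseteq> verts G" "supported_by F' (cl t)" by auto
  have st: "cl s \<in> carrier L" "cl t \<in> carrier L" "cl (Add s t) = cl s \<oplus>\<^bsub>L\<^esub> cl t"
    using Add.prems by (simp_all add: L_ops)
  have "supported_by (F \<union> F') (cl (Add s t))"
    using F(3) F'(3) st(1,2) unfolding supported_by_def st(3) by (auto simp: L.l_distr L.r_distr)
  then show ?case using F F' by (intro exI[of _ "F \<union> F'"]) simp
next
  case (Mult s t)
  then obtain F F' where F: "finite F" "F \<subseteq> verts G" "supported_by F (cl s)"
    and F': "finite F'" "F' \<subseteq> verts G" "supported_by F' (cl t)" by auto
  have st: "cl s \<in> carrier L" "cl t \<in> carrier L" "cl (Mult s t) = cl s \<otimes>\<^bsub>L\<^esub> cl t"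
    using Mult.prems by (simp_all add: L_ops)
  have "supported_by (F \<union> F') (cl (Mult s t))"
    unfolding supported_by_def st(3)
  proof (intro allI impI)
    fix vs assume vs: "distinct vs \<and> F \<union> F' \<subseteq> set vs \<and> set vs \<subseteq> verts G"
    then have c: "vertex_sum vs \<in> carrier L" by simp
    have "vertex_sum vs \<otimes>\<^bsub>L\<^esub> cl s = cl s" "cl t \<otimes>\<^bsub>L\<^esub> vertex_sum vs = cl t"
      using F(3) F'(3) vs unfolding supported_by_def by auto
    then show "vertex_sum vs \<otimes>\<^bsub>L\<^esub> (cl s \<otimes>\<^bsub>L\<^esub> cl t) = cl s \<otimes>\<^bsub>L\<^esub> cl t \<and>
        (cl s \<otimes>\<^bsub>L\<^esub> cl t) \<otimes>\<^bsub>L\<^esub> vertex_sum vs = cl s \<otimes>\<^bsub>L\<^esub> cl t"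
      using L.m_assoc[OF c st(1,2)] L.m_assoc[OF st(1,2) c] by simp
  qed
  then show ?case using F F' by (intro exI[of _ "F \<union> F'"]) simp
next
  case (Scale c t)
  then obtain F where F: "finite F" "F \<subseteq> verts G" "supported_by F (cl t)" by auto
  have t: "cl t \<in> carrier L" "cl (Scale c t) = c \<odot>\<^bsub>L\<^esub> cl t"
    using Scale.prems by (simp_all add: L_ops)
  have "supported_by F (cl (Scale c t))"
    using F(3) unfolding supported_by_def t(2) by (auto simp: L.scale_l_mult L.scale_r_mult t(1))
  then show ?case using F by blast
qed

lemma supported_vertex_sum:
  assumes "distinct vs" "set vs \<subseteq> verts G" "F \<subseteq> set vs" "supported_by F z"
  shows "vertex_sum vs \<otimes>\<^bsub>L\<^esub> z = z" "z \<otimes>\<^bsub>L\<^esub> vertex_sum vs = z"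
  using assms unfolding supported_by_def by auto

lemma vertex_sum_idem:
  assumes "distinct vs" "set vs \<subseteq> verts G"
  shows "vertex_sum vs \<otimes>\<^bsub>L\<^esub> vertex_sum vs = vertex_sum vs"
proof -
  have "set us \<subseteq> set vs \<Longrightarrow> vertex_sum vs \<otimes>\<^bsub>L\<^esub> vertex_sum us = vertex_sum us" for us
    by (induction us) (use assms in \<open>auto simp: L.r_distr vertex_sum_vtx subset_iff\<close>)
  then show ?thesis by blast
qed

text \<open>
  Every generator has a source and a range, so every term is fixed by the sum of the finitely
  many vertices that occur in this way.
\<close>

lemma L_support:
  fixes Z :: "(('a, 'b) lpa_gen, 'r :: comm_ring_1) alg_term set set"
  assumes "finite Z" "Z \<subseteq> carrier L"
  shows "\<exists>vs. distinct vs \<and> set vs \<subseteq> verts G \<and> (\<forall>z\<in>Z. vertex_sum vs \<otimes>\<^bsub>L\<^esub> z = z \<and> z \<otimes>\<^bsub>L\<^esub> vertex_sum vs = z)"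
proof -
  have "\<exists>F. finite F \<and> F \<subseteq> verts G \<and> (\<forall>z\<in>Z. supported_by F z)"
    using assms
  proof (induction rule: finite_induct)
    case (insert z Z)
    then obtain F where F: "finite F" "F \<subseteq> verts G" "\<forall>z\<in>Z. supported_by F z" by auto
    obtain t where "t \<in> alg_terms (lpa_gens G)" "z = cl t"
      using insert.prems L_cases by blast
    then obtain F' where "finite F'" "F' \<subseteq> verts G" "supported_by F' z"
      using term_supported by blast
    moreover have "supported_by (F \<union> F') y" if "supported_by F y \<or> supported_by F' y"
      for y :: "(('a, 'b) lpa_gen, 'r) alg_term set"
      using that supported_by_mono[of F y "F \<union> F'"] supported_by_mono[of F' y "F \<union> F'"] by blast
    ultimately show ?case
      using F by (intro exI[of _ "F \<union> F'"]) simp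
  qed auto
  then obtain F where F: "finite F" "F \<subseteq> verts G" "\<forall>z\<in>Z. supported_by F z" by blast
  obtain vs where "distinct vs" "set vs = F"
    using finite_distinct_list[OF F(1)] by blast
  moreover from this have "vertex_sum vs \<otimes>\<^bsub>L\<^esub> z = z \<and> z \<otimes>\<^bsub>L\<^esub> vertex_sum vs = z" if "z \<in> Z" for z
    using that F(2,3) supported_vertex_sum[of vs F z] by simp
  ultimately show ?thesis
    using F(2) by blast
qed

lemma L_local_units:
  "has_local_units (L :: ('r :: comm_ring_1, (('a, 'b) lpa_gen, 'r) alg_term set) module)"
  unfolding has_local_units_def
proof (intro allI impI)
  fix Z :: "(('a, 'b) lpa_gen, 'r) alg_term set set"
  assume "finite Z \<and> Z \<subseteq> carrier L"
  then obtain vs where vs: "distinct vs" "set vs \<subseteq> verts G"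
      "\<forall>z\<in>Z. vertex_sum vs \<otimes>\<^bsub>L\<^esub> z = z \<and> z \<otimes>\<^bsub>L\<^esub> vertex_sum vs = z"
    using L_support[of Z] by auto
  then show "\<exists>e\<in>carrier L. e \<otimes>\<^bsub>L\<^esub> e = e \<and> (\<forall>x\<in>Z. e \<otimes>\<^bsub>L\<^esub> x = x \<and> x \<otimes>\<^bsub>L\<^esub> e = x)"
    using vertex_sum_idem[OF vs(1,2)] by (intro bexI[of _ "vertex_sum vs"]) simp_all
qed

subsection \<open>The involution\<close>

fun star_gen :: "('a, 'b) lpa_gen \<Rightarrow> ('a, 'b) lpa_gen" where
  "star_gen (Vertex v) = Vertex v"
| "star_gen (Edge e) = Ghost e"
| "star_gen (Ghost e) = Edge e"

primrec star_term :: "(('a, 'b) lpa_gen, 'r) alg_term \<Rightarrow> (('a, 'b) lpa_gen, 'r) alg_term" where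
  "star_term (Gen g) = Gen (star_gen g)"
| "star_term Zero = Zero"
| "star_term (Neg s) = Neg (star_term s)"
| "star_term (Add s t) = Add (star_term s) (star_term t)"
| "star_term (Mult s t) = Mult (star_term t) (star_term s)"
| "star_term (Scale c s) = Scale c (star_term s)"

lemma star_term_involution [simp]: "star_term (star_term t) = t"
proof (induction t)
  case (Gen g)
  then show ?case by (cases g) simp_all
qed simp_all

lemma star_term_terms [simp]: "star_term t \<in> alg_terms (lpa_gens G) \<longleftrightarrow> t \<in> alg_terms (lpa_gens G)"
proof (induction t)
  case (Gen g)
  then show ?case by (cases g) simp_all
qed auto

lemma star_axiom:
  assumes "alg_axiom s t" "s \<in> alg_terms (lpa_gens G)" "t \<in> alg_terms (lpa_gens G)"
  shows "presented_eq (lpa_gens G) (lpa_relations G) (star_term s) (star_term t)"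
proof -
  have "alg_axiom (star_term s) (star_term t) \<or> alg_axiom (star_term t) (star_term s)"
    using assms(1) by (induction rule: alg_axiom.induct) (simp_all add: alg_axiom.intros)
  then show ?thesis
    using assms(2,3) presented_eq.axiom[THEN presented_eq.sym] presented_eq.axiom
    by (metis star_term_terms)
qed

lemma star_sum:
  "star_term (foldr (\<lambda>e. Add (Mult (Gen (Edge e)) (Gen (Ghost e)))) es Zero) =
    foldr (\<lambda>e. Add (Mult (Gen (Edge e)) (Gen (Ghost e)))) es Zero"
  by (induction es) simp_all

lemma star_relation:
  "(s, t) \<in> lpa_relations G \<Longrightarrow> (star_term s, star_term t) \<in> lpa_relations G"
proof (induction rule: lpa_relations.induct)
  case (vertices v u)
  show ?case using lpa_relations.vertices[of u G v] vertices by (cases "u = v") auto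
next
  case (ghost_edge e f)
  show ?case using lpa_relations.ghost_edge[of f G e] ghost_edge by (cases "e = f") auto
next
  case (edge_ghost_sum v es)
  then show ?case
    using lpa_relations.edge_ghost_sum[of v G es] by (simp add: star_sum)
qed (simp_all add: lpa_relations.intros)

lemma star_presented_eq:
  "presented_eq (lpa_gens G) (lpa_relations G) s t \<Longrightarrow>
    presented_eq (lpa_gens G) (lpa_relations G) (star_term s) (star_term t)"
proof (induction rule: presented_eq.induct)
  case (axiom s t)
  then show ?case by (rule star_axiom)
next
  case (relation s t)
  then show ?case by (intro presented_eq.relation star_relation) simp_all
next
  case (trans s t u)
  then show ?case by (metis presented_eq.trans)
qed (auto intro: presented_eq.refl presented_eq.sym presented_eq.neg presented_eq.add
      presented_eq.mult presented_eq.scale)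

definition star where "star = lift_terms (lpa_gens G) (lpa_relations G) (\<lambda>t. cl (star_term t))"

lemma star_cl: "t \<in> alg_terms (lpa_gens G) \<Longrightarrow> star (cl t) = cl (star_term t)"
  unfolding star_def by (rule lift_terms_class) (simp_all add: term_class_eqI star_presented_eq)

lemma star_simps:
  "z \<in> carrier L \<Longrightarrow> star z \<in> carrier L"
  "z \<in> carrier L \<Longrightarrow> star (star z) = z"
  "\<lbrakk>y \<in> carrier L; z \<in> carrier L\<rbrakk> \<Longrightarrow> star (y \<oplus>\<^bsub>L\<^esub> z) = star y \<oplus>\<^bsub>L\<^esub> star z"
  "\<lbrakk>y \<in> carrier L; z \<in> carrier L\<rbrakk> \<Longrightarrow> star (y \<otimes>\<^bsub>L\<^esub> z) = star z \<otimes>\<^bsub>L\<^esub> star y"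
  by (elim L_cases; simp add: star_cl L_ops)+

lemma star_bij: "bij_betw star (carrier L) (carrier L)"
  by (rule bij_betw_byWitness[of _ star]) (auto simp: star_simps)

text \<open>
  The relations are symmetric under \<open>e \<leftrightarrow> e*\<close> with reversal of
  products, so \<open>L\<close> is isomorphic to its opposite ring and left conditions are
  equivalent to right ones.
\<close>

lemma L_left_right:
  fixes A defines "A \<equiv> (L :: ('r :: comm_ring_1, (('a, 'b) lpa_gen, 'r) alg_term set) module)"
  shows "categorically_left_noetherian A \<longleftrightarrow> categorically_right_noetherian A"
    "locally_left_noetherian A \<longleftrightarrow> locally_right_noetherian A"
proof -
  have A: "nonunital_ring A" "has_local_units A"
    unfolding A_def by (rule L.nonunital_ring_axioms, rule L_local_units)
  have B: "nonunital_ring (opposite_ring A)" "has_local_units (opposite_ring A)"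
    using A by (simp_all add: nonunital_ring.opposite_nonunital nonunital_ring.opposite_local_units)
  have bij: "bij_betw star (carrier A) (carrier A)"
    unfolding A_def by (rule star_bij)
  then have img: "star ` carrier A = carrier A"
    by (simp add: bij_betw_def)
  have hom: "star (y \<oplus>\<^bsub>A\<^esub> z) = star y \<oplus>\<^bsub>A\<^esub> star z" "star (y \<otimes>\<^bsub>A\<^esub> z) = star z \<otimes>\<^bsub>A\<^esub> star y"
    if "y \<in> carrier A" "z \<in> carrier A" for y z
    using that unfolding A_def by (simp_all add: star_simps)
  show "categorically_left_noetherian A \<longleftrightarrow> categorically_right_noetherian A"
    unfolding categorically_right_noetherian_def
    using categorically_left_noetherian_surj[OF A, of star "opposite_ring A"]
      categorically_left_noetherian_surj[OF B, of star A] img hom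
    by auto
  show "locally_left_noetherian A \<longleftrightarrow> locally_right_noetherian A"
    unfolding locally_right_noetherian_def
    using locally_left_noetherian_bij[OF A(1) B(1), of star]
      locally_left_noetherian_bij[OF B(1) A(1), of star] bij hom
    by auto
qed

end

section \<open>Path monomials\<close>

context wf_digraph
begin

interpretation L: nonunital_algebra L
  by (rule presented_nonunital_algebra)

definition delta :: "('a, 'b) bpath \<Rightarrow> int \<Rightarrow> ('a, 'b) bpath \<times> int \<Rightarrow> 'r :: comm_ring_1" where
  "delta q l = (\<lambda>x. if x = (q, l) then 1 else 0)"

lemma act_vtx_delta:
  assumes "v \<in> verts G" "q \<in> boundary G"
  shows "act w (vtx v) (delta q l) = (if source q = v then delta q l else (\<lambda>x. 0))"
  using assms by (auto simp: fun_eq_iff vtx_def act_cl delta_def)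

lemma act_edg_delta:
  assumes e: "e \<in> arcs G" and q: "q \<in> boundary G"
  shows "act w (edg e) (delta q l) =
    (if source q = head G e then delta (arc_cons e q) (l + w e) else (\<lambda>x. 0))"
proof (intro ext)
  fix x :: "('a, 'b) bpath \<times> int"
  obtain p k where x: "x = (p, k)" by (cases x)
  have "p \<in> boundary G \<and> first_arc p = Some e \<and> rest p = q \<longleftrightarrow> source q = head G e \<and> p = arc_cons e q"
    using first_arc_Some[of p e] arc_cons_boundary[OF e q] rest_arc_cons[of q e] by auto
  note iff = this
  have "act w (edg e) (delta q l) x =
      (if (p \<in> boundary G \<and> first_arc p = Some e \<and> rest p = q) \<and> k - w e = l then 1 else 0)"
    using e by (auto simp: x edg_def act_cl delta_def)
  also have "\<dots> = (if source q = head G e then delta (arc_cons e q) (l + w e) else (\<lambda>x. 0)) x"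
    unfolding iff by (auto simp: x delta_def)
  finally show "act w (edg e) (delta q l) x =
      (if source q = head G e then delta (arc_cons e q) (l + w e) else (\<lambda>x. 0)) x" .
qed

lemma act_gho_delta:
  assumes e: "e \<in> arcs G" and q: "q \<in> boundary G"
  shows "act w (gho e) (delta q l) =
    (if first_arc q = Some e then delta (rest q) (l - w e) else (\<lambda>x. 0))"
proof (intro ext)
  fix x :: "('a, 'b) bpath \<times> int"
  obtain p k where x: "x = (p, k)" by (cases x)
  have "p \<in> boundary G \<and> source p = head G e \<and> arc_cons e p = q \<longleftrightarrow> first_arc q = Some e \<and> p = rest q"
    using first_arc_Some[OF q] rest_arc_cons[of p e] by auto
  note iff = this
  have "act w (gho e) (delta q l) x =
      (if (p \<in> boundary G \<and> source p = head G e \<and> arc_cons e p = q) \<and> k + w e = l then 1 else 0)"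
    using e by (auto simp: x gho_def act_cl delta_def)
  also have "\<dots> = (if first_arc q = Some e then delta (rest q) (l - w e) else (\<lambda>x. 0)) x"
    unfolding iff by (auto simp: x delta_def)
  finally show "act w (gho e) (delta q l) x =
      (if first_arc q = Some e then delta (rest q) (l - w e) else (\<lambda>x. 0)) x" .
qed

lemma act_zero: "z \<in> carrier L \<Longrightarrow> act w z (\<lambda>x. 0) = (\<lambda>x. 0)"
  by (intro ext act_linear(3))

lemma act_mult: "y \<in> carrier L \<Longrightarrow> z \<in> carrier L \<Longrightarrow> act w (y \<otimes>\<^bsub>L\<^esub> z) f = act w y (act w z f)"
  by (intro ext act_simps(3))

primrec path_el :: "'b list \<Rightarrow> 'a \<Rightarrow> (('a, 'b) lpa_gen, 'r :: comm_ring_1) alg_term set" where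
  "path_el [] v = vtx v"
| "path_el (e # a) v = edg e \<otimes>\<^bsub>L\<^esub> path_el a v"

primrec ghost_el :: "'b list \<Rightarrow> 'a \<Rightarrow> (('a, 'b) lpa_gen, 'r :: comm_ring_1) alg_term set" where
  "ghost_el [] v = vtx v"
| "ghost_el (e # a) v = ghost_el a v \<otimes>\<^bsub>L\<^esub> gho e"

abbreviation weight :: "('b \<Rightarrow> int) \<Rightarrow> 'b list \<Rightarrow> int" where
  "weight w a \<equiv> sum_list (map w a)"

lemma path_els_in_L [simp]:
  "awalk u a v \<Longrightarrow> path_el a v \<in> carrier L" "awalk u a v \<Longrightarrow> ghost_el a v \<in> carrier L"
  by (induction a arbitrary: u) (auto simp: awalk_simps)

lemma path_el_units:
  "awalk u a v \<Longrightarrow> vtx u \<otimes>\<^bsub>L\<^esub> path_el a v = path_el a v"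
  "awalk u a v \<Longrightarrow> path_el a v \<otimes>\<^bsub>L\<^esub> vtx v = path_el a v"
  "awalk u a v \<Longrightarrow> vtx v \<otimes>\<^bsub>L\<^esub> ghost_el a v = ghost_el a v"
  "awalk u a v \<Longrightarrow> ghost_el a v \<otimes>\<^bsub>L\<^esub> vtx u = ghost_el a v"
proof -
  show "vtx u \<otimes>\<^bsub>L\<^esub> path_el a v = path_el a v" if "awalk u a v"
    using that by (cases a) (auto simp: awalk_simps L_relations simp flip: L.m_assoc)
  show "ghost_el a v \<otimes>\<^bsub>L\<^esub> vtx u = ghost_el a v" if "awalk u a v"
    using that by (cases a) (auto simp: awalk_simps L_relations L.m_assoc)
  show "path_el a v \<otimes>\<^bsub>L\<^esub> vtx v = path_el a v" if "awalk u a v"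
    using that
  proof (induction a arbitrary: u)
    case (Cons e a)
    then have "e \<in> arcs G" "awalk (head G e) a v" "v \<in> verts G"
      by (auto simp: awalk_simps dest: awalk_last_in_verts)
    then show ?case using Cons.IH by (simp add: L.m_assoc)
  qed (simp add: awalk_simps L_relations)
  show "vtx v \<otimes>\<^bsub>L\<^esub> ghost_el a v = ghost_el a v" if "awalk u a v"
    using that
  proof (induction a arbitrary: u)
    case (Cons e a)
    then have "e \<in> arcs G" "awalk (head G e) a v" "v \<in> verts G"
      by (auto simp: awalk_simps dest: awalk_last_in_verts)
    then show ?case using Cons.IH by (simp flip: L.m_assoc)
  qed (simp add: awalk_simps L_relations)
qed

lemma act_path_el:
  assumes "awalk u a v" "x \<in> boundary G" "source x = v"
  shows "act w (path_el a v) (delta x l) = delta (prepend u a x) (l + weight w a)"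
  using assms(1)
proof (induction a arbitrary: u)
  case Nil
  then show ?case
    using assms by (auto simp: awalk_simps act_vtx_delta)
next
  case (Cons e a)
  then have e: "e \<in> arcs G" "u = tail G e" and a: "awalk (head G e) a v"
    by (auto simp: awalk_simps)
  then show ?case
    using Cons.IH[OF a] prepend_boundary[of "head G e" a x] assms(2,3)
    by (simp add: act_mult[OF _ path_els_in_L(1)[OF a]] act_edg_delta prepend_Cons algebra_simps)
qed

lemma act_ghost_el:
  assumes "awalk u b v" "x \<in> boundary G" "source x = v"
  shows "act w (ghost_el b v) (delta (prepend u b x) l) = delta x (l - weight w b)"
  using assms(1)
proof (induction b arbitrary: u l)
  case Nil
  then show ?case
    using assms by (auto simp: awalk_simps act_vtx_delta)
next
  case (Cons e a)
  then have e: "e \<in> arcs G" "u = tail G e" and a: "awalk (head G e) a v"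
    by (auto simp: awalk_simps)
  then have bd: "prepend (head G e) a x \<in> boundary G" "source (prepend (head G e) a x) = head G e"
    using prepend_boundary[of "head G e" a x] assms(2,3) by simp_all
  then show ?case
    using Cons.IH[OF a] e arc_cons_boundary[OF e(1) bd]
    by (simp add: act_mult[OF path_els_in_L(2)[OF a]] act_gho_delta prepend_Cons rest_arc_cons algebra_simps)
qed

text \<open>
  The ghost of \<open>b\<close> kills every path that does not begin with \<open>b\<close>,
  because at the first deviation a ghost edge meets another edge.
\<close>

lemma act_ghost_el_zero:
  assumes "awalk u b v" "q \<in> boundary G"
    and "\<And>x. x \<in> boundary G \<Longrightarrow> source x = v \<Longrightarrow> q \<noteq> prepend u b x"
  shows "act w (ghost_el b v) (delta q l) = (\<lambda>x. 0)"
  using assms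
proof (induction b arbitrary: u q l)
  case Nil
  then have "u = v" "v \<in> verts G" by (auto simp: awalk_simps)
  moreover have "source q \<noteq> v"
    using Nil.prems(3)[of q] Nil.prems(2) \<open>u = v\<close> by auto
  ultimately show ?case
    using Nil.prems(2) by (simp add: act_vtx_delta)
next
  case (Cons e a)
  then have e: "e \<in> arcs G" "u = tail G e" and a: "awalk (head G e) a v"
    by (auto simp: awalk_simps)
  show ?case
  proof (cases "first_arc q = Some e")
    case True
    note f = first_arc_Some[OF Cons.prems(2) True]
    have nz: "rest q \<noteq> prepend (head G e) a x" if "x \<in> boundary G" "source x = v" for x
      using Cons.prems(3)[OF that] f(4) e(2) by (auto simp: prepend_Cons)
    show ?thesis
      using e True Cons.prems(2) Cons.IH[OF a f(2) nz]
      by (simp add: act_mult[OF path_els_in_L(2)[OF a]] act_gho_delta)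
  next
    case False
    then show ?thesis
      using e a Cons.prems(2) by (simp add: act_mult[OF path_els_in_L(2)[OF a]] act_gho_delta act_zero)
  qed
qed

definition monomial :: "'b list \<Rightarrow> 'b list \<Rightarrow> 'a \<Rightarrow> (('a, 'b) lpa_gen, 'r :: comm_ring_1) alg_term set" where
  "monomial a b v = path_el a v \<otimes>\<^bsub>L\<^esub> ghost_el b v"

lemma monomial_in_L [simp]: "awalk u a v \<Longrightarrow> awalk u' b v \<Longrightarrow> monomial a b v \<in> carrier L"
  unfolding monomial_def by (metis L.m_closed path_els_in_L)

lemma act_monomial:
  assumes "awalk u a v" "awalk u' b v" "x \<in> boundary G" "source x = v"
  shows "act w (monomial a b v) (delta (prepend u' b x) l) =
    delta (prepend u a x) (l + weight w a - weight w b)"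
  unfolding monomial_def
  by (simp add: act_mult[OF path_els_in_L(1)[OF assms(1)] path_els_in_L(2)[OF assms(2)]]
      act_path_el[OF assms(1,3,4)] act_ghost_el[OF assms(2-4)] algebra_simps)

lemma act_monomial_zero:
  assumes "awalk u a v" "awalk u' b v" "q \<in> boundary G"
    and "\<And>x. x \<in> boundary G \<Longrightarrow> source x = v \<Longrightarrow> q \<noteq> prepend u' b x"
  shows "act w (monomial a b v) (delta q l) = (\<lambda>x. 0)"
  unfolding monomial_def
  by (simp add: act_mult[OF path_els_in_L(1)[OF assms(1)] path_els_in_L(2)[OF assms(2)]]
      act_ghost_el_zero[OF assms(2-4)] act_zero[OF path_els_in_L(1)[OF assms(1)]])

section \<open>Necessity of the graph conditions\<close>

text \<open>
  Infinitely many finite paths from \<open>v\<close>, none a prefix of another. The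
  corresponding elements \<open>a a*\<close> are orthogonal idempotents of the corner at
  \<open>v\<close>.
\<close>

definition prefix_antichain :: "'a \<Rightarrow> (nat \<Rightarrow> 'b list) \<Rightarrow> bool" where
  "prefix_antichain v \<alpha> \<longleftrightarrow> (\<forall>n. \<exists>u. awalk v (\<alpha> n) u) \<and> (\<forall>m n t. m \<noteq> n \<longrightarrow> \<alpha> m \<noteq> \<alpha> n @ t)"

lemma corner_vtx:
  assumes "v \<in> verts G"
  shows "(vtx v :: (('a, 'b) lpa_gen, 'r :: comm_ring_1) alg_term set) \<in> carrier L"
    "vtx v \<otimes>\<^bsub>L\<^esub> vtx v = (vtx v :: (('a, 'b) lpa_gen, 'r) alg_term set)"
  using assms by (simp_all add: L_relations)

text \<open>
  For each \<open>n\<close> choose a boundary path \<open>q\<close> that extends the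
  \<open>n\<close>-th member of the antichain. The idempotent of this member fixes
  \<open>q\<close> and kills the paths chosen for the others. Hence the left ideals of the
  corner whose elements kill all but the first \<open>n\<close> chosen paths increase strictly
  with \<open>n\<close>.
\<close>

lemma prefix_antichain_not_noetherian:
  assumes \<alpha>: "prefix_antichain v \<alpha>"
    and noeth: "locally_left_noetherian (L :: ('r :: comm_ring_1, (('a, 'b) lpa_gen, 'r) alg_term set) module)"
  shows False
proof -
  let ?L = "L :: ('r, (('a, 'b) lpa_gen, 'r) alg_term set) module"
  have "\<exists>u x. awalk v (\<alpha> n) u \<and> x \<in> boundary G \<and> source x = u" for n
    using \<alpha> boundary_path_exists awalk_last_in_verts unfolding prefix_antichain_def by meson
  then obtain u x where ux: "\<And>n. awalk v (\<alpha> n) (u n)" "\<And>n. x n \<in> boundary G" "\<And>n. source (x n) = u n"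
    by metis
  have v: "v \<in> verts G" using ux(1) by blast
  let ?C = "corner_ring ?L (vtx v)"
  note corner = corner_vtx[OF v, where 'r = 'r]
  interpret C: nonunital_ring ?C by (rule L.corner_nonunital[OF corner])
  note C = L.corner_carrier_iff[OF corner] and corner_ring_simps(1) [simp del]
  define w :: "'b \<Rightarrow> int" where "w = (\<lambda>e. 0)"
  define q where "q n = prepend v (\<alpha> n) (x n)" for n
  have qb: "q n \<in> boundary G" for n
    unfolding q_def using prepend_boundary[of v "\<alpha> n" "x n"] ux by simp
  \<comment> \<open>The left ideal of the elements that annihilate \<open>q m\<close> for all \<open>m \<ge>
    n\<close>. The idempotent of the \<open>n\<close>-th path separates \<open>N n\<close>
    from \<open>N (Suc n)\<close>.\<close>
  define N where "N n = {z \<in> carrier ?C. \<forall>m\<ge>n. act w z (delta (q m) 0) = (\<lambda>x. 0)}" for n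
  have NC: "z \<in> carrier ?L" if "z \<in> carrier ?C" for z using that C by blast
  have "submodule (N n) ?C (regular_module ?C)" for n
    unfolding C.regular_submodule_iff
  proof (intro conjI ballI)
    fix z assume z: "z \<in> N n"
    then have zc: "z \<in> carrier ?C" by (simp add: N_def)
    have "act w (\<ominus>\<^bsub>?C\<^esub> z) (delta (q m) 0) = (\<lambda>x. 0)" if "m \<ge> n" for m
    proof (intro ext)
      fix y
      have "act w (\<ominus>\<^bsub>?C\<^esub> z \<oplus>\<^bsub>?L\<^esub> z) (delta (q m) 0) y = 0"
        using C.l_neg[OF zc] by (simp add: act_simps)
      then show "act w (\<ominus>\<^bsub>?C\<^esub> z) (delta (q m) 0) y = 0"
        using z that NC[OF zc] NC[OF C.a_inv_closed[OF zc]] by (simp add: act_simps N_def)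
    qed
    then have "\<ominus>\<^bsub>?C\<^esub> z \<in> N n"
      using zc by (simp add: N_def)
    then show "\<exists>y\<in>N n. y \<oplus>\<^bsub>?C\<^esub> z = \<zero>\<^bsub>?C\<^esub>"
      using C.l_neg[OF zc] by blast
  next
    fix y z assume "y \<in> N n" "z \<in> N n"
    then show "y \<oplus>\<^bsub>?C\<^esub> z \<in> N n"
      using C.a_closed[of y z] NC by (auto simp: N_def act_simps fun_eq_iff)
  next
    fix y z assume "y \<in> carrier ?C" "z \<in> N n"
    then show "y \<otimes>\<^bsub>?C\<^esub> z \<in> N n"
      using C.m_closed[of y z] NC by (auto simp: N_def act_mult act_zero)
  next
    show "\<zero>\<^bsub>?C\<^esub> \<in> N n"
      using C.zero_closed by (auto simp: N_def act_simps fun_eq_iff)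
  qed (auto simp: N_def)
  moreover have "N n \<subseteq> N (Suc n)" for n
    by (auto simp: N_def)
  moreover have "left_noetherian ?C"
    using noeth corner unfolding locally_left_noetherian_def by blast
  ultimately obtain n where n: "\<And>i. i \<ge> n \<Longrightarrow> N i = N n"
    unfolding left_noetherian_def noetherian_module_def by blast
  define z where "z = (monomial (\<alpha> n) (\<alpha> n) (u n) :: (('a, 'b) lpa_gen, 'r) alg_term set)"
  have P: "path_el (\<alpha> n) (u n) \<in> carrier ?L" "ghost_el (\<alpha> n) (u n) \<in> carrier ?L"
    by (rule path_els_in_L[OF ux(1)])+
  have U: "vtx v \<otimes>\<^bsub>?L\<^esub> path_el (\<alpha> n) (u n) = path_el (\<alpha> n) (u n)"
      "ghost_el (\<alpha> n) (u n) \<otimes>\<^bsub>?L\<^esub> vtx v = ghost_el (\<alpha> n) (u n)"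
    by (rule path_el_units[OF ux(1)])+
  have zC: "z \<in> carrier ?C"
    unfolding C z_def monomial_def
    using L.m_assoc[OF corner(1) P] L.m_assoc[OF P corner(1)] P by (simp add: U)
  have "z \<in> N (Suc n)"
    unfolding N_def
  proof (intro CollectI conjI zC allI impI)
    fix m assume m: "m \<ge> Suc n"
    have "q m \<noteq> prepend v (\<alpha> n) y" if y: "y \<in> boundary G" "source y = u n" for y
    proof
      assume eq: "q m = prepend v (\<alpha> n) y"
      show False
      proof (cases "length (\<alpha> n) \<le> length (\<alpha> m)")
        case True
        then obtain t where "\<alpha> m = \<alpha> n @ t"
          using prepend_eq_imp_prefix[of v "\<alpha> n" y v "\<alpha> m" "x m"] eq ux y by (auto simp: q_def)
        then show False using \<alpha> m unfolding prefix_antichain_def by (metis Suc_n_not_le_n)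
      next
        case False
        then obtain t where "\<alpha> n = \<alpha> m @ t"
          using prepend_eq_imp_prefix[of v "\<alpha> m" "x m" v "\<alpha> n" y] eq ux y by (auto simp: q_def)
        then show False using \<alpha> m unfolding prefix_antichain_def by (metis Suc_n_not_le_n)
      qed
    qed
    then show "act w z (delta (q m) 0) = (\<lambda>x. 0)"
      unfolding z_def by (rule act_monomial_zero[OF ux(1) ux(1) qb])
  qed
  then have "z \<in> N n" using n[of "Suc n"] by simp
  then have "act w z (delta (q n) 0) = (\<lambda>x. 0)" by (simp add: N_def)
  moreover have "act w z (delta (q n) 0) = delta (q n) (0 + weight w (\<alpha> n) - weight w (\<alpha> n))"
    unfolding z_def q_def using ux by (intro act_monomial)
  ultimately have "delta (q n) 0 (q n, 0) = (0 :: 'r)" by simp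
  then show False by (simp add: delta_def)
qed

text \<open>
  The edges out of an infinite emitter are pairwise incomparable paths of length one.
\<close>

lemma infinite_emitter_antichain:
  assumes v: "infinite_emitter G v"
  shows "\<exists>\<alpha>. prefix_antichain v \<alpha>"
proof -
  obtain f :: "nat \<Rightarrow> 'b" where f: "inj f" "range f \<subseteq> out_arcs G v"
    using v infinite_countable_subset unfolding infinite_emitter_def by blast
  have fn: "f n \<in> arcs G" "tail G (f n) = v" for n
    using f(2) by (auto simp: image_subset_iff)
  have "awalk v [f n] (head G (f n))" for n
    using fn by (simp add: awalk_simps)
  moreover have "[f m] \<noteq> [f n] @ t" if "m \<noteq> n" for m n t
    using f(1) that by (auto dest: injD)
  ultimately show ?thesis
    unfolding prefix_antichain_def by (intro exI[of _ "\<lambda>n. [f n]"]) blast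
qed

lemma awalk_nth:
  assumes "awalk u p v" "i < length p"
  shows "p ! i \<in> arcs G" "awalk u (take i p) (tail G (p ! i))" "awalk (tail G (p ! i)) (drop i p) v"
proof -
  have "awalk u (take i p @ drop i p) v" using assms(1) by simp
  then obtain y where y: "awalk u (take i p) y" "awalk y (drop i p) v"
    unfolding awalk_append by blast
  moreover have "drop i p = p ! i # drop (Suc i) p"
    using assms(2) by (simp add: Cons_nth_drop_Suc)
  ultimately have "y = tail G (p ! i)" "p ! i \<in> arcs G"
    by (auto simp: awalk_simps)
  with y show "p ! i \<in> arcs G" "awalk u (take i p) (tail G (p ! i))" "awalk (tail G (p ! i)) (drop i p) v"
    by simp_all
qed

lemma awalk_closed_power: "awalk u p u \<Longrightarrow> awalk u (concat (replicate n p)) u"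
  by (induction n) (auto simp: awalk_append awalk_Nil_iff)

text \<open>
  Go around \<open>p\<close> exactly \<open>n\<close> times and then leave through the exit.
\<close>

lemma closed_exit_antichain:
  assumes p: "awalk u p u" "p \<noteq> []" and i: "i < length p"
    and f: "f \<in> arcs G" "tail G f = tail G (p ! i)" "f \<noteq> p ! i"
  shows "\<exists>\<alpha>. prefix_antichain u \<alpha>"
proof -
  define \<alpha> where "\<alpha> n = concat (replicate n p) @ take i p @ [f]" for n
  have "awalk u (\<alpha> n) (head G f)" for n
    unfolding \<alpha>_def awalk_append
    using awalk_closed_power[OF p(1)] awalk_nth(2)[OF p(1) i] f(1,2)
    by (intro exI[of _ u] exI[of _ "tail G f"] conjI) (simp_all add: awalk_simps)
  moreover have False if mn: "m < n" and eq: "\<alpha> m @ s = \<alpha> n @ t" for m n s t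
  proof -
    obtain k where k: "n = m + Suc k" using less_imp_Suc_add[OF mn] by auto
    have "\<alpha> n = concat (replicate m p) @ p @ concat (replicate k p) @ take i p @ [f]"
      unfolding \<alpha>_def k replicate_add by simp
    then have "take i p @ f # s = p @ concat (replicate k p) @ take i p @ f # t"
      using eq unfolding \<alpha>_def by simp
    then have "(take i p @ f # s) ! i = (p @ concat (replicate k p) @ take i p @ f # t) ! i"
      by simp
    then have "f = p ! i"
      using i by (simp add: nth_append)
    then show False using f(3) by simp
  qed
  then have "\<alpha> m \<noteq> \<alpha> n @ t" if "m \<noteq> n" for m n t
    using that by (metis append_Nil2 nat_neq_iff)
  ultimately show ?thesis
    unfolding prefix_antichain_def by blast
qed

lemma infinite_path_segment:
  assumes "infinite_path G \<alpha>" "i \<le> j"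
  shows "awalk (tail G (\<alpha> i)) (map \<alpha> [i..<j]) (tail G (\<alpha> j))"
  using assms(2)
proof (induction j rule: dec_induct)
  case base
  then show ?case using assms(1) by (auto simp: awalk_Nil_iff infinite_path_def)
next
  case (step j)
  then have "awalk (tail G (\<alpha> i)) (map \<alpha> [i..<j] @ [\<alpha> j]) (tail G (\<alpha> (Suc j)))"
    unfolding awalk_append using assms(1)
    by (intro exI[of _ "tail G (\<alpha> j)"]) (auto simp: awalk_simps infinite_path_def)
  then show ?case using step.hyps by simp
qed

text \<open>
  Follow the ray up to an exit and leave there; distinct exits give incomparable paths.
\<close>

lemma ray_exits_antichain:
  assumes r: "ray G \<alpha>" and inf: "infinite (exits_infinite G \<alpha>)"
  shows "\<exists>\<beta>. prefix_antichain (tail G (\<alpha> 0)) \<beta>"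
proof -
  have path: "infinite_path G \<alpha>" using r by (simp add: ray_def)
  obtain f :: "nat \<Rightarrow> 'b" where f: "inj f" "range f \<subseteq> exits_infinite G \<alpha>"
    using infinite_countable_subset[OF inf] by blast
  then have "\<exists>i. f n \<in> arcs G \<and> tail G (f n) = tail G (\<alpha> i) \<and> f n \<noteq> \<alpha> i" for n
    by (auto simp: exits_infinite_def image_subset_iff)
  then obtain i where i: "\<And>n. f n \<in> arcs G" "\<And>n. tail G (f n) = tail G (\<alpha> (i n))" "\<And>n. f n \<noteq> \<alpha> (i n)"
    by metis
  define \<beta> where "\<beta> n = map \<alpha> [0..<i n] @ [f n]" for n
  have "awalk (tail G (\<alpha> 0)) (\<beta> n) (head G (f n))" for n
    unfolding \<beta>_def awalk_append using infinite_path_segment[OF path, of 0 "i n"] i(1,2)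
    by (intro exI[of _ "tail G (\<alpha> (i n))"]) (simp add: awalk_simps)
  moreover have "\<beta> m \<noteq> \<beta> n @ t" if mn: "m \<noteq> n" for m n t
  proof
    assume eq: "\<beta> m = \<beta> n @ t"
    have "length (\<beta> m) = length (\<beta> n @ t)" using eq by simp
    then have le: "i n \<le> i m" by (simp add: \<beta>_def)
    have nth: "\<beta> m ! i n = f n"
      unfolding eq by (simp add: \<beta>_def nth_append)
    show False
    proof (cases "i n = i m")
      case True
      then have "\<beta> m ! i n = f m" by (simp add: \<beta>_def nth_append)
      then show False using nth f(1) mn by (auto dest: injD)
    next
      case False
      then have "\<beta> m ! i n = \<alpha> (i n)" using le by (simp add: \<beta>_def nth_append)
      then show False using nth i(3) by simp
    qed
  qed
  ultimately show ?thesis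
    unfolding prefix_antichain_def by blast
qed

lemma locally_noetherian_graph_conditions:
  assumes "locally_left_noetherian (L :: ('r :: comm_ring_1, (('a, 'b) lpa_gen, 'r) alg_term set) module)"
  shows "\<forall>v\<in>verts G. \<not> infinite_emitter G v" "\<forall>p. cycle_path G p \<longrightarrow> exits_finite G p = {}"
    "\<forall>\<alpha>. ray G \<alpha> \<longrightarrow> finite (exits_infinite G \<alpha>)"
proof -
  note no = prefix_antichain_not_noetherian[OF _ assms]
  show "\<forall>v\<in>verts G. \<not> infinite_emitter G v"
    using no infinite_emitter_antichain by blast
  show "\<forall>\<alpha>. ray G \<alpha> \<longrightarrow> finite (exits_infinite G \<alpha>)"
    using no ray_exits_antichain by blast
  show "\<forall>p. cycle_path G p \<longrightarrow> exits_finite G p = {}"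
  proof (intro allI impI, rule ccontr)
    fix p assume "cycle_path G p" "exits_finite G p \<noteq> {}"
    then obtain u i f where "awalk u p u" "p \<noteq> []" "i < length p" "f \<in> arcs G"
      "tail G f = tail G (p ! i)" "f \<noteq> p ! i"
      by (auto simp: cycle_path_def closed_path_def exits_finite_def)
    then show False
      using no closed_exit_antichain by blast
  qed
qed

text \<open>
  The action only adds values and multiplies them by scalars, so ideals of the coefficient ring
  cut out invariant sets of functions.
\<close>

lemma rho_ideal_valued:
  assumes I: "ideal_set I" and f: "\<And>x. f x \<in> I"
  shows "rho w t f x \<in> I"
  using f
proof (induction t arbitrary: f x)
  case (Gen g)
  then show ?case using I by (cases g; cases x) (auto simp: ideal_set_def)
next
  case (Neg t)
  then show ?case using ideal_set_minus[OF I] by simp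
qed (use I in \<open>auto simp: ideal_set_def\<close>)

lemma act_ideal_valued:
  "\<lbrakk>z \<in> carrier L; ideal_set I; \<And>x. f x \<in> I\<rbrakk> \<Longrightarrow> act w z f x \<in> I"
  by (elim L_cases) (simp add: act_cl rho_ideal_valued)

text \<open>
  An ideal \<open>I\<close> of the coefficient ring is recovered from the left ideal of those
  \<open>z\<close> in a corner whose action on a fixed path takes values in \<open>I\<close>: it
  contains \<open>c v\<close> exactly when \<open>c \<in> I\<close>.
\<close>

lemma locally_noetherian_coefficients:
  assumes noeth: "locally_left_noetherian (L :: ('r :: comm_ring_1, (('a, 'b) lpa_gen, 'r) alg_term set) module)"
    and v: "v \<in> verts G"
  shows "noetherian_type TYPE('r)"
  unfolding noetherian_type_def
proof (intro allI impI, elim conjE)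
  fix I :: "nat \<Rightarrow> 'r set" assume I: "\<forall>n. ideal_set (I n)" "\<forall>n. I n \<subseteq> I (Suc n)"
  let ?L = "L :: ('r, (('a, 'b) lpa_gen, 'r) alg_term set) module"
  let ?C = "corner_ring ?L (vtx v)"
  obtain p where p: "p \<in> boundary G" "source p = v"
    using boundary_path_exists[OF v] by blast
  note corner = corner_vtx[OF v, where 'r = 'r]
  interpret C: nonunital_ring ?C by (rule L.corner_nonunital[OF corner])
  note C = L.corner_carrier_iff[OF corner] and corner_ring_simps(1) [simp del]
  have NC: "z \<in> carrier ?L" if "z \<in> carrier ?C" for z using that C by blast
  define w :: "'b \<Rightarrow> int" where "w = (\<lambda>e. 0)"
  have In: "0 \<in> I n" "x \<in> I n \<Longrightarrow> y \<in> I n \<Longrightarrow> x + y \<in> I n" "x \<in> I n \<Longrightarrow> - x \<in> I n" for n x y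
    using I(1) ideal_set_minus[of "I n" x] by (auto simp: ideal_set_def)
  define N where "N n = {z \<in> carrier ?C. \<forall>x. act w z (delta p 0) x \<in> I n}" for n
  have "submodule (N n) ?C (regular_module ?C)" for n
    unfolding C.regular_submodule_iff
  proof (intro conjI ballI)
    fix z assume z: "z \<in> N n"
    then have zc: "z \<in> carrier ?C" by (simp add: N_def)
    have "act w (\<ominus>\<^bsub>?C\<^esub> z) (delta p 0) y \<in> I n" for y
    proof -
      have "act w (\<ominus>\<^bsub>?C\<^esub> z \<oplus>\<^bsub>?L\<^esub> z) (delta p 0) y = 0"
        using C.l_neg[OF zc] by (simp add: act_simps)
      then have "act w (\<ominus>\<^bsub>?C\<^esub> z) (delta p 0) y = - act w z (delta p 0) y"
        using NC[OF zc] NC[OF C.a_inv_closed[OF zc]] by (simp add: act_simps eq_neg_iff_add_eq_0)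
      moreover have "act w z (delta p 0) y \<in> I n" using z unfolding N_def by blast
      ultimately show ?thesis using In(3) by simp
    qed
    then have "\<ominus>\<^bsub>?C\<^esub> z \<in> N n"
      using zc by (simp add: N_def)
    then show "\<exists>y\<in>N n. y \<oplus>\<^bsub>?C\<^esub> z = \<zero>\<^bsub>?C\<^esub>"
      using C.l_neg[OF zc] by blast
  next
    fix y z assume "y \<in> N n" "z \<in> N n"
    then show "y \<oplus>\<^bsub>?C\<^esub> z \<in> N n"
      using C.a_closed[of y z] NC In(2) by (auto simp: N_def act_simps)
  next
    fix y z assume y: "y \<in> carrier ?C" and z: "z \<in> N n"
    then have zc: "z \<in> carrier ?C" and "act w z (delta p 0) x \<in> I n" for x
      unfolding N_def by blast+
    then have "act w y (act w z (delta p 0)) x \<in> I n" for x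
      by (intro act_ideal_valued[OF NC[OF y] I(1)[rule_format]])
    then show "y \<otimes>\<^bsub>?C\<^esub> z \<in> N n"
      using C.m_closed[OF y zc] NC y zc by (simp add: N_def act_mult)
  next
    show "\<zero>\<^bsub>?C\<^esub> \<in> N n"
      using C.zero_closed In(1) by (auto simp: N_def act_simps)
  qed (auto simp: N_def)
  moreover have "N n \<subseteq> N (Suc n)" for n
    using I(2) by (auto simp: N_def)
  moreover have "left_noetherian ?C"
    using noeth corner unfolding locally_left_noetherian_def by blast
  ultimately obtain n where n: "\<And>i. i \<ge> n \<Longrightarrow> N i = N n"
    unfolding left_noetherian_def noetherian_module_def by blast
  have "c \<in> I i \<longleftrightarrow> c \<odot>\<^bsub>?L\<^esub> vtx v \<in> N i" for c i
  proof -
    have "c \<odot>\<^bsub>?L\<^esub> vtx v \<in> carrier ?C"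
      unfolding C using corner by (simp add: L.scale_l_mult L.scale_r_mult)
    moreover have "act w (c \<odot>\<^bsub>?L\<^esub> vtx v) (delta p 0) x = (if x = (p, 0) then c else 0)" for x
      using p v by (simp add: act_simps act_vtx_delta) (simp add: delta_def)
    ultimately show ?thesis
      using In(1)[of i] by (auto simp: N_def)
  qed
  then show "\<exists>n. \<forall>i\<ge>n. I i = I n"
    using n by (intro exI[of _ n]) blast
qed

end

section \<open>Graphs without exits\<close>

locale exit_free_digraph = wf_digraph +
  assumes row_finite: "v \<in> verts G \<Longrightarrow> \<not> infinite_emitter G v"
    and cycle_no_exit: "cycle_path G p \<Longrightarrow> exits_finite G p = {}"
    and ray_finite_exits: "ray G \<alpha> \<Longrightarrow> finite (exits_infinite G \<alpha>)"
begin

text \<open>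
  From an isolated vertex one never has a choice: every vertex reachable from it emits at most
  one edge.
\<close>

definition isolated :: "'a \<Rightarrow> bool" where
  "isolated v \<longleftrightarrow> v \<in> verts G \<and>
    (\<forall>a u e f. awalk v a u \<longrightarrow> e \<in> out_arcs G u \<longrightarrow> f \<in> out_arcs G u \<longrightarrow> e = f)"

lemma isolated_awalk:
  assumes "isolated v" "awalk v a u" shows "isolated u"
  unfolding isolated_def
proof (intro conjI allI impI)
  show "u \<in> verts G" using assms(2) by (rule awalk_last_in_verts)
  fix b w e f assume "awalk u b w" "e \<in> out_arcs G w" "f \<in> out_arcs G w"
  moreover from this(1) have "awalk v (a @ b) w" using assms(2) awalk_append by blast
  ultimately show "e = f" using assms(1) unfolding isolated_def by blast
qed

lemma isolated_unique_arc:
  "\<lbrakk>isolated v; e \<in> arcs G; f \<in> arcs G; tail G e = v; tail G f = v\<rbrakk> \<Longrightarrow> e = f"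
  unfolding isolated_def using awalk_Nil_iff by (metis in_out_arcs_conv)

lemma isolated_arc: "\<lbrakk>isolated (tail G e); e \<in> arcs G\<rbrakk> \<Longrightarrow> isolated (head G e)"
  using isolated_awalk[of "tail G e" "[e]" "head G e"] by (simp add: awalk_simps)

lemma isolated_walk_prefix:
  "\<lbrakk>isolated v; awalk v a u; awalk v b w; length a \<le> length b\<rbrakk> \<Longrightarrow> \<exists>t. b = a @ t \<and> awalk u t w"
proof (induction a arbitrary: v b)
  case Nil
  then have "v = u" by (simp add: awalk_Nil_iff)
  then show ?case using Nil.prems(3) by (intro exI[of _ b]) simp
next
  case (Cons e a)
  then obtain f c where b: "b = f # c" by (cases b) auto
  have ef: "e \<in> arcs G" "f \<in> arcs G" "tail G e = v" "tail G f = v"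
    and w: "awalk (head G e) a u" "awalk (head G f) c w"
    using Cons.prems(2,3) b by (auto simp: awalk_simps)
  then have "e = f" using isolated_unique_arc[OF Cons.prems(1)] by blast
  moreover have "isolated (head G e)" using isolated_arc ef(1,3) Cons.prems(1) by simp
  ultimately obtain t where "c = a @ t" "awalk u t w"
    using Cons.IH[of "head G e" c] w Cons.prems(4) b by auto
  then show ?case using b \<open>e = f\<close> by simp
qed

lemma awalk_from_sink: "\<lbrakk>is_sink G u; awalk u t w\<rbrakk> \<Longrightarrow> t = []"
  by (cases t) (auto simp: is_sink_def awalk_simps)

lemma boundary_Fin: "Fin_path u p \<in> boundary G \<Longrightarrow> \<exists>v. awalk u p v \<and> is_sink G v"
  using row_finite by (auto simp: boundary_def dest: awalk_last_in_verts)

lemma boundary_Inf: "Inf_path \<alpha> \<in> boundary G \<longleftrightarrow> infinite_path G \<alpha>"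
  by (auto simp: boundary_def)

lemma isolated_boundary_Fin_Inf:
  assumes "isolated u" "Fin_path u p \<in> boundary G" "Inf_path \<alpha> \<in> boundary G" "tail G (\<alpha> 0) = u"
  shows False
proof -
  obtain v where v: "awalk u p v" "is_sink G v" using boundary_Fin[OF assms(2)] by blast
  have "awalk u (map \<alpha> [0..<Suc (length p)]) (tail G (\<alpha> (Suc (length p))))"
    using infinite_path_segment[of \<alpha> 0 "Suc (length p)"] assms(3,4) boundary_Inf by simp
  from isolated_walk_prefix[OF assms(1) v(1) this]
  obtain t w where t: "map \<alpha> [0..<Suc (length p)] = p @ t" "awalk v t w" by auto
  have "t = []" using awalk_from_sink[OF v(2) t(2)] .
  then show False using arg_cong[OF t(1), of length] by simp
qed

text \<open>
  Without choices there is only one maximal path.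
\<close>

lemma isolated_boundary_unique:
  assumes "isolated (source x)" "x \<in> boundary G" "y \<in> boundary G" "source y = source x"
  shows "x = y"
proof (cases x)
  case x: (Fin_path u p)
  then obtain v where v: "awalk u p v" "is_sink G v" using boundary_Fin assms(2) by blast
  show ?thesis
  proof (cases y)
    case y: (Fin_path u' q)
    then have u': "u' = u" using assms(4) x by simp
    then obtain v' where v': "awalk u q v'" "is_sink G v'" using boundary_Fin assms(3) y by blast
    have iso: "isolated u" using assms(1) x by simp
    have "p = q"
    proof (cases "length p \<le> length q")
      case True
      then show ?thesis
        using isolated_walk_prefix[OF iso v(1) v'(1)] awalk_from_sink[OF v(2)] by auto
    next
      case False
      then show ?thesis
        using isolated_walk_prefix[OF iso v'(1) v(1)] awalk_from_sink[OF v'(2)] by auto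
    qed
    then show ?thesis using x y u' by simp
  next
    case y: (Inf_path \<alpha>)
    have "tail G (\<alpha> 0) = u" using assms(4) unfolding x y by simp
    moreover have "isolated u" using assms(1) unfolding x by simp
    ultimately show ?thesis
      using isolated_boundary_Fin_Inf assms(2,3) unfolding x y by blast
  qed
next
  case x: (Inf_path \<alpha>)
  show ?thesis
  proof (cases y)
    case y: (Fin_path u p)
    have "tail G (\<alpha> 0) = u" using assms(4) unfolding x y by simp
    moreover from this have "isolated u" using assms(1) unfolding x by simp
    ultimately show ?thesis
      using isolated_boundary_Fin_Inf assms(2,3) unfolding x y by blast
  next
    case y: (Inf_path \<beta>)
    have inf: "infinite_path G \<alpha>" "infinite_path G \<beta>" using x y assms boundary_Inf by auto
    have iso: "isolated (tail G (\<alpha> 0))" "tail G (\<beta> 0) = tail G (\<alpha> 0)" using x y assms by auto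
    have "\<alpha> n = \<beta> n" for n
    proof -
      have "awalk (tail G (\<alpha> 0)) (map \<alpha> [0..<Suc n]) (tail G (\<alpha> (Suc n)))"
        "awalk (tail G (\<alpha> 0)) (map \<beta> [0..<Suc n]) (tail G (\<beta> (Suc n)))"
        using infinite_path_segment[OF inf(1), of 0 "Suc n"] infinite_path_segment[OF inf(2), of 0 "Suc n"] iso
        by simp_all
      from isolated_walk_prefix[OF iso(1) this]
      obtain t where t: "map \<beta> [0..<Suc n] = map \<alpha> [0..<Suc n] @ t" by auto
      then have "t = []" using arg_cong[OF t, of length] by simp
      with t show ?thesis by simp
    qed
    then show ?thesis using x y by auto
  qed
qed

text \<open>
  A closed walk decomposes into cycles: a repeated vertex splits off a shorter closed walk.
\<close>

lemma closed_walk_no_exit: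
  "\<lbrakk>awalk u p u; p \<noteq> []; e \<in> set p; f \<in> arcs G; tail G f = tail G e\<rbrakk> \<Longrightarrow> f = e"
proof (induction "length p" arbitrary: u p rule: less_induct)
  case less
  show ?case
  proof (cases "distinct (map (tail G) p)")
    case True
    then have "cycle_path G p" using less.prems(1,2) by (auto simp: cycle_path_def closed_path_def)
    then have "exits_finite G p = {}" by (rule cycle_no_exit)
    moreover obtain i where "i < length p" "p ! i = e" using less.prems(3) by (auto simp: in_set_conv_nth)
    ultimately show ?thesis using less.prems(4,5) by (auto simp: exits_finite_def)
  next
    case False
    then obtain i' j' where "i' < length p" "j' < length p" "i' \<noteq> j'" "tail G (p ! i') = tail G (p ! j')"
      by (auto simp: distinct_conv_nth)
    then have "\<exists>i j. i < j \<and> j < length p \<and> tail G (p ! i) = tail G (p ! j)"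
      by (metis nat_neq_iff)
    then obtain i j where ij: "i < j" "j < length p" "tail G (p ! i) = tail G (p ! j)" by blast
    define a b c where "a = take i p" and "b = take (j - i) (drop i p)" and "c = drop j p"
    have p: "p = a @ b @ c"
    proof -
      have "drop i p = b @ drop (j - i) (drop i p)" unfolding b_def by (rule append_take_drop_id[symmetric])
      also have "drop (j - i) (drop i p) = c" using ij(1) by (simp add: c_def)
      finally show ?thesis unfolding a_def by (metis append_take_drop_id)
    qed
    have len: "length a = i" "length b = j - i" "length c = length p - j"
      using ij by (simp_all add: a_def b_def c_def)
    obtain y z where y: "awalk u a y" "awalk y b z" "awalk z c u"
      using less.prems(1) unfolding p awalk_append by blast
    have bne: "b \<noteq> []" "c \<noteq> []" using len ij by auto
    have "y = tail G (hd b)"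
      using y(2) bne(1) by (cases b) (auto simp: awalk_simps)
    moreover have "z = tail G (hd c)"
      using y(3) bne(2) by (cases c) (auto simp: awalk_simps)
    moreover have "hd b = p ! i"
      using ij by (simp add: b_def hd_take hd_drop_conv_nth)
    moreover have "hd c = p ! j"
      using ij(2) by (simp add: c_def hd_drop_conv_nth)
    ultimately have "y = z" using ij(3) by simp
    then have closed: "awalk y b y" "awalk u (a @ c) u" using y awalk_append by blast+
    have "e \<in> set b \<or> e \<in> set (a @ c)" using less.prems(3) p by auto
    then show ?thesis
    proof
      assume "e \<in> set b"
      then show ?thesis
        using less.hyps[OF _ closed(1) bne(1)] less.prems(4,5) len ij by auto
    next
      assume "e \<in> set (a @ c)"
      then show ?thesis
        using less.hyps[OF _ closed(2)] bne(2) less.prems(4,5) len ij by auto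
    qed
  qed
qed

lemma awalk_split_arc:
  assumes "awalk u p v" "e \<in> set p"
  shows "\<exists>p1 p2. p = p1 @ e # p2 \<and> awalk u p1 (tail G e) \<and> awalk (head G e) p2 v \<and> e \<in> arcs G"
proof -
  obtain p1 p2 where p: "p = p1 @ e # p2" using assms(2) by (meson split_list)
  then show ?thesis using assms(1) by (auto simp: awalk_append awalk_Cons_iff)
qed

text \<open>
  Since a closed walk cannot be left, everything reachable from it lies on it.
\<close>

lemma closed_walk_reachable:
  assumes p: "awalk u p u" "p \<noteq> []"
  shows "awalk u a v \<Longrightarrow> \<exists>e\<in>set p. tail G e = v"
proof (induction a arbitrary: v rule: rev_induct)
  case Nil
  then have "v = u" by (simp add: awalk_Nil_iff)
  then show ?case using p by (cases p) (auto simp: awalk_simps)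
next
  case (snoc f a)
  then have f: "awalk u a (tail G f)" "f \<in> arcs G" "head G f = v"
    by (auto simp: awalk_append awalk_simps)
  then obtain e where e: "e \<in> set p" "tail G e = tail G f" using snoc.IH by blast
  have "f = e" using closed_walk_no_exit[OF p e(1) f(2)] e(2) by simp
  then obtain p1 p2 where p12: "p = p1 @ f # p2" "awalk (head G f) p2 u"
    using awalk_split_arc[OF p(1) e(1)] by auto
  show ?case
  proof (cases p2)
    case Nil
    then have "v = u" using p12(2) f(3) by (simp add: awalk_Nil_iff)
    then show ?thesis using p by (cases p) (auto simp: awalk_simps)
  next
    case (Cons g q)
    then have "tail G g = v" "g \<in> set p" using p12 f(3) by (auto simp: awalk_simps)
    then show ?thesis by blast
  qed
qed

lemma closed_walk_arcs:
  assumes "awalk u p u" "p \<noteq> []" "awalk u a (tail G f)" "f \<in> arcs G"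
  shows "f \<in> set p"
  using closed_walk_reachable[OF assms(1-3)] closed_walk_no_exit[OF assms(1,2) _ assms(4)] by metis

lemma closed_walk_isolated:
  assumes "awalk u p u" "p \<noteq> []" shows "isolated u"
  unfolding isolated_def
proof (intro conjI allI impI)
  show "u \<in> verts G" using assms(1) by (rule awalk_hd_in_verts)
  fix a v e f assume a: "awalk u a v" and ef: "e \<in> out_arcs G v" "f \<in> out_arcs G v"
  obtain g where "g \<in> set p" "tail G g = v" using closed_walk_reachable[OF assms a] by blast
  then show "e = f" using closed_walk_no_exit[OF assms, of g] ef by auto
qed

lemma closed_walk_rotate:
  assumes "awalk u p u" "p \<noteq> []" "awalk u a v"
  shows "\<exists>s. awalk v s v \<and> s \<noteq> []"
proof -
  obtain e where e: "e \<in> set p" "tail G e = v" using closed_walk_reachable[OF assms] by blast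
  then obtain p1 p2 where "p = p1 @ e # p2" "awalk u p1 v" "awalk (head G e) p2 u" "e \<in> arcs G"
    using awalk_split_arc[OF assms(1) e(1)] by auto
  then have "awalk v (e # p2 @ p1) v" using e(2) by (auto simp: awalk_Cons_iff awalk_append)
  then show ?thesis by blast
qed

text \<open>
  An infinite path either is a ray, which is exit free after its finitely many exits, or repeats
  a vertex and then runs along a closed walk without exits.
\<close>

lemma infinite_path_isolated:
  assumes \<alpha>: "infinite_path G \<alpha>"
  shows "\<exists>i. isolated (tail G (\<alpha> i))"
proof (cases "inj (\<lambda>i. tail G (\<alpha> i))")
  case True
  then have "ray G \<alpha>" using \<alpha> by (simp add: ray_def)
  then have fin: "finite (exits_infinite G \<alpha>)" by (rule ray_finite_exits)
  have arcs: "\<alpha> i \<in> arcs G" for i using \<alpha> by (simp add: infinite_path_def)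
  have "finite {i. \<exists>f\<in>exits_infinite G \<alpha>. tail G f = tail G (\<alpha> i)}"
  proof -
    have "{i. \<exists>f\<in>exits_infinite G \<alpha>. tail G f = tail G (\<alpha> i)} \<subseteq>
        (\<lambda>i. tail G (\<alpha> i)) -` (tail G ` exits_infinite G \<alpha>)"
    proof
      fix i assume "i \<in> {i. \<exists>f\<in>exits_infinite G \<alpha>. tail G f = tail G (\<alpha> i)}"
      then obtain f where f: "f \<in> exits_infinite G \<alpha>" "tail G f = tail G (\<alpha> i)" by blast
      show "i \<in> (\<lambda>i. tail G (\<alpha> i)) -` (tail G ` exits_infinite G \<alpha>)"
        using imageI[OF f(1), of "tail G"] unfolding f(2) by simp
    qed
    then show ?thesis using finite_vimageI[OF finite_imageI[OF fin] True] finite_subset by blast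
  qed
  then have "\<exists>N. \<forall>i\<in>{i. \<exists>f\<in>exits_infinite G \<alpha>. tail G f = tail G (\<alpha> i)}. i < N"
    unfolding finite_nat_set_iff_bounded .
  then obtain N where N: "\<And>i. \<exists>f\<in>exits_infinite G \<alpha>. tail G f = tail G (\<alpha> i) \<Longrightarrow> i < N"
    by blast
  have single: "f = \<alpha> i" if "i \<ge> N" "f \<in> arcs G" "tail G f = tail G (\<alpha> i)" for i f
  proof (rule ccontr)
    assume "f \<noteq> \<alpha> i"
    then have "f \<in> exits_infinite G \<alpha>" using that by (auto simp: exits_infinite_def)
    then have "i < N" using N that(3) by blast
    then show False using that(1) by simp
  qed
  have reach: "awalk (tail G (\<alpha> N)) a v \<Longrightarrow> v = tail G (\<alpha> (N + length a))" for a v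
  proof (induction a arbitrary: v rule: rev_induct)
    case Nil
    then show ?case by (simp add: awalk_Nil_iff)
  next
    case (snoc f a)
    then have f: "awalk (tail G (\<alpha> N)) a (tail G f)" "f \<in> arcs G" "head G f = v"
      by (auto simp: awalk_append awalk_simps)
    then have "f = \<alpha> (N + length a)" using snoc.IH single[of "N + length a" f] by simp
    then show ?case using f(3) \<alpha> by (auto simp: infinite_path_def)
  qed
  have "isolated (tail G (\<alpha> N))"
    unfolding isolated_def
  proof (intro conjI allI impI)
    show "tail G (\<alpha> N) \<in> verts G" using arcs by simp
    fix a u e f assume a: "awalk (tail G (\<alpha> N)) a u" "e \<in> out_arcs G u" "f \<in> out_arcs G u"
    have "u = tail G (\<alpha> (N + length a))" using reach[OF a(1)] .
    then show "e = f" using single[of "N + length a"] a(2,3) by auto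
  qed
  then show ?thesis by blast
next
  case False
  then obtain i j where "i < j" "tail G (\<alpha> i) = tail G (\<alpha> j)"
    unfolding inj_def by (metis nat_neq_iff)
  then have "awalk (tail G (\<alpha> i)) (map \<alpha> [i..<j]) (tail G (\<alpha> i))" "map \<alpha> [i..<j] \<noteq> []"
    using infinite_path_segment[OF \<alpha>, of i j] by auto
  then show ?thesis using closed_walk_isolated by blast
qed

definition branching :: "('a \<times> 'a) set" where
  "branching = {(head G e, tail G e) | e. e \<in> arcs G \<and> \<not> isolated (head G e)}"

text \<open>
  An infinite descent would be an infinite path that never meets an isolated vertex.
\<close>

lemma wf_branching: "wf branching"
  unfolding wf_iff_no_infinite_down_chain
proof
  assume "\<exists>f. \<forall>i. (f (Suc i), f i) \<in> branching"
  then obtain f where f: "\<And>i. (f (Suc i), f i) \<in> branching" by blast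
  have "\<exists>e. e \<in> arcs G \<and> head G e = f (Suc i) \<and> tail G e = f i \<and> \<not> isolated (f (Suc i))" for i
    using f[of i] unfolding branching_def by auto
  then obtain \<alpha> where \<alpha>: "\<And>i. \<alpha> i \<in> arcs G \<and> head G (\<alpha> i) = f (Suc i) \<and> tail G (\<alpha> i) = f i \<and> \<not> isolated (f (Suc i))"
    by metis
  then have "infinite_path G \<alpha>" by (simp add: infinite_path_def)
  then obtain i where "isolated (tail G (\<alpha> i))" using infinite_path_isolated by blast
  then have "isolated (head G (\<alpha> i))" using isolated_arc \<alpha> by blast
  then show False using \<alpha> by metis
qed

text \<open>
  Every boundary path eventually has no alternative: a finite one ends in a sink, and an
  infinite one reaches an isolated vertex.
\<close>

lemma boundary_isolated_tail:
  assumes "p \<in> boundary G"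
  shows "\<exists>u a x. p = prepend u a x \<and> awalk u a (source x) \<and> x \<in> boundary G \<and> isolated (source x)"
proof (cases p)
  case (Fin_path u q)
  then obtain v where v: "awalk u q v" "is_sink G v" using boundary_Fin assms by blast
  have "v \<in> verts G" using v(1) by (rule awalk_last_in_verts)
  then have "isolated v"
    using awalk_from_sink[OF v(2)] v(2) unfolding isolated_def
    by (metis awalk_Nil_iff empty_iff is_sink_def)
  moreover have "Fin_path v [] \<in> boundary G"
    using v(2) \<open>v \<in> verts G\<close> by (auto simp: boundary_def awalk_Nil_iff)
  ultimately show ?thesis
    using Fin_path v(1) by (intro exI[of _ u] exI[of _ q] exI[of _ "Fin_path v []"]) simp
next
  case (Inf_path \<alpha>)
  then have \<alpha>: "infinite_path G \<alpha>" using assms boundary_Inf by simp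
  then obtain i where i: "isolated (tail G (\<alpha> i))" using infinite_path_isolated by blast
  have "infinite_path G (suffix i \<alpha>)" using \<alpha> by (simp add: infinite_path_def)
  moreover have "\<alpha> = map \<alpha> [0..<i] \<frown> suffix i \<alpha>" by (auto simp: conc_def fun_eq_iff)
  moreover have "awalk (tail G (\<alpha> 0)) (map \<alpha> [0..<i]) (tail G (\<alpha> i))"
    using infinite_path_segment[OF \<alpha>, of 0 i] by simp
  ultimately show ?thesis
    using Inf_path i
    by (intro exI[of _ "tail G (\<alpha> 0)"] exI[of _ "map \<alpha> [0..<i]"] exI[of _ "Inf_path (suffix i \<alpha>)"])
      (simp add: boundary_Inf)
qed

subsection \<open>Weights\<close>

definition cycle_arcs :: "'b \<Rightarrow> 'b set" where
  "cycle_arcs e = {f \<in> arcs G. \<exists>a b. awalk (head G e) a (tail G f) \<and> awalk (head G f) b (tail G e)}"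

text \<open>
  One edge is chosen on each cycle. Counting marked edges then measures how often a walk goes
  around a cycle, and walks that meet no cycle have weight zero.
\<close>

definition marked :: "'b set" where
  "marked = {e \<in> arcs G. e \<in> cycle_arcs e \<and> e = (SOME f. f \<in> cycle_arcs e)}"

definition mark :: "'b \<Rightarrow> int" where "mark e = (if e \<in> marked then 1 else 0)"

lemma cycle_arcs_closed_walk:
  assumes p: "awalk u p u" "p \<noteq> []" "e \<in> set p"
  shows "cycle_arcs e = set p"
proof
  obtain p1 p2 where e: "p = p1 @ e # p2" "awalk u p1 (tail G e)" "awalk (head G e) p2 u" "e \<in> arcs G"
    using awalk_split_arc[OF p(1,3)] by blast
  show "cycle_arcs e \<subseteq> set p"
  proof
    fix f assume "f \<in> cycle_arcs e"
    then obtain a where a: "awalk (head G e) a (tail G f)" "f \<in> arcs G" unfolding cycle_arcs_def by blast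
    have "awalk u (p1 @ e # a) (tail G f)"
      using e(2,4) a(1) by (auto simp: awalk_append awalk_Cons_iff)
    then show "f \<in> set p" using closed_walk_arcs[OF p(1,2)] a(2) by blast
  qed
  show "set p \<subseteq> cycle_arcs e"
  proof
    fix f assume "f \<in> set p"
    then obtain q1 q2 where f: "awalk u q1 (tail G f)" "awalk (head G f) q2 u" "f \<in> arcs G"
      using awalk_split_arc[OF p(1)] by blast
    then have "awalk (head G e) (p2 @ q1) (tail G f)" "awalk (head G f) (q2 @ p1) (tail G e)"
      using e awalk_append by blast+
    then show "f \<in> cycle_arcs e" using f(3) unfolding cycle_arcs_def by blast
  qed
qed

lemma mark_closed_walk:
  assumes p: "awalk u p u" "p \<noteq> []"
  shows "\<exists>d\<in>set p. \<forall>e\<in>set p. mark e = (if e = d then 1 else 0)"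
proof (intro bexI ballI)
  let ?d = "SOME f. f \<in> set p"
  show "?d \<in> set p" using p(2) by (simp add: some_in_eq)
  fix e assume e: "e \<in> set p"
  then have "e \<in> arcs G" using awalk_split_arc[OF p(1)] by blast
  then have "e \<in> marked \<longleftrightarrow> e = ?d"
    using cycle_arcs_closed_walk[OF p e] e by (simp add: marked_def)
  then show "mark e = (if e = ?d then 1 else 0)" by (simp add: mark_def)
qed

abbreviation mweight :: "'b list \<Rightarrow> int" where "mweight a \<equiv> sum_list (map mark a)"

lemma mweight_closed_pos:
  assumes p: "awalk u p u" "p \<noteq> []"
  shows "mweight p > 0"
proof -
  obtain d where d: "d \<in> set p" "mark d = 1" using mark_closed_walk[OF p] by fastforce
  then obtain p1 p2 where "p = p1 @ d # p2" by (meson split_list)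
  moreover have "mweight q \<ge> 0" for q by (induction q) (auto simp: mark_def)
  ultimately show ?thesis using d(2) by (simp add: add_nonneg_pos add_pos_nonneg)
qed

text \<open>
  A shortest closed walk repeats no edge, so it meets the marked edge once.
\<close>

lemma mweight_one:
  assumes "awalk u p u" "p \<noteq> []"
  shows "\<exists>c. awalk u c u \<and> c \<noteq> [] \<and> mweight c = 1"
proof -
  obtain c where c: "awalk u c u" "c \<noteq> []" and min: "\<And>q. awalk u q u \<Longrightarrow> q \<noteq> [] \<Longrightarrow> length c \<le> length q"
    using ex_has_least_nat[of "\<lambda>q. awalk u q u \<and> q \<noteq> []" p length] assms by blast
  have "distinct c"
  proof (rule ccontr)
    assume "\<not> distinct c"
    then obtain xs ys zs e where split: "c = xs @ [e] @ ys @ [e] @ zs"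
      using not_distinct_decomp by blast
    then have "awalk u (xs @ [e] @ zs) u"
      using c(1) by (auto simp: awalk_append awalk_Cons_iff)
    then have "length c \<le> length (xs @ [e] @ zs)" by (intro min) auto
    then show False unfolding split by simp
  qed
  obtain d where d: "d \<in> set c" "\<And>e. e \<in> set c \<Longrightarrow> mark e = (if e = d then 1 else 0)"
    using mark_closed_walk[OF c] by blast
  have "mweight c = sum mark (set c)"
    using \<open>distinct c\<close> by (simp add: sum_list_distinct_conv_sum_set)
  also have "\<dots> = (\<Sum>e\<in>set c. if e = d then 1 else 0)" using d(2) by (intro sum.cong) auto
  also have "\<dots> = 1" using d(1) by (simp add: sum.delta)
  finally show ?thesis using c by blast
qed

subsection \<open>Orbits and periodicity\<close>

text \<open>
  A form of eventual periodicity without infinite powers: a tail starts at a vertex that lies on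
  a closed walk.
\<close>

definition periodic :: "('a, 'b) bpath \<Rightarrow> bool" where
  "periodic p \<longleftrightarrow> (\<exists>u a x s. x \<in> boundary G \<and> awalk u a (source x) \<and> p = prepend u a x \<and>
    awalk (source x) s (source x) \<and> s \<noteq> [])"

lemma infinite_path_suffix: "infinite_path G \<alpha> \<Longrightarrow> infinite_path G (suffix i \<alpha>)"
  by (simp add: infinite_path_def)

text \<open>
  Both paths start at the same isolated vertex, which is the source of only one boundary path.
\<close>

lemma closed_walk_absorb:
  assumes "x \<in> boundary G" "awalk (source x) s (source x)"
  shows "prepend (source x) s x = x"
proof (cases "s = []")
  case False
  then show ?thesis
    using isolated_boundary_unique[of x "prepend (source x) s x"] closed_walk_isolated[OF assms(2)]
      prepend_boundary[OF assms(2,1)] assms(1) by simp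
qed simp

lemma conc_fixpoint:
  assumes "s \<frown> \<xi> = \<xi>" "s \<noteq> []" shows "\<xi> = s\<^sup>\<omega>"
proof
  show "\<xi> n = s\<^sup>\<omega> n" for n
  proof (induction n rule: less_induct)
    case (less n)
    show ?case
    proof (cases "n < length s")
      case True
      then show ?thesis using fun_cong[OF assms(1), of n] assms(2) by simp
    next
      case False
      then have shift: "\<xi> n = \<xi> (n - length s)" using fun_cong[OF assms(1), of n] by simp
      have "0 < length s" using assms(2) by simp
      then have "\<xi> (n - length s) = s\<^sup>\<omega> (n - length s)"
        using False by (intro less.IH) linarith
      also have "\<dots> = s\<^sup>\<omega> n" using False assms(2) by (simp add: le_mod_geq)
      finally show ?thesis using shift by simp
    qed
  qed
qed

lemma eventually_periodic_iff:
  assumes "p \<in> boundary G"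
  shows "eventually_periodic G p \<longleftrightarrow> periodic p"
proof
  assume "eventually_periodic G p"
  then obtain u \<alpha> v \<epsilon> where e: "awalk u \<alpha> v" "\<epsilon> \<noteq> []" "awalk v \<epsilon> v" "p = Inf_path (\<alpha> \<frown> \<epsilon>\<^sup>\<omega>)"
    by (auto simp: eventually_periodic_def closed_path_def)
  let ?x = "Inf_path (\<epsilon>\<^sup>\<omega>) :: ('a, 'b) bpath"
  have inf: "infinite_path G (\<alpha> \<frown> \<epsilon>\<^sup>\<omega>)" using assms e(4) boundary_Inf by simp
  have "infinite_path G (suffix (length \<alpha>) (\<alpha> \<frown> \<epsilon>\<^sup>\<omega>))"
    by (rule infinite_path_suffix[OF inf])
  then have "?x \<in> boundary G" by (simp add: boundary_Inf)
  moreover have "source ?x = v" using e(2,3) by (cases \<epsilon>) (auto simp: awalk_simps)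
  ultimately show "periodic p"
    unfolding periodic_def using e by (intro exI[of _ u] exI[of _ \<alpha>] exI[of _ ?x] exI[of _ \<epsilon>]) simp
next
  assume "periodic p"
  then obtain u a x s where x: "x \<in> boundary G" "awalk u a (source x)" "p = prepend u a x"
      "awalk (source x) s (source x)" "s \<noteq> []"
    unfolding periodic_def by blast
  have absorb: "prepend (source x) s x = x" using closed_walk_absorb[OF x(1,4)] .
  show "eventually_periodic G p"
  proof (cases x)
    case (Fin_path v q)
    then show ?thesis using absorb x(5) by simp
  next
    case (Inf_path \<xi>)
    then have "\<xi> = s\<^sup>\<omega>" using absorb x(5) conc_fixpoint by simp
    then show ?thesis
      unfolding eventually_periodic_def closed_path_def using x Inf_path
      by (intro exI[of _ u] exI[of _ a] exI[of _ "source x"] exI[of _ s]) auto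
  qed
qed

lemma same_orbitD:
  assumes "same_orbit G p q"
  obtains x u a v b where "x \<in> boundary G" "awalk u a (source x)" "awalk v b (source x)"
    "p = prepend u a x" "q = prepend v b x"
  using assms unfolding same_orbit_def by blast

lemma same_orbitI:
  "\<lbrakk>x \<in> boundary G; awalk u a (source x); awalk v b (source x)\<rbrakk> \<Longrightarrow>
    same_orbit G (prepend u a x) (prepend v b x)"
  unfolding same_orbit_def by blast

lemma same_orbit_refl: "p \<in> boundary G \<Longrightarrow> same_orbit G p p"
  using same_orbitI[of p "source p" "[]" "source p" "[]"] source_in_verts by (simp add: awalk_Nil_iff)

lemma same_orbit_sym: "same_orbit G p q \<Longrightarrow> same_orbit G q p"
  unfolding same_orbit_def by blast

lemma prepend_append_walk:
  "awalk u a (source x) \<Longrightarrow> x = prepend (source x) t y \<Longrightarrow> prepend u a x = prepend u (a @ t) y"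
  by (metis prepend_append)

text \<open>
  The two tails of the middle path are comparable, so the shorter of them is a common tail of
  the outer paths.
\<close>

lemma same_orbit_trans:
  assumes "same_orbit G p q" "same_orbit G q r" shows "same_orbit G p r"
proof -
  obtain x u a v b where x: "x \<in> boundary G" "awalk u a (source x)" "awalk v b (source x)"
      "p = prepend u a x" "q = prepend v b x" using assms(1) by (rule same_orbitD)
  obtain y v' c w d where y: "y \<in> boundary G" "awalk v' c (source y)" "awalk w d (source y)"
      "q = prepend v' c y" "r = prepend w d y" using assms(2) by (rule same_orbitD)
  show ?thesis
  proof (cases "length b \<le> length c")
    case True
    then obtain t where t: "x = prepend (source x) t y" "awalk (source x) t (source y)"
      using prepend_eq_imp_prefix[of v b x v' c y] x y by auto
    have "awalk u (a @ t) (source y)" using x(2) t(2) awalk_append by blast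
    then have "same_orbit G (prepend u (a @ t) y) (prepend w d y)" using y by (intro same_orbitI)
    then show ?thesis using x(4) y(5) prepend_append_walk[OF x(2) t(1)] by simp
  next
    case False
    then obtain t where t: "y = prepend (source y) t x" "awalk (source y) t (source x)"
      using prepend_eq_imp_prefix[of v' c y v b x] x y by auto
    have "awalk w (d @ t) (source x)" using y(3) t(2) awalk_append by blast
    then have "same_orbit G (prepend u a x) (prepend w (d @ t) x)" using x by (intro same_orbitI)
    then show ?thesis using x(4) y(5) prepend_append_walk[OF y(3) t(1)] by simp
  qed
qed

lemma same_orbit_boundary: "same_orbit G p q \<Longrightarrow> p \<in> boundary G \<and> q \<in> boundary G"
  by (elim same_orbitD) (simp add: prepend_boundary)

text \<open>A common tail of two paths of one periodic orbit can be chosen on a cycle.\<close>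

lemma periodic_common_tail:
  assumes "same_orbit G p q" "periodic p"
  shows "\<exists>x u a v b s. x \<in> boundary G \<and> awalk u a (source x) \<and> awalk v b (source x) \<and>
    p = prepend u a x \<and> q = prepend v b x \<and> awalk (source x) s (source x) \<and> s \<noteq> []"
proof -
  obtain y u a v b where y: "y \<in> boundary G" "awalk u a (source y)" "awalk v b (source y)"
      "p = prepend u a y" "q = prepend v b y" using assms(1) by (rule same_orbitD)
  obtain u' c x s where x: "x \<in> boundary G" "awalk u' c (source x)" "p = prepend u' c x"
      "awalk (source x) s (source x)" "s \<noteq> []"
    using assms(2) unfolding periodic_def by blast
  show ?thesis
  proof (cases "length a \<le> length c")
    case True
    then obtain t where t: "y = prepend (source y) t x" "awalk (source y) t (source x)"
      using prepend_eq_imp_prefix[of u a y u' c x] x y by auto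
    have "awalk u (a @ t) (source x)" "awalk v (b @ t) (source x)"
      using y(2,3) t(2) awalk_append by blast+
    moreover have "p = prepend u (a @ t) x" "q = prepend v (b @ t) x"
      using y(4,5) prepend_append_walk[OF y(2) t(1)] prepend_append_walk[OF y(3) t(1)] by simp_all
    ultimately show ?thesis using x(1,4,5) by blast
  next
    case False
    then obtain t where "awalk (source x) t (source y)"
      using prepend_eq_imp_prefix[of u' c x u a y] x y by auto
    then show ?thesis using closed_walk_rotate[OF x(4,5)] y by blast
  qed
qed

lemma periodic_same_orbit: "same_orbit G p q \<Longrightarrow> periodic p \<Longrightarrow> periodic q"
  using periodic_common_tail[of p q] unfolding periodic_def by blast

text \<open>
  The groupoid of the graph: pairs of paths with a common tail, together with the weight
  difference of the segments in front of it. The common tail starts at an isolated vertex; for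
  such tails the monomial attached to a triple will not depend on the choice of the segments.
\<close>

definition triples :: "(('a, 'b) bpath \<times> int \<times> ('a, 'b) bpath) set" where
  "triples = {(prepend u a x, mweight a - mweight b, prepend v b x) | u a v b x.
    x \<in> boundary G \<and> isolated (source x) \<and> awalk u a (source x) \<and> awalk v b (source x)}"

lemma triplesI:
  "\<lbrakk>x \<in> boundary G; isolated (source x); awalk u a (source x); awalk v b (source x)\<rbrakk> \<Longrightarrow>
    (prepend u a x, mweight a - mweight b, prepend v b x) \<in> triples"
  unfolding triples_def by blast

lemma triples_same_orbit: "(p, k, q) \<in> triples \<Longrightarrow> same_orbit G p q"
  unfolding triples_def using same_orbitI by blast

text \<open>
  A marked edge lies on a cycle, and a path that enters a cycle never leaves it.
\<close>

lemma marked_arc_periodic: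
  assumes "x \<in> boundary G" "awalk u a (source x)" "mweight a \<noteq> 0"
  shows "periodic (prepend u a x)"
proof -
  have "\<exists>e\<in>set a. mark e \<noteq> 0"
  proof (rule ccontr)
    assume "\<not> (\<exists>e\<in>set a. mark e \<noteq> 0)"
    then have "mweight a = 0" by (induction a) auto
    then show False using assms(3) by simp
  qed
  then obtain e where e: "e \<in> set a" "e \<in> marked" by (auto simp: mark_def split: if_splits)
  obtain a1 a2 where a: "a = a1 @ e # a2" "awalk u a1 (tail G e)" "awalk (head G e) a2 (source x)" "e \<in> arcs G"
    using awalk_split_arc[OF assms(2) e(1)] by blast
  obtain c where c: "awalk (head G e) c (tail G e)"
    using e(2) unfolding marked_def cycle_arcs_def by blast
  let ?y = "prepend (tail G e) (e # a2) x"
  have w: "awalk (tail G e) (e # a2) (source x)" using a by (simp add: awalk_Cons_iff)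
  note y = prepend_boundary[OF w assms(1)]
  have "awalk (tail G e) (e # c) (tail G e)" using a(4) c by (simp add: awalk_Cons_iff)
  moreover have "prepend u a x = prepend u a1 ?y" unfolding a(1) by (rule prepend_append)
  ultimately show ?thesis
    unfolding periodic_def using y a(2)
    by (intro exI[of _ u] exI[of _ a1] exI[of _ ?y] exI[of _ "e # c"]) simp
qed

text \<open>
  Paths that are not eventually periodic meet no marked edge.
\<close>

lemma triples_nonperiodic: "(p, k, q) \<in> triples \<Longrightarrow> \<not> periodic p \<Longrightarrow> k = 0"
proof -
  assume t: "(p, k, q) \<in> triples" and np: "\<not> periodic p"
  then obtain u a v b x where x: "p = prepend u a x" "k = mweight a - mweight b" "q = prepend v b x"
      "x \<in> boundary G" "awalk u a (source x)" "awalk v b (source x)"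
    unfolding triples_def by blast
  have "\<not> periodic q"
    using np periodic_same_orbit[OF same_orbit_sym[OF triples_same_orbit[OF t]]] by blast
  then have "mweight a = 0" "mweight b = 0"
    using np marked_arc_periodic[OF x(4,5)] marked_arc_periodic[OF x(4,6)] x(1,3) by auto
  then show "k = 0" using x(2) by simp
qed

lemma same_orbit_triple: "same_orbit G p q \<Longrightarrow> \<exists>k. (p, k, q) \<in> triples"
proof -
  assume "same_orbit G p q"
  then obtain y u a v b where y: "y \<in> boundary G" "awalk u a (source y)" "awalk v b (source y)"
      "p = prepend u a y" "q = prepend v b y" by (rule same_orbitD)
  obtain u' t x where x: "y = prepend u' t x" "awalk u' t (source x)" "x \<in> boundary G" "isolated (source x)"
    using boundary_isolated_tail[OF y(1)] by blast
  have u': "u' = source y" using prepend_boundary[OF x(2,3)] x(1) by simp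
  have "awalk u (a @ t) (source x)" "awalk v (b @ t) (source x)"
    using y(2,3) x(2) u' awalk_append by blast+
  moreover have "p = prepend u (a @ t) x" "q = prepend v (b @ t) x"
    using y(4,5) x(1) prepend_append by metis+
  ultimately show ?thesis using triplesI[OF x(3,4)] by blast
qed

lemma nonperiodic_triple: "same_orbit G p q \<Longrightarrow> \<not> periodic p \<Longrightarrow> (p, 0, q) \<in> triples"
  using same_orbit_triple triples_nonperiodic by blast

lemma mweight_replicate: "mweight c = 1 \<Longrightarrow> mweight (concat (replicate n c)) = int n"
  by (induction n) auto

text \<open>
  Going around the cycle changes the weight but not the path, so every integer occurs as a
  weight difference.
\<close>

lemma periodic_triple:
  assumes "same_orbit G p q" "periodic p"
  shows "(p, k, q) \<in> triples"
proof -
  obtain x u a v b s where x: "x \<in> boundary G" "awalk u a (source x)" "awalk v b (source x)"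
      "p = prepend u a x" "q = prepend v b x" "awalk (source x) s (source x)" "s \<noteq> []"
    using periodic_common_tail[OF assms] by blast
  obtain c where c: "awalk (source x) c (source x)" "mweight c = 1"
    using mweight_one[OF x(6,7)] by blast
  let ?c = "\<lambda>n. concat (replicate n c)"
  have iso: "isolated (source x)" using closed_walk_isolated[OF x(6,7)] .
  have cw: "awalk (source x) (?c n) (source x)" for n using awalk_closed_power[OF c(1)] .
  have absorb: "prepend z (d @ ?c n) x = prepend z d x" for z d n
    using closed_walk_absorb[OF x(1) cw[of n]] prepend_append[of z d "?c n" x "source x"] by simp
  \<comment> \<open>The missing weight is made up by turns of the cycle, appended on the left if positive and
    on the right if negative.\<close>
  define m where "m = k - (mweight a - mweight b)"
  have "awalk u (a @ ?c (nat m)) (source x)" "awalk v (b @ ?c (nat (- m))) (source x)"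
    using x(2,3) cw awalk_append by blast+
  from triplesI[OF x(1) iso this]
  have "(p, mweight (a @ ?c (nat m)) - mweight (b @ ?c (nat (- m))), q) \<in> triples"
    unfolding absorb x(4,5) .
  moreover have "mweight (a @ ?c (nat m)) - mweight (b @ ?c (nat (- m))) = k"
    by (simp add: mweight_replicate[OF c(2)] m_def)
  ultimately show ?thesis by simp
qed

end

section \<open>Matrix units of the Leavitt path algebra\<close>

text \<open>
  The type argument fixes the coefficients, so that all elements in this context live in one algebra.
\<close>

locale exit_free_lpa = exit_free_digraph G
  for G :: "('a, 'b) pre_digraph" (structure) +
  fixes coefficients :: "'r :: comm_ring_1 itself"
begin

abbreviation LL :: "('r, (('a, 'b) lpa_gen, 'r) alg_term set) module" where
  "LL \<equiv> presented_algebra (lpa_gens G) (lpa_relations G)"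

abbreviation mon :: "'b list \<Rightarrow> 'b list \<Rightarrow> 'a \<Rightarrow> (('a, 'b) lpa_gen, 'r) alg_term set" where
  "mon \<equiv> monomial"

interpretation L: nonunital_algebra LL
  by (rule presented_nonunital_algebra)

lemma path_el_snoc:
  assumes e: "e \<in> arcs G"
  shows "awalk u a (tail G e) \<Longrightarrow> path_el (a @ [e]) (head G e) = path_el a (tail G e) \<otimes>\<^bsub>LL\<^esub> edg e"
    "awalk u a (tail G e) \<Longrightarrow> ghost_el (a @ [e]) (head G e) = gho e \<otimes>\<^bsub>LL\<^esub> ghost_el a (tail G e)"
proof -
  show "path_el (a @ [e]) (head G e) = path_el a (tail G e) \<otimes>\<^bsub>LL\<^esub> edg e" if "awalk u a (tail G e)"
    using that
  proof (induction a arbitrary: u)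
    case (Cons f a)
    then have f: "f \<in> arcs G" "awalk (head G f) a (tail G e)" by (auto simp: awalk_simps)
    then show ?case using Cons.IH[OF f(2)] e by (simp add: L.m_assoc)
  qed (use e in \<open>simp add: L_relations\<close>)
  show "ghost_el (a @ [e]) (head G e) = gho e \<otimes>\<^bsub>LL\<^esub> ghost_el a (tail G e)" if "awalk u a (tail G e)"
    using that
  proof (induction a arbitrary: u)
    case (Cons f a)
    then have f: "f \<in> arcs G" "awalk (head G f) a (tail G e)" by (auto simp: awalk_simps)
    then show ?case using Cons.IH[OF f(2)] e by (simp add: L.m_assoc)
  qed (use e in \<open>simp add: L_relations\<close>)
qed

text \<open>
  At an isolated vertex with an edge, the sum in the last relation has one term.
\<close>

lemma isolated_vtx:
  assumes "isolated (tail G e)" "e \<in> arcs G"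
  shows "edg e \<otimes>\<^bsub>LL\<^esub> gho e = vtx (tail G e)"
proof -
  have "set [e] = out_arcs G (tail G e)"
    using isolated_unique_arc[OF assms(1)] assms(2) by auto
  then show ?thesis
    using assms(2) by (simp add: L_edge_ghost_sum[OF tail_in_verts[OF assms(2)] _ \<open>set [e] = _\<close>])
qed

lemma monomial_extend_arc:
  assumes "isolated (tail G e)" "e \<in> arcs G" and a: "awalk u a (tail G e)" and b: "awalk v b (tail G e)"
  shows "mon (a @ [e]) (b @ [e]) (head G e) =
    (mon a b (tail G e) :: (('a, 'b) lpa_gen, 'r) alg_term set)"
proof -
  let ?P = "path_el a (tail G e) :: (('a, 'b) lpa_gen, 'r) alg_term set"
  let ?Q = "ghost_el b (tail G e) :: (('a, 'b) lpa_gen, 'r) alg_term set"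
  have c: "?P \<in> carrier LL" "?Q \<in> carrier LL" by (rule path_els_in_L[OF a] path_els_in_L[OF b])+
  have g: "(edg e :: (('a, 'b) lpa_gen, 'r) alg_term set) \<in> carrier LL"
      "(gho e :: (('a, 'b) lpa_gen, 'r) alg_term set) \<in> carrier LL"
    using assms(2) by simp_all
  have "(?P \<otimes>\<^bsub>LL\<^esub> edg e) \<otimes>\<^bsub>LL\<^esub> (gho e \<otimes>\<^bsub>LL\<^esub> ?Q) = ?P \<otimes>\<^bsub>LL\<^esub> ((edg e \<otimes>\<^bsub>LL\<^esub> gho e) \<otimes>\<^bsub>LL\<^esub> ?Q)"
    using c g by (simp add: L.m_assoc)
  also have "\<dots> = ?P \<otimes>\<^bsub>LL\<^esub> ?Q"
    unfolding isolated_vtx[OF assms(1,2)] path_el_units(3)[OF b] ..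
  finally show ?thesis
    unfolding monomial_def path_el_snoc(1)[OF assms(2) a] path_el_snoc(2)[OF assms(2) b] .
qed

text \<open>
  By \<open>v = e e*\<close> at an isolated vertex, \<open>a b*\<close> equals \<open>(a e) (b
  e)*\<close>, and this can be repeated.
\<close>

lemma monomial_extend:
  "\<lbrakk>isolated v; awalk v t y; awalk u a v; awalk u' b v\<rbrakk> \<Longrightarrow> mon (a @ t) (b @ t) y = mon a b v"
proof (induction t arbitrary: v a b)
  case Nil
  then show ?case by (simp add: awalk_Nil_iff)
next
  case (Cons e t)
  then have e: "e \<in> arcs G" "v = tail G e" "awalk (head G e) t y" by (auto simp: awalk_simps)
  have "awalk u (a @ [e]) (head G e)" "awalk u' (b @ [e]) (head G e)"
    using Cons.prems(3,4) e by (auto simp: awalk_append awalk_simps)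
  moreover have "isolated (head G e)" using Cons.prems(1) e isolated_arc by simp
  ultimately have "mon ((a @ [e]) @ t) ((b @ [e]) @ t) y = mon (a @ [e]) (b @ [e]) (head G e)"
    using Cons.IH e(3) by blast
  then show ?case
    using monomial_extend_arc[OF _ e(1), of u a u' b] Cons.prems e(2) by simp
qed

definition represents where
  "represents g u a v b x \<longleftrightarrow> x \<in> boundary G \<and> isolated (source x) \<and> awalk u a (source x) \<and>
    awalk v b (source x) \<and> g = (prepend u a x, mweight a - mweight b, prepend v b x)"

lemma triples_represents: "g \<in> triples \<longleftrightarrow> (\<exists>u a v b x. represents g u a v b x)"
  unfolding triples_def represents_def by blast

text \<open>
  Two representations of a triple differ by a common extension: after lengthening the shorter
  segments on the left, those on the right differ by a closed walk of weight zero, which is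
  empty.
\<close>

lemma monomial_unique_le:
  assumes r: "represents g u a v b x" "represents g u' a' v' b' x'" and le: "length a \<le> length a'"
  shows "mon a' b' (source x') = mon a b (source x)"
proof -
  note x = r(1)[unfolded represents_def] and x' = r(2)[unfolded represents_def]
  have eq: "prepend u a x = prepend u' a' x'" "prepend v b x = prepend v' b' x'"
      "mweight a - mweight b = mweight a' - mweight b'"
    using x x' by auto
  obtain t where t: "a' = a @ t" "x = prepend (source x) t x'" "awalk (source x) t (source x')"
    using prepend_eq_imp_prefix[OF eq(1)] x x' le by auto
  have bt: "awalk v (b @ t) (source x')" using x t(3) awalk_append by blast
  have eq2: "prepend v (b @ t) x' = prepend v' b' x'"
    using eq(2) prepend_append_walk[of v b x t x'] x t(2) by simp
  have "b' = b @ t"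
  proof (cases "length (b @ t) \<le> length b'")
    case True
    then obtain s where s: "b' = (b @ t) @ s" "awalk (source x') s (source x')"
      using prepend_eq_imp_prefix[OF eq2 bt] x' by auto
    then have "mweight s = 0" using eq(3) t(1) by simp
    then have "s = []" using mweight_closed_pos[OF s(2)] by auto
    then show ?thesis using s(1) by simp
  next
    case False
    then obtain s where s: "b @ t = b' @ s" "awalk (source x') s (source x')"
      using prepend_eq_imp_prefix[OF eq2[symmetric] _ bt] x' by auto
    have "mweight b + mweight t = mweight b' + mweight s"
      using arg_cong[OF s(1), of mweight] by simp
    then have "mweight s = 0" using eq(3) t(1) by simp
    then have "s = []" using mweight_closed_pos[OF s(2)] by auto
    then show ?thesis using s(1) by simp
  qed
  then show ?thesis
    unfolding t(1) \<open>b' = b @ t\<close> by (intro monomial_extend[OF _ t(3)]) (use x in blast)+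
qed

lemma monomial_unique:
  assumes "represents g u a v b x" "represents g u' a' v' b' x'"
  shows "mon a' b' (source x') = mon a b (source x)"
proof (cases "length a \<le> length a'")
  case True
  show ?thesis by (rule monomial_unique_le[OF assms True])
next
  case False
  then show ?thesis by (intro monomial_unique_le[OF assms(2,1), symmetric]) simp
qed

text \<open>
  The choice of a representation does not matter, see \<open>monomial_unique\<close>.
\<close>

definition unit_el :: "('a, 'b) bpath \<times> int \<times> ('a, 'b) bpath \<Rightarrow> (('a, 'b) lpa_gen, 'r) alg_term set" where
  "unit_el g = (SOME z. \<exists>u a v b x. represents g u a v b x \<and> z = mon a b (source x))"

lemma unit_el_eq:
  assumes r: "represents g u a v b x" shows "unit_el g = mon a b (source x)"
  unfolding unit_el_def
proof (rule some_equality)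
  show "\<exists>u a' v b' x'. represents g u a' v b' x' \<and> mon a b (source x) = mon a' b' (source x')"
    using r by blast
next
  fix z assume "\<exists>u a v b x. represents g u a v b x \<and> z = mon a b (source x)"
  then obtain u' a' v' b' x' where r': "represents g u' a' v' b' x'" and z: "z = mon a' b' (source x')"
    by blast
  show "z = mon a b (source x)" unfolding z by (rule monomial_unique[OF r r'])
qed

lemma unit_el_in_L [simp]:
  assumes "g \<in> triples" shows "unit_el g \<in> carrier LL"
proof -
  obtain u a v b x where r: "represents g u a v b x" using assms triples_represents by blast
  then show ?thesis
    unfolding unit_el_eq[OF r] represents_def by (intro monomial_in_L) blast+
qed

lemma triples_boundary: "(p, k, q) \<in> triples \<Longrightarrow> p \<in> boundary G \<and> q \<in> boundary G"
  using triples_same_orbit same_orbit_boundary by blast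

text \<open>
  The matrix coefficient of the action: the value at \<open>(p, k)\<close> of \<open>z\<close>
  applied to the point function at \<open>(q, 0)\<close>.
\<close>

definition coef :: "(('a, 'b) lpa_gen, 'r) alg_term set
    \<Rightarrow> ('a, 'b) bpath \<times> int \<times> ('a, 'b) bpath \<Rightarrow> 'r" where
  "coef z = (\<lambda>(p, k, q). act mark z (delta q 0) (p, k))"

lemma coef_simps:
  "coef \<zero>\<^bsub>LL\<^esub> g = 0"
  "\<lbrakk>y \<in> carrier LL; z \<in> carrier LL\<rbrakk> \<Longrightarrow> coef (y \<oplus>\<^bsub>LL\<^esub> z) g = coef y g + coef z g"
  "z \<in> carrier LL \<Longrightarrow> coef (c \<odot>\<^bsub>LL\<^esub> z) g = c * coef z g"
  by (cases g; simp add: coef_def act_simps)+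

text \<open>
  An isolated vertex is the source of exactly one boundary path, so a unit moves one path only.
  Hence the units are linearly independent.
\<close>

lemma coef_unit_el:
  assumes g: "g \<in> triples" and q: "q \<in> boundary G"
  shows "coef (unit_el g) (p, k, q) = (if (p, k, q) = g then 1 else 0)"
proof -
  obtain u a v b x where r: "represents g u a v b x" using g triples_represents by blast
  note x = r[unfolded represents_def]
  have w: "awalk u a (source x)" "awalk v b (source x)" "x \<in> boundary G" using x by blast+
  show ?thesis
  proof (cases "q = prepend v b x")
    case True
    show ?thesis
      unfolding coef_def unit_el_eq[OF r] True prod.case act_monomial[OF w HOL.refl]
      using x True by (auto simp: delta_def)
  next
    case False
    have "q \<noteq> prepend v b y" if "y \<in> boundary G" "source y = source x" for y
      using isolated_boundary_unique[of x y] that x False by auto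
    moreover have "(p, k, q) \<noteq> g" using x False by auto
    ultimately show ?thesis
      unfolding coef_def unit_el_eq[OF r] prod.case
      by (simp add: act_monomial_zero[OF w(1,2) q])
  qed
qed

inductive_set unit_span :: "(('a, 'b) lpa_gen, 'r) alg_term set set" where
  zero: "\<zero>\<^bsub>LL\<^esub> \<in> unit_span"
| unit: "g \<in> triples \<Longrightarrow> c \<odot>\<^bsub>LL\<^esub> unit_el g \<in> unit_span"
| add: "\<lbrakk>y \<in> unit_span; z \<in> unit_span\<rbrakk> \<Longrightarrow> y \<oplus>\<^bsub>LL\<^esub> z \<in> unit_span"

lemma unit_span_in_L: "z \<in> unit_span \<Longrightarrow> z \<in> carrier LL"
  by (induction rule: unit_span.induct) auto

lemma unit_span_scale: "z \<in> unit_span \<Longrightarrow> c \<odot>\<^bsub>LL\<^esub> z \<in> unit_span"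
proof (induction rule: unit_span.induct)
  case zero
  then show ?case by (simp add: unit_span.zero)
next
  case (unit g d)
  then show ?case using unit_span.unit[OF unit, of "c * d"] by (simp add: L.scale_scale)
next
  case (add y z)
  then show ?case using unit_span.add[OF add.IH] by (simp add: L.scale_r_distr unit_span_in_L)
qed

lemma monomial_in_unit_span:
  assumes "isolated v" "awalk u a v" "awalk u' b v"
  shows "mon a b v \<in> unit_span"
proof -
  obtain x where x: "x \<in> boundary G" "source x = v"
    using boundary_path_exists assms(1) unfolding isolated_def by blast
  let ?g = "(prepend u a x, mweight a - mweight b, prepend u' b x)"
  have r: "represents ?g u a u' b x" unfolding represents_def using x assms by simp
  then have "?g \<in> triples" unfolding triples_represents by (intro exI)
  then have "1 \<odot>\<^bsub>LL\<^esub> unit_el ?g \<in> unit_span" by (rule unit_span.unit)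
  then show ?thesis
    unfolding unit_el_eq[OF r] x(2) L.scale_one[OF monomial_in_L[OF assms(2,3)]] .
qed

text \<open>
  Linearity reduces a multiplication to monomials that end in an isolated vertex.
\<close>

lemma unit_span_left:
  fixes y :: "(('a, 'b) lpa_gen, 'r) alg_term set"
  assumes y: "y \<in> carrier LL" and z: "z \<in> unit_span"
    and mono: "\<And>u a u' b v. \<lbrakk>isolated v; awalk u a v; awalk u' b v\<rbrakk> \<Longrightarrow> y \<otimes>\<^bsub>LL\<^esub> mon a b v \<in> unit_span"
  shows "y \<otimes>\<^bsub>LL\<^esub> z \<in> unit_span"
  using z
proof (induction rule: unit_span.induct)
  case zero
  then show ?case using y by (simp add: unit_span.zero)
next
  case (unit g c)
  then obtain u a v b x where r: "represents g u a v b x" using triples_represents by blast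
  then have "y \<otimes>\<^bsub>LL\<^esub> unit_el g \<in> unit_span"
    unfolding unit_el_eq[OF r] using mono unfolding represents_def by blast
  then show ?case using unit y by (simp add: L.scale_r_mult unit_span_scale)
next
  case (add z z')
  then show ?case using y unit_span.add[OF add.IH] by (simp add: L.r_distr unit_span_in_L)
qed

lemma unit_span_right:
  fixes y :: "(('a, 'b) lpa_gen, 'r) alg_term set"
  assumes y: "y \<in> carrier LL" and z: "z \<in> unit_span"
    and mono: "\<And>u a u' b v. \<lbrakk>isolated v; awalk u a v; awalk u' b v\<rbrakk> \<Longrightarrow> mon a b v \<otimes>\<^bsub>LL\<^esub> y \<in> unit_span"
  shows "z \<otimes>\<^bsub>LL\<^esub> y \<in> unit_span"
  using z
proof (induction rule: unit_span.induct)
  case zero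
  then show ?case using y by (simp add: unit_span.zero)
next
  case (unit g c)
  then obtain u a v b x where r: "represents g u a v b x" using triples_represents by blast
  then have "unit_el g \<otimes>\<^bsub>LL\<^esub> y \<in> unit_span"
    unfolding unit_el_eq[OF r] using mono unfolding represents_def by blast
  then show ?case using unit y by (simp add: L.scale_l_mult unit_span_scale)
next
  case (add z z')
  then show ?case using y unit_span.add[OF add.IH] by (simp add: L.l_distr unit_span_in_L)
qed

lemma vtx_path_el:
  assumes v: "v \<in> verts G" and a: "awalk u a w"
  shows "vtx v \<otimes>\<^bsub>LL\<^esub> path_el a w = (if v = u then path_el a w else \<zero>\<^bsub>LL\<^esub>)"
    "ghost_el a w \<otimes>\<^bsub>LL\<^esub> vtx v = (if v = u then ghost_el a w else \<zero>\<^bsub>LL\<^esub>)"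
proof -
  have u: "u \<in> verts G" using a by (rule awalk_hd_in_verts)
  note assoc = L.m_assoc[OF gens_in_L(1)[OF v] gens_in_L(1)[OF u] path_els_in_L(1)[OF a]]
    L.m_assoc[OF path_els_in_L(2)[OF a] gens_in_L(1)[OF u] gens_in_L(1)[OF v]]
  show "vtx v \<otimes>\<^bsub>LL\<^esub> path_el a w = (if v = u then path_el a w else \<zero>\<^bsub>LL\<^esub>)"
    using assoc(1) by (simp add: L_relations(1)[OF v u] path_el_units(1)[OF a] path_els_in_L(1)[OF a] split: if_splits)
  show "ghost_el a w \<otimes>\<^bsub>LL\<^esub> vtx v = (if v = u then ghost_el a w else \<zero>\<^bsub>LL\<^esub>)"
    using assoc(2) by (simp add: L_relations(1)[OF u v] path_el_units(4)[OF a] path_els_in_L(2)[OF a] split: if_splits)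
qed

lemma vtx_unit_span:
  assumes v: "v \<in> verts G" and z: "z \<in> unit_span" shows "vtx v \<otimes>\<^bsub>LL\<^esub> z \<in> unit_span"
proof (rule unit_span_left[OF gens_in_L(1)[OF v] z])
  fix u a u' b w assume w: "isolated w" "awalk u a w" "awalk u' b w"
  have "vtx v \<otimes>\<^bsub>LL\<^esub> mon a b w = (vtx v \<otimes>\<^bsub>LL\<^esub> path_el a w) \<otimes>\<^bsub>LL\<^esub> ghost_el b w"
    unfolding monomial_def
    by (rule L.m_assoc[OF gens_in_L(1)[OF v] path_els_in_L(1)[OF w(2)] path_els_in_L(2)[OF w(3)], symmetric])
  also have "\<dots> = (if v = u then mon a b w else \<zero>\<^bsub>LL\<^esub>)"
    unfolding vtx_path_el(1)[OF v w(2)] monomial_def by (simp add: path_els_in_L(2)[OF w(3)])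
  finally show "vtx v \<otimes>\<^bsub>LL\<^esub> mon a b w \<in> unit_span"
    by (simp add: monomial_in_unit_span[OF w] unit_span.zero)
qed

lemma edg_mult_path_el:
  assumes "e \<in> arcs G" "awalk u a w" "head G e \<noteq> u"
  shows "edg e \<otimes>\<^bsub>LL\<^esub> path_el a w = \<zero>\<^bsub>LL\<^esub>" "ghost_el a w \<otimes>\<^bsub>LL\<^esub> gho e = \<zero>\<^bsub>LL\<^esub>"
proof -
  have "(edg e \<otimes>\<^bsub>LL\<^esub> vtx (head G e)) \<otimes>\<^bsub>LL\<^esub> path_el a w = edg e \<otimes>\<^bsub>LL\<^esub> (vtx (head G e) \<otimes>\<^bsub>LL\<^esub> path_el a w)"
    using assms(1) by (simp add: L.m_assoc path_els_in_L(1)[OF assms(2)])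
  then show "edg e \<otimes>\<^bsub>LL\<^esub> path_el a w = \<zero>\<^bsub>LL\<^esub>"
    unfolding L_relations(3)[OF assms(1)] using assms by (simp add: vtx_path_el(1)[OF _ assms(2)])
  have "(ghost_el a w \<otimes>\<^bsub>LL\<^esub> vtx (head G e)) \<otimes>\<^bsub>LL\<^esub> gho e = ghost_el a w \<otimes>\<^bsub>LL\<^esub> (vtx (head G e) \<otimes>\<^bsub>LL\<^esub> gho e)"
    using assms(1) by (simp add: L.m_assoc path_els_in_L(2)[OF assms(2)])
  then show "ghost_el a w \<otimes>\<^bsub>LL\<^esub> gho e = \<zero>\<^bsub>LL\<^esub>"
    unfolding L_relations(4)[OF assms(1)] using assms by (simp add: vtx_path_el(2)[OF _ assms(2)])
qed

lemma edg_unit_span: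
  assumes e: "e \<in> arcs G" and z: "z \<in> unit_span" shows "edg e \<otimes>\<^bsub>LL\<^esub> z \<in> unit_span"
proof (rule unit_span_left[OF gens_in_L(2)[OF e] z])
  fix u a u' b w assume w: "isolated w" "awalk u a w" "awalk u' b w"
  have eq: "edg e \<otimes>\<^bsub>LL\<^esub> mon a b w = (edg e \<otimes>\<^bsub>LL\<^esub> path_el a w) \<otimes>\<^bsub>LL\<^esub> ghost_el b w"
    unfolding monomial_def
    by (rule L.m_assoc[OF gens_in_L(2)[OF e] path_els_in_L(1)[OF w(2)] path_els_in_L(2)[OF w(3)], symmetric])
  show "edg e \<otimes>\<^bsub>LL\<^esub> mon a b w \<in> unit_span"
  proof (cases "head G e = u")
    case True
    then have "awalk (tail G e) (e # a) w" using e w(2) by (simp add: awalk_Cons_iff)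
    then have "mon (e # a) b w \<in> unit_span" using monomial_in_unit_span w by blast
    then show ?thesis unfolding eq by (simp add: monomial_def)
  next
    case False
    then show ?thesis
      unfolding eq edg_mult_path_el(1)[OF e w(2) False] by (simp add: path_els_in_L(2)[OF w(3)] unit_span.zero)
  qed
qed

lemma gho_right_unit_span:
  assumes e: "e \<in> arcs G" and z: "z \<in> unit_span" shows "z \<otimes>\<^bsub>LL\<^esub> gho e \<in> unit_span"
proof (rule unit_span_right[OF gens_in_L(3)[OF e] z])
  fix u a u' b w assume w: "isolated w" "awalk u a w" "awalk u' b w"
  have eq: "mon a b w \<otimes>\<^bsub>LL\<^esub> gho e = path_el a w \<otimes>\<^bsub>LL\<^esub> (ghost_el b w \<otimes>\<^bsub>LL\<^esub> gho e)"
    unfolding monomial_def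
    by (rule L.m_assoc[OF path_els_in_L(1)[OF w(2)] path_els_in_L(2)[OF w(3)] gens_in_L(3)[OF e]])
  show "mon a b w \<otimes>\<^bsub>LL\<^esub> gho e \<in> unit_span"
  proof (cases "head G e = u'")
    case True
    then have "awalk (tail G e) (e # b) w" using e w(3) by (simp add: awalk_Cons_iff)
    then have "mon a (e # b) w \<in> unit_span" using monomial_in_unit_span w by blast
    then show ?thesis unfolding eq by (simp add: monomial_def)
  next
    case False
    then show ?thesis
      unfolding eq edg_mult_path_el(2)[OF e w(3) False] by (simp add: path_els_in_L(1)[OF w(2)] unit_span.zero)
  qed
qed

lemma gho_monomial:
  assumes e: "e \<in> arcs G" and f: "f \<in> arcs G" and w: "isolated w" "awalk (head G f) a w" "awalk u' b w"
  shows "gho e \<otimes>\<^bsub>LL\<^esub> mon (f # a) b w \<in> unit_span"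
proof -
  have c: "edg f \<otimes>\<^bsub>LL\<^esub> path_el a w \<in> carrier LL" "path_el a w \<in> carrier LL" "ghost_el b w \<in> carrier LL"
    using f by (simp_all add: path_els_in_L(1)[OF w(2)] path_els_in_L(2)[OF w(3)])
  have eq: "gho e \<otimes>\<^bsub>LL\<^esub> mon (f # a) b w = ((gho e \<otimes>\<^bsub>LL\<^esub> edg f) \<otimes>\<^bsub>LL\<^esub> path_el a w) \<otimes>\<^bsub>LL\<^esub> ghost_el b w"
    unfolding monomial_def path_el.simps using e f c by (simp add: L.m_assoc)
  show ?thesis
  proof (cases "e = f")
    case True
    have "gho e \<otimes>\<^bsub>LL\<^esub> mon (f # a) b w = mon a b w"
      unfolding eq L_relations(6)[OF e f] using True by (simp add: monomial_def path_el_units(1)[OF w(2)])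
    then show ?thesis by (simp add: monomial_in_unit_span[OF w])
  next
    case False
    have "gho e \<otimes>\<^bsub>LL\<^esub> mon (f # a) b w = \<zero>\<^bsub>LL\<^esub>"
      unfolding eq L_relations(6)[OF e f] using False c by simp
    then show ?thesis by (simp add: unit_span.zero)
  qed
qed

text \<open>
  The only delicate case is a ghost edge that meets an empty path, where the monomial is first
  extended by that edge.
\<close>

lemma gho_unit_span:
  assumes e: "e \<in> arcs G" and z: "z \<in> unit_span" shows "gho e \<otimes>\<^bsub>LL\<^esub> z \<in> unit_span"
proof (rule unit_span_left[OF gens_in_L(3)[OF e] z])
  fix u a u' b w assume w: "isolated w" "awalk u a w" "awalk u' b w"
  show "gho e \<otimes>\<^bsub>LL\<^esub> mon a b w \<in> unit_span"
  proof (cases a)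
    case (Cons f c)
    then have "f \<in> arcs G" "awalk (head G f) c w" using w(2) by (auto simp: awalk_simps)
    then show ?thesis unfolding Cons using gho_monomial[OF e _ w(1) _ w(3)] by blast
  next
    case Nil
    then have wv: "w \<in> verts G" using w(2) by (auto simp: awalk_simps)
    show ?thesis
    proof (cases "tail G e = w")
      case True
      have iso: "isolated (tail G e)" "isolated (head G e)" using w(1) True isolated_arc e by auto
      have nil: "awalk w [] (tail G e)" using wv True by (simp add: awalk_Nil_iff)
      have b: "awalk u' b (tail G e)" using w(3) True by simp
      have be: "awalk u' (b @ [e]) (head G e)" using b e by (auto simp: awalk_append awalk_simps)
      have "gho e \<otimes>\<^bsub>LL\<^esub> mon ([] @ [e]) (b @ [e]) (head G e) \<in> unit_span"
        using gho_monomial[OF e e iso(2) _ be, of "[]"] e by (simp add: awalk_Nil_iff)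
      then show ?thesis
        unfolding monomial_extend_arc[OF iso(1) e nil b] Nil True .
    next
      case False
      have "(gho e \<otimes>\<^bsub>LL\<^esub> vtx (tail G e)) \<otimes>\<^bsub>LL\<^esub> (vtx w \<otimes>\<^bsub>LL\<^esub> ghost_el b w) =
          gho e \<otimes>\<^bsub>LL\<^esub> ((vtx (tail G e) \<otimes>\<^bsub>LL\<^esub> vtx w) \<otimes>\<^bsub>LL\<^esub> ghost_el b w)"
        using e wv by (simp add: L.m_assoc path_els_in_L(2)[OF w(3)])
      also have "\<dots> = \<zero>\<^bsub>LL\<^esub>"
        using e wv False by (simp add: L_relations path_els_in_L(2)[OF w(3)])
      finally have "gho e \<otimes>\<^bsub>LL\<^esub> mon [] b w = \<zero>\<^bsub>LL\<^esub>"
        unfolding L_relations(5)[OF e] by (simp add: monomial_def)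
      then show ?thesis unfolding Nil by (simp add: unit_span.zero)
    qed
  qed
qed

text \<open>
  Expand \<open>v\<close> as the sum of \<open>e e*\<close> over its outgoing edges and repeat
  at the heads that are not isolated. This stops because the branching relation is well-founded.
\<close>

lemma vtx_in_unit_span: "v \<in> verts G \<Longrightarrow> vtx v \<in> unit_span"
proof (induction v rule: wf_induct_rule[OF wf_branching])
  case (1 v)
  show ?case
  proof (cases "isolated v")
    case True
    have "awalk v [] v" using 1(2) by (simp add: awalk_Nil_iff)
    then show ?thesis
      using monomial_in_unit_span[OF True, of v "[]" v "[]"] 1(2) by (simp add: monomial_def L_relations)
  next
    case False
    have "out_arcs G v \<noteq> {}"
    proof
      assume "out_arcs G v = {}"
      then have "is_sink G v" using 1(2) by (simp add: is_sink_def)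
      then have "isolated v"
        using awalk_from_sink[of v] 1(2) unfolding isolated_def
        by (metis awalk_Nil_iff empty_iff is_sink_def)
      then show False using False by blast
    qed
    moreover have "finite (out_arcs G v)" using row_finite[OF 1(2)] 1(2) by (simp add: infinite_emitter_def)
    ultimately obtain es where es: "distinct es" "set es = out_arcs G v" "es \<noteq> []"
      using finite_distinct_list by (metis set_empty)
    have arc: "edg e \<otimes>\<^bsub>LL\<^esub> gho e \<in> unit_span" if e: "e \<in> arcs G" "tail G e = v" for e
    proof -
      have "vtx (head G e) \<in> unit_span"
      proof (cases "isolated (head G e)")
        case True
        have "awalk (head G e) [] (head G e)" using e(1) by (simp add: awalk_Nil_iff)
        then show ?thesis
          using monomial_in_unit_span[OF True, of "head G e" "[]" "head G e" "[]"] e(1)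
          by (simp add: monomial_def L_relations)
      next
        case False
        then have "(head G e, v) \<in> branching" using e unfolding branching_def by blast
        then show ?thesis using 1(1) e(1) by simp
      qed
      then have "edg e \<otimes>\<^bsub>LL\<^esub> (vtx (head G e) \<otimes>\<^bsub>LL\<^esub> gho e) \<in> unit_span"
        by (intro edg_unit_span gho_right_unit_span e(1))
      then show ?thesis unfolding L_relations(4)[OF e(1)] .
    qed
    have "set xs \<subseteq> out_arcs G v \<Longrightarrow> foldr (\<lambda>e x. (edg e \<otimes>\<^bsub>LL\<^esub> gho e) \<oplus>\<^bsub>LL\<^esub> x) xs \<zero>\<^bsub>LL\<^esub> \<in> unit_span" for xs
    proof (induction xs)
      case Nil
      then show ?case by (simp add: unit_span.zero)
    next
      case (Cons e xs)
      then show ?case unfolding foldr_Cons o_apply by (intro unit_span.add arc) auto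
    qed
    then show ?thesis
      unfolding L_edge_ghost_sum[OF 1(2) es] by (simp add: es(2))
  qed
qed

lemma left_unit_span:
  assumes "t \<in> alg_terms (lpa_gens G)" "z \<in> unit_span"
  shows "cl t \<otimes>\<^bsub>LL\<^esub> z \<in> unit_span"
  using assms
proof (induction t arbitrary: z)
  case (Gen g)
  then show ?case
    using vtx_unit_span edg_unit_span gho_unit_span
    by (cases g) (auto simp: vtx_def edg_def gho_def)
next
  case Zero
  then show ?case using unit_span_in_L[OF Zero(2)] unit_span.zero by (simp flip: L_ops(1))
next
  case (Neg t)
  have t: "cl t \<in> carrier LL" and z: "z \<in> carrier LL" using Neg.prems unit_span_in_L by auto
  have "cl (Neg t) \<oplus>\<^bsub>LL\<^esub> cl t = \<zero>\<^bsub>LL\<^esub>"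
    using Neg.prems(1) by (simp add: L_ops term_class_axiom[OF alg_axiom.intros(4)])
  moreover have "((-1) \<odot>\<^bsub>LL\<^esub> cl t) \<oplus>\<^bsub>LL\<^esub> cl t = \<zero>\<^bsub>LL\<^esub>"
    using L.scale_l_distr[OF t, of "-1" 1] t by simp
  ultimately have "cl (Neg t) = (-1) \<odot>\<^bsub>LL\<^esub> cl t"
    using t Neg.prems(1) by (metis L.add.r_cancel L.scale_closed alg_terms_simps(3) cl_in_L)
  then show ?case
    using Neg t z by (simp add: L.scale_l_mult unit_span_scale)
next
  case (Add s t)
  then have c: "cl s \<in> carrier LL" "cl t \<in> carrier LL" "z \<in> carrier LL" using unit_span_in_L by auto
  have "cl (Add s t) \<otimes>\<^bsub>LL\<^esub> z = cl s \<otimes>\<^bsub>LL\<^esub> z \<oplus>\<^bsub>LL\<^esub> cl t \<otimes>\<^bsub>LL\<^esub> z"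
    using L.l_distr[OF c] Add.prems(1) by (simp add: L_ops)
  then show ?case using Add unit_span.add by simp
next
  case (Mult s t)
  then have c: "cl s \<in> carrier LL" "cl t \<in> carrier LL" "z \<in> carrier LL" using unit_span_in_L by auto
  have "cl (Mult s t) \<otimes>\<^bsub>LL\<^esub> z = cl s \<otimes>\<^bsub>LL\<^esub> (cl t \<otimes>\<^bsub>LL\<^esub> z)"
    using L.m_assoc[OF c] Mult.prems(1) by (simp add: L_ops)
  then show ?case using Mult by simp
next
  case (Scale c t)
  then have t: "cl t \<in> carrier LL" "z \<in> carrier LL" using unit_span_in_L by auto
  have "cl (Scale c t) \<otimes>\<^bsub>LL\<^esub> z = c \<odot>\<^bsub>LL\<^esub> (cl t \<otimes>\<^bsub>LL\<^esub> z)"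
    using L.scale_l_mult[OF t, of c] Scale.prems(1) by (simp add: L_ops)
  then show ?case using Scale unit_span_scale by simp
qed

text \<open>
  The span of the units is a left ideal that contains the vertices, hence the local units.
\<close>

lemma L_unit_span:
  fixes z :: "(('a, 'b) lpa_gen, 'r) alg_term set"
  assumes z: "z \<in> carrier LL" shows "z \<in> unit_span"
proof -
  obtain vs where vs: "set vs \<subseteq> verts G" "z \<otimes>\<^bsub>LL\<^esub> vertex_sum vs = z"
    using L_support[of "{z}"] z by auto
  have sum: "set us \<subseteq> verts G \<Longrightarrow> vertex_sum us \<in> unit_span" for us
    by (induction us) (auto intro: unit_span.zero unit_span.add vtx_in_unit_span)
  obtain t where t: "t \<in> alg_terms (lpa_gens G)" "z = cl t" using L_cases[OF z] by blast
  have "z \<otimes>\<^bsub>LL\<^esub> vertex_sum vs \<in> unit_span"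
    unfolding t(2) by (rule left_unit_span[OF t(1) sum[OF vs(1)]])
  then show ?thesis unfolding vs(2) .
qed

lemma L_induct [consumes 1, case_names zero unit add]:
  fixes z :: "(('a, 'b) lpa_gen, 'r) alg_term set"
  assumes "z \<in> carrier LL" "P \<zero>\<^bsub>LL\<^esub>" "\<And>c g. g \<in> triples \<Longrightarrow> P (c \<odot>\<^bsub>LL\<^esub> unit_el g)"
    "\<And>y z. \<lbrakk>y \<in> carrier LL; z \<in> carrier LL; P y; P z\<rbrakk> \<Longrightarrow> P (y \<oplus>\<^bsub>LL\<^esub> z)"
  shows "P z"
  using L_unit_span[OF assms(1)]
proof (induction rule: unit_span.induct)
  case (unit g c)
  then show ?case by (rule assms(3))
next
  case (add y z)
  then show ?case by (intro assms(4) unit_span_in_L)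
qed (rule assms(2))

definition support where "support z = {g. snd (snd g) \<in> boundary G \<and> coef z g \<noteq> 0}"

lemma support_finite: "z \<in> carrier LL \<Longrightarrow> finite (support z) \<and> support z \<subseteq> triples"
proof (induction rule: L_induct)
  case zero
  then show ?case by (simp add: support_def coef_simps)
next
  case (unit c g)
  have "h = g" if "h \<in> support (c \<odot>\<^bsub>LL\<^esub> unit_el g)" for h
    using that unit
    by (cases h) (auto simp: support_def coef_simps coef_unit_el split: if_splits)
  then have "support (c \<odot>\<^bsub>LL\<^esub> unit_el g) \<subseteq> {g}" by blast
  then show ?case using unit finite_subset by blast
next
  case (add y z)
  have "support (y \<oplus>\<^bsub>LL\<^esub> z) \<subseteq> support y \<union> support z"
    using add.hyps by (auto simp: support_def coef_simps)
  then show ?case using add.IH finite_subset[of _ "support y \<union> support z"] by blast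
qed

text \<open>
  Together with \<open>coef_unit_el\<close> this shows that the units form a basis of
  \<open>L\<close> with coordinate functions \<open>coef\<close>. The statement allows any
  larger index set, so expansions of two elements can be compared.
\<close>

lemma coef_expansion:
  "z \<in> carrier LL \<Longrightarrow> \<exists>F. finite F \<and> F \<subseteq> triples \<and> (\<forall>F'. finite F' \<longrightarrow> F \<subseteq> F' \<longrightarrow> F' \<subseteq> triples \<longrightarrow>
    z = (\<Oplus>\<^bsub>LL\<^esub>g\<in>F'. coef z g \<odot>\<^bsub>LL\<^esub> unit_el g))"
proof (induction rule: L_induct)
  case zero
  have "(\<Oplus>\<^bsub>LL\<^esub>g\<in>F'. 0 \<odot>\<^bsub>LL\<^esub> unit_el g) = \<zero>\<^bsub>LL\<^esub>" if "F' \<subseteq> triples" for F'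
    using that by (intro L.add.finprod_one_eqI) (auto simp: subset_iff)
  then show ?case by (intro exI[of _ "{}"]) (simp add: coef_simps)
next
  case (unit c g)
  have eq: "c \<odot>\<^bsub>LL\<^esub> unit_el g = (\<Oplus>\<^bsub>LL\<^esub>h\<in>F'. coef (c \<odot>\<^bsub>LL\<^esub> unit_el g) h \<odot>\<^bsub>LL\<^esub> unit_el h)"
    if F': "finite F'" "{g} \<subseteq> F'" "F' \<subseteq> triples" for F'
  proof -
    have "coef (c \<odot>\<^bsub>LL\<^esub> unit_el g) h = (if h = g then c else 0)" if "h \<in> F'" for h
    proof -
      obtain p k q where h: "h = (p, k, q)" by (cases h)
      then have "q \<in> boundary G" using triples_boundary that F'(3) by blast
      then show ?thesis using unit h by (simp add: coef_simps coef_unit_el)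
    qed
    then have "(\<Oplus>\<^bsub>LL\<^esub>h\<in>F'. coef (c \<odot>\<^bsub>LL\<^esub> unit_el g) h \<odot>\<^bsub>LL\<^esub> unit_el h) =
        (\<Oplus>\<^bsub>LL\<^esub>h\<in>F'. if g = h then c \<odot>\<^bsub>LL\<^esub> unit_el h else \<zero>\<^bsub>LL\<^esub>)"
      using F'(3) by (intro L.finsum_cong') (auto simp: subset_iff)
    also have "\<dots> = c \<odot>\<^bsub>LL\<^esub> unit_el g"
      by (rule L.finsum_singleton[where f = "\<lambda>h. c \<odot>\<^bsub>LL\<^esub> unit_el h"]) (use F' in auto)
    finally show ?thesis ..
  qed
  show ?case
  proof (rule exI[of _ "{g}"], intro conjI)
    show "finite {g}" by simp
    show "{g} \<subseteq> triples" using unit by simp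
  qed (rule allI, rule impI, rule impI, rule impI, rule eq)
next
  case (add y z)
  obtain F1 where F1: "finite F1" "F1 \<subseteq> triples" "\<forall>F'. finite F' \<longrightarrow> F1 \<subseteq> F' \<longrightarrow> F' \<subseteq> triples \<longrightarrow>
      y = (\<Oplus>\<^bsub>LL\<^esub>g\<in>F'. coef y g \<odot>\<^bsub>LL\<^esub> unit_el g)"
    using add.IH(1) by (elim exE conjE)
  obtain F2 where F2: "finite F2" "F2 \<subseteq> triples" "\<forall>F'. finite F' \<longrightarrow> F2 \<subseteq> F' \<longrightarrow> F' \<subseteq> triples \<longrightarrow>
      z = (\<Oplus>\<^bsub>LL\<^esub>g\<in>F'. coef z g \<odot>\<^bsub>LL\<^esub> unit_el g)"
    using add.IH(2) by (elim exE conjE)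
  have eq: "y \<oplus>\<^bsub>LL\<^esub> z = (\<Oplus>\<^bsub>LL\<^esub>g\<in>F'. coef (y \<oplus>\<^bsub>LL\<^esub> z) g \<odot>\<^bsub>LL\<^esub> unit_el g)"
    if F': "finite F'" "F1 \<union> F2 \<subseteq> F'" "F' \<subseteq> triples" for F'
  proof -
    have "(\<Oplus>\<^bsub>LL\<^esub>g\<in>F'. coef (y \<oplus>\<^bsub>LL\<^esub> z) g \<odot>\<^bsub>LL\<^esub> unit_el g) =
        (\<Oplus>\<^bsub>LL\<^esub>g\<in>F'. coef y g \<odot>\<^bsub>LL\<^esub> unit_el g \<oplus>\<^bsub>LL\<^esub> coef z g \<odot>\<^bsub>LL\<^esub> unit_el g)"
      using F'(3) add.hyps by (intro L.finsum_cong') (auto simp: coef_simps L.scale_l_distr subset_iff)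
    also have "\<dots> = (\<Oplus>\<^bsub>LL\<^esub>g\<in>F'. coef y g \<odot>\<^bsub>LL\<^esub> unit_el g) \<oplus>\<^bsub>LL\<^esub> (\<Oplus>\<^bsub>LL\<^esub>g\<in>F'. coef z g \<odot>\<^bsub>LL\<^esub> unit_el g)"
      using F'(3) by (intro L.finsum_addf) (auto simp: subset_iff)
    also have "\<dots> = y \<oplus>\<^bsub>LL\<^esub> z"
      using F1(3)[rule_format, of F'] F2(3)[rule_format, of F'] F' by simp
    finally show ?thesis ..
  qed
  show ?case
  proof (rule exI[of _ "F1 \<union> F2"], intro conjI)
    show "finite (F1 \<union> F2)" "F1 \<union> F2 \<subseteq> triples" using F1 F2 by simp_all
  qed (rule allI, rule impI, rule impI, rule impI, rule eq)
qed

lemma coef_inject: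
  assumes "y \<in> carrier LL" "z \<in> carrier LL" "\<And>g. g \<in> triples \<Longrightarrow> coef y g = coef z g"
  shows "y = z"
proof -
  obtain F1 where F1: "finite F1" "F1 \<subseteq> triples" "\<forall>F'. finite F' \<longrightarrow> F1 \<subseteq> F' \<longrightarrow> F' \<subseteq> triples \<longrightarrow>
      y = (\<Oplus>\<^bsub>LL\<^esub>g\<in>F'. coef y g \<odot>\<^bsub>LL\<^esub> unit_el g)"
    using coef_expansion[OF assms(1)] by (elim exE conjE)
  obtain F2 where F2: "finite F2" "F2 \<subseteq> triples" "\<forall>F'. finite F' \<longrightarrow> F2 \<subseteq> F' \<longrightarrow> F' \<subseteq> triples \<longrightarrow>
      z = (\<Oplus>\<^bsub>LL\<^esub>g\<in>F'. coef z g \<odot>\<^bsub>LL\<^esub> unit_el g)"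
    using coef_expansion[OF assms(2)] by (elim exE conjE)
  have F: "finite (F1 \<union> F2)" "F1 \<subseteq> F1 \<union> F2" "F2 \<subseteq> F1 \<union> F2" "F1 \<union> F2 \<subseteq> triples" using F1 F2 by auto
  have "(\<Oplus>\<^bsub>LL\<^esub>g\<in>F1 \<union> F2. coef y g \<odot>\<^bsub>LL\<^esub> unit_el g) = (\<Oplus>\<^bsub>LL\<^esub>g\<in>F1 \<union> F2. coef z g \<odot>\<^bsub>LL\<^esub> unit_el g)"
    using F(4) assms(3) by (intro L.finsum_cong') (auto simp: subset_iff)
  then show ?thesis
    unfolding F1(3)[rule_format, OF F(1,2,4), symmetric] F2(3)[rule_format, OF F(1,3,4), symmetric] .
qed

lemma coef_surject:
  fixes f :: "('a, 'b) bpath \<times> int \<times> ('a, 'b) bpath \<Rightarrow> 'r"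
  assumes "finite F" "F \<subseteq> triples"
  shows "\<exists>z\<in>carrier LL. \<forall>p k q. q \<in> boundary G \<longrightarrow> coef z (p, k, q) = (if (p, k, q) \<in> F then f (p, k, q) else 0)"
  using assms
proof (induction rule: finite_induct)
  case empty
  then show ?case by (intro bexI[of _ "\<zero>\<^bsub>LL\<^esub>"]) (simp_all add: coef_simps)
next
  case (insert g F)
  then obtain z where z: "z \<in> carrier LL" "\<And>p k q. q \<in> boundary G \<Longrightarrow>
      coef z (p, k, q) = (if (p, k, q) \<in> F then f (p, k, q) else 0)" by auto
  have g: "g \<in> triples" using insert.prems by simp
  show ?case
    using insert.hyps(2) g z
    by (intro bexI[of _ "(f g \<odot>\<^bsub>LL\<^esub> unit_el g) \<oplus>\<^bsub>LL\<^esub> z"]) (auto simp: coef_simps coef_unit_el)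
qed

text \<open>
  Products are convolutions over the groupoid: the action is linear and commutes with shifts of
  the integer.
\<close>

lemma coef_mult:
  fixes y z :: "(('a, 'b) lpa_gen, 'r) alg_term set"
  assumes z: "z \<in> carrier LL" and y: "y \<in> carrier LL" and q: "q \<in> boundary G"
    and F: "finite A" "finite B" "\<And>s l. coef y (s, l, q) \<noteq> 0 \<Longrightarrow> s \<in> A \<and> l \<in> B"
  shows "coef (z \<otimes>\<^bsub>LL\<^esub> y) (p, k, q) = (\<Sum>s\<in>A. \<Sum>l\<in>B. coef z (p, k - l, s) * coef y (s, l, q))"
proof -
  have "act mark y (delta q 0) = (\<lambda>x. \<Sum>(s, l)\<in>A \<times> B. coef y (s, l, q) * delta s l x)"
  proof
    fix x :: "('a, 'b) bpath \<times> int"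
    obtain r m where x: "x = (r, m)" by (cases x)
    have "(\<Sum>(s, l)\<in>A \<times> B. coef y (s, l, q) * delta s l x) =
        (\<Sum>sl\<in>A \<times> B. if sl = x then coef y (r, m, q) else 0)"
      by (intro sum.cong) (auto simp: delta_def x split: if_splits)
    also have "\<dots> = (if x \<in> A \<times> B then coef y (r, m, q) else 0)"
      using F(1,2) by (simp add: sum.delta)
    also have "\<dots> = coef y (r, m, q)"
      using F(3)[of r m] x by auto
    finally show "act mark y (delta q 0) x = (\<Sum>(s, l)\<in>A \<times> B. coef y (s, l, q) * delta s l x)"
      by (simp add: coef_def x)
  qed
  then have "coef (z \<otimes>\<^bsub>LL\<^esub> y) (p, k, q) =
      act mark z (\<lambda>x. \<Sum>sl\<in>A \<times> B. coef y (fst sl, snd sl, q) * delta (fst sl) (snd sl) x) (p, k)"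
    using y z by (simp add: coef_def act_mult split_def)
  also have "\<dots> = (\<Sum>sl\<in>A \<times> B. act mark z (\<lambda>x. coef y (fst sl, snd sl, q) * delta (fst sl) (snd sl) x) (p, k))"
    using F(1,2) by (intro act_linear(5)[OF z]) simp
  also have "\<dots> = (\<Sum>sl\<in>A \<times> B. coef z (p, k - snd sl, fst sl) * coef y (fst sl, snd sl, q))"
  proof (rule sum.cong[OF HOL.refl])
    fix sl :: "('a, 'b) bpath \<times> int"
    obtain s l where sl: "sl = (s, l)" by (cases sl)
    have "(delta s l :: ('a, 'b) bpath \<times> int \<Rightarrow> 'r) = (\<lambda>(p, k). delta s 0 (p, k - l))"
      by (auto simp: delta_def fun_eq_iff)
    then have "act mark z (delta s l) (p, k) = coef z (p, k - l, s)"
      using act_linear(4)[OF z, of mark "delta s 0" l p k] by (simp add: coef_def)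
    then show "act mark z (\<lambda>x. coef y (fst sl, snd sl, q) * delta (fst sl) (snd sl) x) (p, k) =
        coef z (p, k - snd sl, fst sl) * coef y (fst sl, snd sl, q)"
      by (simp add: sl act_linear(2)[OF z] mult.commute[of "coef z (p, k - l, s)"])
  qed
  also have "\<dots> = (\<Sum>s\<in>A. \<Sum>l\<in>B. coef z (p, k - l, s) * coef y (s, l, q))"
    by (simp add: sum.cartesian_product split_def)
  finally show ?thesis .
qed

end

section \<open>Decomposition into matrix algebras\<close>

context exit_free_lpa
begin

interpretation L: nonunital_algebra LL
  by (rule presented_nonunital_algebra)

lemma orbit_of_eq: "same_orbit G p q \<Longrightarrow> orbit_of G p = orbit_of G q"
  unfolding orbit_of_def using same_orbit_trans same_orbit_sym by blast

lemma orbit_of_self: "p \<in> boundary G \<Longrightarrow> p \<in> orbit_of G p"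
  by (simp add: orbit_of_def same_orbit_refl)

abbreviation orbits :: "('a, 'b) bpath set set" where
  "orbits \<equiv> orbit_of G ` boundary G"

lemma orbits_mem:
  assumes "X \<in> orbits" "p \<in> X"
  shows "p \<in> boundary G" "orbit_of G p = X"
    and "same_orbit G p q \<Longrightarrow> q \<in> X"
    and "q \<in> X \<Longrightarrow> same_orbit G p q"
proof -
  obtain r where r: "r \<in> boundary G" "X = orbit_of G r" using assms(1) by blast
  then have rp: "same_orbit G r p" "p \<in> boundary G" using assms(2) by (auto simp: orbit_of_def)
  then show "p \<in> boundary G" "orbit_of G p = X" using orbit_of_eq r(2) by auto
  then show "q \<in> X" if "same_orbit G p q"
    using that same_orbit_boundary by (auto simp: orbit_of_def)
  show "same_orbit G p q" if "q \<in> X"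
    using that \<open>orbit_of G p = X\<close> by (auto simp: orbit_of_def)
qed

lemma nonperiodic_orbit_mem:
  assumes "X \<in> nonperiodic_orbits G"
  shows "X \<in> orbits" "p \<in> X \<Longrightarrow> \<not> periodic p"
proof -
  obtain r where r: "r \<in> boundary G" "\<not> periodic r" "X = orbit_of G r"
    using assms eventually_periodic_iff unfolding nonperiodic_orbits_def by auto
  then show "X \<in> orbits" by blast
  show "\<not> periodic p" if "p \<in> X"
    using that r periodic_same_orbit same_orbit_sym unfolding orbit_of_def by blast
qed

lemma periodic_orbit_mem:
  assumes "X \<in> periodic_orbits G"
  shows "X \<in> orbits" "p \<in> X \<Longrightarrow> periodic p"
proof -
  obtain r where r: "r \<in> boundary G" "periodic r" "X = orbit_of G r"
    using assms eventually_periodic_iff unfolding periodic_orbits_def by auto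
  then show "X \<in> orbits" by blast
  show "periodic p" if "p \<in> X"
    using that r periodic_same_orbit unfolding orbit_of_def by blast
qed

lemma orbit_of_cases:
  "p \<in> boundary G \<Longrightarrow> orbit_of G p \<in> (if periodic p then periodic_orbits G else nonperiodic_orbits G)"
  unfolding periodic_orbits_def nonperiodic_orbits_def using eventually_periodic_iff by auto

definition entry :: "(('a, 'b) lpa_gen, 'r) alg_term set \<Rightarrow> ('a, 'b) bpath set \<Rightarrow>
    int \<Rightarrow> ('a, 'b) bpath \<Rightarrow> ('a, 'b) bpath \<Rightarrow> 'r" where
  "entry z X k p q = (if p \<in> X \<and> q \<in> X then coef z (p, k, q) else 0)"

lemma entry_support:
  assumes "X \<in> orbits" "entry z X k p q \<noteq> 0"
  shows "(p, k, q) \<in> support z" "p \<in> X" "q \<in> X" "orbit_of G p = X"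
proof -
  show pq: "p \<in> X" "q \<in> X" using assms(2) by (simp_all add: entry_def split: if_splits)
  show "orbit_of G p = X" by (rule orbits_mem(2)[OF assms(1) pq(1)])
  show "(p, k, q) \<in> support z"
    using assms(2) pq orbits_mem(1)[OF assms(1) pq(2)] by (simp add: entry_def support_def)
qed

lemma coef_triples:
  "\<lbrakk>z \<in> carrier LL; q \<in> boundary G; coef z (p, k, q) \<noteq> 0\<rbrakk> \<Longrightarrow> (p, k, q) \<in> triples"
  using support_finite[of z] by (auto simp: support_def)

lemma entry_finite:
  assumes "X \<in> orbits" "z \<in> carrier LL"
  shows "finite {s. entry z X k p s \<noteq> 0}" "finite {s. entry z X k s q \<noteq> 0}" "finite {k. entry z X k p q \<noteq> 0}"
    "finite {s. \<exists>k. entry z X k p s \<noteq> 0}" "finite {s. \<exists>k. entry z X k s q \<noteq> 0}"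
proof -
  have fin: "finite (support z)" using support_finite[OF assms(2)] by blast
  have "{s. \<exists>k. entry z X k p s \<noteq> 0} \<subseteq> (snd \<circ> snd) ` support z"
    using entry_support(1)[OF assms(1)] by force
  then show 1: "finite {s. \<exists>k. entry z X k p s \<noteq> 0}" using fin finite_surj by blast
  have "{s. \<exists>k. entry z X k s q \<noteq> 0} \<subseteq> fst ` support z"
    using entry_support(1)[OF assms(1)] by force
  then show 2: "finite {s. \<exists>k. entry z X k s q \<noteq> 0}" using fin finite_surj by blast
  have "{k. entry z X k p q \<noteq> 0} \<subseteq> (fst \<circ> snd) ` support z"
    using entry_support(1)[OF assms(1)] by force
  then show "finite {k. entry z X k p q \<noteq> 0}" using fin finite_surj by blast
  show "finite {s. entry z X k p s \<noteq> 0}" by (rule finite_subset[OF _ 1]) blast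
  show "finite {s. entry z X k s q \<noteq> 0}" by (rule finite_subset[OF _ 2]) blast
qed

lemma entry_simps:
  "\<lbrakk>y \<in> carrier LL; z \<in> carrier LL\<rbrakk> \<Longrightarrow> entry (y \<oplus>\<^bsub>LL\<^esub> z) X k p q = entry y X k p q + entry z X k p q"
  "z \<in> carrier LL \<Longrightarrow> entry (c \<odot>\<^bsub>LL\<^esub> z) X k p q = c * entry z X k p q"
  by (simp_all add: entry_def coef_simps)

text \<open>
  All paths through which a product passes lie in one orbit, so orbits multiply independently.
\<close>

lemma entry_mult:
  assumes X: "X \<in> orbits" and z: "z \<in> carrier LL" and y: "y \<in> carrier LL"
    and F: "finite A" "finite B" "\<And>s l. entry y X l s q \<noteq> 0 \<Longrightarrow> s \<in> A \<and> l \<in> B"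
  shows "entry (z \<otimes>\<^bsub>LL\<^esub> y) X k p q = (\<Sum>s\<in>A. \<Sum>l\<in>B. entry z X (k - l) p s * entry y X l s q)"
proof (cases "p \<in> X \<and> q \<in> X")
  case False
  then show ?thesis by (auto simp: entry_def)
next
  case True
  have q: "q \<in> boundary G" using orbits_mem(1)[OF X] True by blast
  have s: "s \<in> X" if "coef y (s, l, q) \<noteq> 0" for s l
    using orbits_mem(3)[OF X] True same_orbit_sym triples_same_orbit[OF coef_triples[OF y q that]] by blast
  have "coef (z \<otimes>\<^bsub>LL\<^esub> y) (p, k, q) = (\<Sum>s\<in>A. \<Sum>l\<in>B. coef z (p, k - l, s) * coef y (s, l, q))"
  proof (rule coef_mult[OF z y q F(1,2)])
    fix s l assume "coef y (s, l, q) \<noteq> 0"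
    with s[OF this] have "entry y X l s q \<noteq> 0" using True by (simp add: entry_def)
    then show "s \<in> A \<and> l \<in> B" by (rule F(3))
  qed
  also have "\<dots> = (\<Sum>s\<in>A. \<Sum>l\<in>B. entry z X (k - l) p s * entry y X l s q)"
  proof (intro sum.cong HOL.refl)
    fix s l
    show "coef z (p, k - l, s) * coef y (s, l, q) = entry z X (k - l) p s * entry y X l s q"
      using True s[of s l] by (cases "coef y (s, l, q) = 0") (simp_all add: entry_def)
  qed
  finally show ?thesis using True by (simp add: entry_def)
qed

definition laurent_entry :: "(('a, 'b) lpa_gen, 'r) alg_term set \<Rightarrow> ('a, 'b) bpath set \<Rightarrow>
    ('a, 'b) bpath \<Rightarrow> ('a, 'b) bpath \<Rightarrow> 'r laurent" where
  "laurent_entry z X p q = Abs_poly_mapping (\<lambda>k. entry z X k p q)"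

lemma lookup_laurent_entry:
  "\<lbrakk>X \<in> orbits; z \<in> carrier LL\<rbrakk> \<Longrightarrow> Poly_Mapping.lookup (laurent_entry z X p q) k = entry z X k p q"
  by (simp add: laurent_entry_def lookup_Abs_poly_mapping entry_finite(3))

lemma laurent_entry_nonzero:
  assumes "X \<in> orbits" "z \<in> carrier LL"
  shows "laurent_entry z X p q \<noteq> 0 \<longleftrightarrow> (\<exists>k. entry z X k p q \<noteq> 0)"
  by (simp add: poly_mapping_eq_iff fun_eq_iff lookup_laurent_entry[OF assms])

lemma entry_in_matrix:
  assumes X: "X \<in> orbits" and z: "z \<in> carrier LL"
  shows "entry z X 0 \<in> carrier (matrix_algebra (\<lambda>c. c) X)"
    "laurent_entry z X \<in> carrier (matrix_algebra \<iota> X)"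
proof -
  let ?S = "((\<lambda>(p, k, q). (p, q)) ` support z) \<inter> X \<times> X"
  have S: "finite ?S" "?S \<subseteq> X \<times> X" using support_finite[OF z] by auto
  have in_S: "(p, q) \<in> ?S" if "entry z X k p q \<noteq> 0" for p k q
    using entry_support[OF X that] by force
  show "entry z X 0 \<in> carrier (matrix_algebra (\<lambda>c. c) X)"
    by (rule matrix_carrierI[OF S in_S])
  show "laurent_entry z X \<in> carrier (matrix_algebra \<iota> X)"
    by (rule matrix_carrierI[OF S]) (use in_S laurent_entry_nonzero[OF X z] in blast)
qed

text \<open>
  In an orbit without periodic paths only the integer \<open>0\<close> occurs, and the
  convolution is a matrix product.
\<close>

lemma entry_matrix_mult:
  assumes X: "X \<in> nonperiodic_orbits G" and z: "z \<in> carrier LL" and y: "y \<in> carrier LL"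
  shows "entry (z \<otimes>\<^bsub>LL\<^esub> y) X 0 p q = (\<Sum>s | entry z X 0 p s \<noteq> 0. entry z X 0 p s * entry y X 0 s q)"
proof -
  note O = nonperiodic_orbit_mem(1)[OF X]
  let ?K = "{s. entry z X 0 p s \<noteq> 0} \<union> {s. entry y X 0 s q \<noteq> 0}"
  have K: "finite ?K" using entry_finite(1,2)[OF O] z y by blast
  \<comment> \<open>A nonzero entry sits at a triple, and triples of this orbit have integer \<open>0\<close>.\<close>
  have zero: "l = 0" if "entry y X l s q \<noteq> 0" for s l
    using that coef_triples[OF y, of q s l] triples_nonperiodic nonperiodic_orbit_mem[OF X] orbits_mem(1)[OF O]
    unfolding entry_def by (metis (full_types))
  have "entry (z \<otimes>\<^bsub>LL\<^esub> y) X 0 p q = (\<Sum>s\<in>?K. \<Sum>l\<in>{0}. entry z X (0 - l) p s * entry y X l s q)"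
  proof (rule entry_mult[OF O z y K])
    fix s l assume "entry y X l s q \<noteq> 0"
    moreover from this have "l = 0" by (rule zero)
    ultimately show "s \<in> ?K \<and> l \<in> {0}" by simp
  qed simp
  also have "\<dots> = (\<Sum>s\<in>?K. entry z X 0 p s * entry y X 0 s q)" by simp
  also have "\<dots> = (\<Sum>s | entry z X 0 p s \<noteq> 0. entry z X 0 p s * entry y X 0 s q)"
    by (rule matrix_mult_sum[OF K, symmetric]) blast
  finally show ?thesis .
qed

text \<open>
  In an orbit of eventually periodic paths the integer plays the role of the exponent.
\<close>

lemma laurent_matrix_mult:
  assumes X: "X \<in> orbits" and z: "z \<in> carrier LL" and y: "y \<in> carrier LL"
  shows "laurent_entry (z \<otimes>\<^bsub>LL\<^esub> y) X p q =
    (\<Sum>s | laurent_entry z X p s \<noteq> 0. laurent_entry z X p s * laurent_entry y X s q)"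
proof (rule poly_mapping_eqI)
  fix k
  let ?K = "{s. laurent_entry z X p s \<noteq> 0} \<union> {s. laurent_entry y X s q \<noteq> 0}"
  let ?B = "\<Union>s\<in>?K. Poly_Mapping.keys (laurent_entry y X s q)"
  have K: "finite ?K"
    unfolding laurent_entry_nonzero[OF X z] laurent_entry_nonzero[OF X y]
    using entry_finite(4,5)[OF X] z y by blast
  then have B: "finite ?B" by simp
  have zy: "z \<otimes>\<^bsub>LL\<^esub> y \<in> carrier LL" using z y by (rule L.m_closed)
  have "entry (z \<otimes>\<^bsub>LL\<^esub> y) X k p q = (\<Sum>s\<in>?K. \<Sum>l\<in>?B. entry z X (k - l) p s * entry y X l s q)"
  proof (rule entry_mult[OF X z y K B])
    fix s l assume *: "entry y X l s q \<noteq> 0"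
    then have "laurent_entry y X s q \<noteq> 0" using laurent_entry_nonzero[OF X y] by blast
    moreover have "l \<in> Poly_Mapping.keys (laurent_entry y X s q)"
      using * by (simp add: in_keys_iff lookup_laurent_entry[OF X y])
    ultimately show "s \<in> ?K \<and> l \<in> ?B" by blast
  qed
  also have "\<dots> = (\<Sum>s\<in>?K. Poly_Mapping.lookup (laurent_entry z X p s * laurent_entry y X s q) k)"
  proof (rule sum.cong[OF HOL.refl])
    fix s assume "s \<in> ?K"
    then have "Poly_Mapping.keys (laurent_entry y X s q) \<subseteq> ?B" by blast
    then have "Poly_Mapping.lookup (laurent_entry y X s q * laurent_entry z X p s) k =
        (\<Sum>l\<in>?B. entry y X l s q * entry z X (k - l) p s)"
      by (simp only: lookup_times_sum[OF B] lookup_laurent_entry[OF X z] lookup_laurent_entry[OF X y])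
    then show "(\<Sum>l\<in>?B. entry z X (k - l) p s * entry y X l s q) =
        Poly_Mapping.lookup (laurent_entry z X p s * laurent_entry y X s q) k"
      by (simp only: mult.commute)
  qed
  also have "\<dots> = Poly_Mapping.lookup (\<Sum>s\<in>?K. laurent_entry z X p s * laurent_entry y X s q) k"
    by (simp only: lookup_sum)
  also have "(\<Sum>s\<in>?K. laurent_entry z X p s * laurent_entry y X s q) =
      (\<Sum>s | laurent_entry z X p s \<noteq> 0. laurent_entry z X p s * laurent_entry y X s q)"
    by (rule matrix_mult_sum[OF K, symmetric]) blast
  finally show "Poly_Mapping.lookup (laurent_entry (z \<otimes>\<^bsub>LL\<^esub> y) X p q) k =
      Poly_Mapping.lookup (\<Sum>s | laurent_entry z X p s \<noteq> 0. laurent_entry z X p s * laurent_entry y X s q) k"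
    unfolding lookup_laurent_entry[OF X zy] .
qed

abbreviation plain_matrices where
  "plain_matrices \<equiv> algebra_direct_sum (nonperiodic_orbits G) (matrix_algebra (\<lambda>c :: 'r. c))"

abbreviation laurent_matrices where
  "laurent_matrices \<equiv> algebra_direct_sum (periodic_orbits G)
    (matrix_algebra (\<lambda>c :: 'r. Poly_Mapping.single 0 c :: 'r laurent))"

definition to_matrices where
  "to_matrices z = (\<lambda>X\<in>nonperiodic_orbits G. entry z X 0, \<lambda>X\<in>periodic_orbits G. laurent_entry z X)"

lemma to_matrices_carrier:
  assumes z: "z \<in> carrier LL"
  shows "to_matrices z \<in> carrier (algebra_binary_sum plain_matrices laurent_matrices)"
proof -
  let ?S = "(orbit_of G \<circ> fst) ` support z"
  have S: "finite ?S" using support_finite[OF z] by simp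
  have zero: "entry z X k p q = 0" if "X \<in> orbits" "X \<notin> ?S" for X k p q
    using entry_support(1,4)[OF that(1), of z k p q] that(2) by force
  have "(\<lambda>X\<in>nonperiodic_orbits G. entry z X 0) \<in> carrier plain_matrices"
  proof (rule direct_sum_carrierI[OF _ S])
    fix X assume "X \<in> nonperiodic_orbits G"
    then have X: "X \<in> orbits" by (rule nonperiodic_orbit_mem)
    show "entry z X 0 \<in> carrier (matrix_algebra (\<lambda>c. c) X)" by (rule entry_in_matrix(1)[OF X z])
    show "entry z X 0 = \<zero>\<^bsub>matrix_algebra (\<lambda>c. c) X\<^esub>" if "X \<notin> ?S"
      by (simp add: fun_eq_iff zero[OF X that])
  qed
  moreover have "(\<lambda>X\<in>periodic_orbits G. laurent_entry z X) \<in> carrier laurent_matrices"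
  proof (rule direct_sum_carrierI[OF _ S])
    fix X assume "X \<in> periodic_orbits G"
    then have X: "X \<in> orbits" by (rule periodic_orbit_mem)
    show "laurent_entry z X \<in> carrier (matrix_algebra (Poly_Mapping.single 0) X)"
      by (rule entry_in_matrix(2)[OF X z])
    show "laurent_entry z X = \<zero>\<^bsub>matrix_algebra (Poly_Mapping.single 0) X\<^esub>" if "X \<notin> ?S"
      using laurent_entry_nonzero[OF X z] zero[OF X that] by (simp add: fun_eq_iff)
  qed
  ultimately show ?thesis unfolding to_matrices_def binary_sum_simps by (rule SigmaI)
qed

lemma to_matrices_hom:
  assumes y: "y \<in> carrier LL" and z: "z \<in> carrier LL"
  shows "to_matrices (y \<oplus>\<^bsub>LL\<^esub> z) = to_matrices y \<oplus>\<^bsub>algebra_binary_sum plain_matrices laurent_matrices\<^esub> to_matrices z"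
    "to_matrices (y \<otimes>\<^bsub>LL\<^esub> z) = to_matrices y \<otimes>\<^bsub>algebra_binary_sum plain_matrices laurent_matrices\<^esub> to_matrices z"
    "to_matrices (c \<odot>\<^bsub>LL\<^esub> z) = c \<odot>\<^bsub>algebra_binary_sum plain_matrices laurent_matrices\<^esub> to_matrices z"
proof -
  note orb = nonperiodic_orbit_mem(1) periodic_orbit_mem(1)
  have yz: "y \<oplus>\<^bsub>LL\<^esub> z \<in> carrier LL" "c \<odot>\<^bsub>LL\<^esub> z \<in> carrier LL"
    using y z L.scale_closed by (blast intro: L.add.m_closed)+
  have add: "laurent_entry (y \<oplus>\<^bsub>LL\<^esub> z) X p q = laurent_entry y X p q + laurent_entry z X p q"
    if "X \<in> orbits" for X p q
    by (rule poly_mapping_eqI)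
      (simp only: lookup_add lookup_laurent_entry[OF that y] lookup_laurent_entry[OF that z]
        lookup_laurent_entry[OF that yz(1)] entry_simps(1)[OF y z])
  have scale: "laurent_entry (c \<odot>\<^bsub>LL\<^esub> z) X p q = Poly_Mapping.single 0 c * laurent_entry z X p q"
    if "X \<in> orbits" for X p q
    by (rule poly_mapping_eqI)
      (simp add: lookup_single_times lookup_laurent_entry[OF that z] lookup_laurent_entry[OF that yz(2)]
        entry_simps(2)[OF z])
  show "to_matrices (y \<oplus>\<^bsub>LL\<^esub> z) = to_matrices y \<oplus>\<^bsub>algebra_binary_sum plain_matrices laurent_matrices\<^esub> to_matrices z"
    unfolding to_matrices_def binary_sum_simps direct_sum_simps matrix_algebra_simps fst_conv snd_conv
    by (intro arg_cong2[where f = Pair] restrict_ext ext) (simp_all add: entry_simps(1)[OF y z] add orb)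
  show "to_matrices (c \<odot>\<^bsub>LL\<^esub> z) = c \<odot>\<^bsub>algebra_binary_sum plain_matrices laurent_matrices\<^esub> to_matrices z"
    unfolding to_matrices_def binary_sum_simps direct_sum_simps matrix_algebra_simps fst_conv snd_conv
    by (intro arg_cong2[where f = Pair] restrict_ext ext) (simp_all add: entry_simps(2)[OF z] scale orb)
  show "to_matrices (y \<otimes>\<^bsub>LL\<^esub> z) = to_matrices y \<otimes>\<^bsub>algebra_binary_sum plain_matrices laurent_matrices\<^esub> to_matrices z"
    unfolding to_matrices_def binary_sum_simps direct_sum_simps matrix_algebra_simps fst_conv snd_conv
    by (intro arg_cong2[where f = Pair] restrict_ext ext)
      (simp_all add: entry_matrix_mult[OF _ y z] laurent_matrix_mult[OF _ y z] orb)
qed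

text \<open>
  Every coordinate of an element occurs as an entry in the orbit of its first path.
\<close>

lemma to_matrices_inj: "inj_on to_matrices (carrier LL)"
proof (rule inj_onI)
  fix y z :: "(('a, 'b) lpa_gen, 'r) alg_term set"
  assume yz: "y \<in> carrier LL" "z \<in> carrier LL" and eq: "to_matrices y = to_matrices z"
  show "y = z"
  proof (rule coef_inject[OF yz])
    fix g assume g: "g \<in> triples"
    obtain p k q where pkq: "g = (p, k, q)" by (cases g)
    then have o: "same_orbit G p q" using g triples_same_orbit by blast
    then have p: "p \<in> boundary G" using same_orbit_boundary by blast
    let ?X = "orbit_of G p"
    have X: "?X \<in> orbits" "p \<in> ?X" using p orbit_of_self by blast+
    then have q: "q \<in> ?X" using orbits_mem(3)[OF X o] by blast
    have "entry y ?X k p q = entry z ?X k p q"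
    proof (cases "periodic p")
      case True
      then have "?X \<in> periodic_orbits G" using orbit_of_cases[OF p] by simp
      then have "laurent_entry y ?X = laurent_entry z ?X"
        using arg_cong[OF eq, of "\<lambda>f. snd f ?X"] by (simp add: to_matrices_def)
      then show ?thesis
        using lookup_laurent_entry[OF X(1)] yz by metis
    next
      case False
      then have "?X \<in> nonperiodic_orbits G" using orbit_of_cases[OF p] by simp
      then have "entry y ?X 0 = entry z ?X 0"
        using arg_cong[OF eq, of "\<lambda>f. fst f ?X"] by (simp add: to_matrices_def)
      moreover have "k = 0" using False g triples_nonperiodic pkq by blast
      ultimately show ?thesis by simp
    qed
    then show "coef y g = coef z g" using X(2) q by (simp add: entry_def pkq)
  qed
qed

text \<open>
  Every position of a matrix is a triple: for periodic orbits with any exponent, for the others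
  with exponent \<open>0\<close>. A finitely supported family of matrices therefore prescribes
  finitely many coordinates.
\<close>

lemma to_matrices_surj:
  assumes f: "f \<in> carrier (algebra_binary_sum plain_matrices laurent_matrices)"
  shows "\<exists>z\<in>carrier LL. to_matrices z = f"
proof -
  obtain f1 f2 where f12: "f = (f1, f2)" "f1 \<in> carrier plain_matrices" "f2 \<in> carrier laurent_matrices"
    using f unfolding binary_sum_simps by blast
  note D1 = direct_sum_carrierD[OF f12(2)] and D2 = direct_sum_carrierD[OF f12(3)]
  define val where "val = (\<lambda>(p, k :: int, q).
    if periodic p then Poly_Mapping.lookup (f2 (orbit_of G p) p q) k else f1 (orbit_of G p) p q)"
  define F where "F = {g \<in> triples. val g \<noteq> 0}"
  let ?S1 = "{X \<in> nonperiodic_orbits G. f1 X \<noteq> \<zero>\<^bsub>matrix_algebra (\<lambda>c :: 'r. c) X\<^esub>}"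
  let ?S2 = "{X \<in> periodic_orbits G. f2 X \<noteq> \<zero>\<^bsub>matrix_algebra (\<lambda>c :: 'r. Poly_Mapping.single 0 c :: 'r laurent) X\<^esub>}"
  let ?F1 = "\<Union>X\<in>?S1. (\<lambda>(p, q). (p, 0 :: int, q)) ` {(p, q). f1 X p q \<noteq> 0}"
  let ?F2 = "\<Union>X\<in>?S2. \<Union>(p, q)\<in>{(p, q). f2 X p q \<noteq> 0}. (\<lambda>k. (p, k, q)) ` Poly_Mapping.keys (f2 X p q)"
  have "F \<subseteq> ?F1 \<union> ?F2"
  proof
    fix g assume "g \<in> F"
    then obtain p k q where g: "g = (p, k, q)" "(p, k, q) \<in> triples" "val (p, k, q) \<noteq> 0"
      unfolding F_def by (cases g) auto
    then have X: "orbit_of G p \<in> (if periodic p then periodic_orbits G else nonperiodic_orbits G)"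
      using orbit_of_cases triples_boundary by blast
    show "g \<in> ?F1 \<union> ?F2"
    proof (cases "periodic p")
      case True
      then have k: "Poly_Mapping.lookup (f2 (orbit_of G p) p q) k \<noteq> 0" using g(3) by (simp add: val_def)
      then have nz: "f2 (orbit_of G p) p q \<noteq> 0" by auto
      then have "f2 (orbit_of G p) \<noteq> (\<lambda>i j. 0)" by (intro notI) simp
      then have S: "orbit_of G p \<in> ?S2" using True X by simp
      have "(p, k, q) \<in> ?F2"
      proof (rule UN_I[OF S], rule UN_I[of "(p, q)"])
        show "(p, q) \<in> {(p', q'). f2 (orbit_of G p) p' q' \<noteq> 0}" using nz by simp
        show "(p, k, q) \<in> (case (p, q) of (p', q') \<Rightarrow>
            (\<lambda>k. (p', k, q')) ` Poly_Mapping.keys (f2 (orbit_of G p) p' q'))"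
          unfolding prod.case by (rule imageI) (use k in \<open>simp add: in_keys_iff\<close>)
      qed
      then show ?thesis unfolding g(1) by (rule UnI2)
    next
      case False
      then have nz: "f1 (orbit_of G p) p q \<noteq> 0" using g(3) by (simp add: val_def)
      then have "f1 (orbit_of G p) \<noteq> (\<lambda>i j. 0)" by (intro notI) simp
      then have S: "orbit_of G p \<in> ?S1" using False X by simp
      have "k = 0" using triples_nonperiodic[OF g(2) False] .
      then have "(p, k, q) \<in> ?F1"
        by (intro UN_I[OF S] image_eqI[of _ _ "(p, q)"]) (use nz in simp_all)
      then show ?thesis unfolding g(1) by (rule UnI1)
    qed
  qed
  moreover have "finite ?F1"
    using D1(1,3) by (intro finite_UN_I finite_imageI) auto
  moreover have "finite ?F2"
  proof (rule finite_UN_I[OF D2(3)])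
    fix X assume "X \<in> ?S2"
    then have "finite {(p, q). f2 X p q \<noteq> 0}" using D2(1)[of X] by simp
    then show "finite (\<Union>(p, q)\<in>{(p, q). f2 X p q \<noteq> 0}. (\<lambda>k. (p, k, q)) ` Poly_Mapping.keys (f2 X p q))"
      by (rule finite_UN_I) auto
  qed
  ultimately have F: "finite F" "F \<subseteq> triples" using finite_subset unfolding F_def by blast+
  obtain z where z: "z \<in> carrier LL"
      "\<forall>p k q. q \<in> boundary G \<longrightarrow> coef z (p, k, q) = (if (p, k, q) \<in> F then val (p, k, q) else 0)"
    using coef_surject[OF F, of val] by blast
  have coef: "coef z (p, k, q) = val (p, k, q)" if "(p, k, q) \<in> triples" for p k q
    using z(2) that triples_boundary[OF that] by (simp add: F_def)
  have "entry z X 0 = f1 X" if X: "X \<in> nonperiodic_orbits G" for X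
  proof (intro ext)
    fix p q
    note O = nonperiodic_orbit_mem[OF X]
    show "entry z X 0 p q = f1 X p q"
    proof (cases "p \<in> X \<and> q \<in> X")
      case True
      then have "same_orbit G p q" "orbit_of G p = X" using orbits_mem[OF O(1)] by blast+
      then show ?thesis
        using True coef[OF nonperiodic_triple[of p q]] O(2)[of p] by (simp add: entry_def val_def)
    next
      case False
      have "{(i, j). f1 X i j \<noteq> 0} \<subseteq> X \<times> X" using D1(1)[OF X] by simp
      then have "f1 X p q = 0" using False by blast
      then show ?thesis using False by (auto simp: entry_def)
    qed
  qed
  moreover have "laurent_entry z X = f2 X" if X: "X \<in> periodic_orbits G" for X
  proof (intro ext poly_mapping_eqI)
    fix p q k
    note O = periodic_orbit_mem[OF X]
    show "Poly_Mapping.lookup (laurent_entry z X p q) k = Poly_Mapping.lookup (f2 X p q) k"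
    proof (cases "p \<in> X \<and> q \<in> X")
      case True
      then have "same_orbit G p q" "orbit_of G p = X" using orbits_mem[OF O(1)] by blast+
      then show ?thesis
        using True coef[OF periodic_triple[of p q k]] O(2)[of p]
        by (simp add: entry_def val_def lookup_laurent_entry[OF O(1) z(1)])
    next
      case False
      have "{(i, j). f2 X i j \<noteq> 0} \<subseteq> X \<times> X" using D2(1)[OF X] by simp
      then have "f2 X p q = 0" using False by blast
      then show ?thesis using False by (auto simp: entry_def lookup_laurent_entry[OF O(1) z(1)])
    qed
  qed
  ultimately have "to_matrices z = f"
    unfolding to_matrices_def f12(1) using D1(2) D2(2) by (metis (no_types, lifting) restrict_ext)
  then show ?thesis using z(1) by blast
qed

lemma L_isomorphic_matrices:
  "algebra_isomorphic LL (algebra_binary_sum plain_matrices laurent_matrices)"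
proof -
  let ?M = "algebra_binary_sum plain_matrices laurent_matrices"
  have "to_matrices ` carrier LL = carrier ?M"
  proof (intro equalityI subsetI)
    fix f assume "f \<in> carrier ?M"
    then show "f \<in> to_matrices ` carrier LL" by (rule bexE[OF to_matrices_surj]) (rule image_eqI, rule HOL.sym)
  next
    fix f assume "f \<in> to_matrices ` carrier LL"
    then show "f \<in> carrier ?M" by (elim imageE ssubst) (rule to_matrices_carrier)
  qed
  then have "bij_betw to_matrices (carrier LL) (carrier ?M)"
    using to_matrices_inj by (simp add: bij_betw_def)
  then have "to_matrices \<in> algebra_iso LL ?M"
    unfolding algebra_iso_def mem_Collect_eq
    by (intro conjI ballI allI to_matrices_hom) assumption+
  then show ?thesis unfolding algebra_isomorphic_def by (metis empty_iff)
qed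

end

section \<open>The equivalence\<close>

text \<open>
  Local units pass from \<open>A\<close> to \<open>B\<close> along the isomorphism, and the
  chain condition passes back along its inverse.
\<close>

lemma isomorphic_column_span_imp_categorically_noetherian:
  assumes A: "nonunital_ring A" "has_local_units A" and B: "nonunital_ring B"
    and span: "carrier B \<subseteq> column_span B" and iso: "algebra_isomorphic A B"
  shows "categorically_left_noetherian A"
proof -
  interpret A: nonunital_ring A by (rule A)
  obtain h where bij: "bij_betw h (carrier A) (carrier B)"
    and add: "\<And>x y. \<lbrakk>x \<in> carrier A; y \<in> carrier A\<rbrakk> \<Longrightarrow> h (x \<oplus>\<^bsub>A\<^esub> y) = h x \<oplus>\<^bsub>B\<^esub> h y"
    and mult: "\<And>x y. \<lbrakk>x \<in> carrier A; y \<in> carrier A\<rbrakk> \<Longrightarrow> h (x \<otimes>\<^bsub>A\<^esub> y) = h x \<otimes>\<^bsub>B\<^esub> h y"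
    using iso unfolding algebra_isomorphic_def algebra_iso_def by blast
  have img: "h ` carrier A = carrier B" and inj: "inj_on h (carrier A)"
    using bij by (simp_all add: bij_betw_def)
  have lu: "has_local_units B" by (rule has_local_units_surj[OF A(2) img mult])
  have cat: "categorically_left_noetherian B"
    by (rule column_span_imp_categorically_noetherian[OF B lu span])
  let ?g = "the_inv_into (carrier A) h"
  have g: "?g (h x) = x" if "x \<in> carrier A" for x using inj that by (rule the_inv_into_f_f)
  have pre: "\<exists>a\<in>carrier A. x = h a" if "x \<in> carrier B" for x using that img by blast
  show ?thesis
  proof (rule categorically_left_noetherian_surj[OF B lu cat])
    show "?g ` carrier B = carrier A"
      unfolding img[symmetric] by (rule the_inv_into_onto[OF inj])
    fix x y assume "x \<in> carrier B" "y \<in> carrier B"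
    then obtain a b where ab: "a \<in> carrier A" "b \<in> carrier A" "x = h a" "y = h b" using pre by blast
    show "?g (x \<oplus>\<^bsub>B\<^esub> y) = ?g x \<oplus>\<^bsub>A\<^esub> ?g y"
      unfolding ab(3,4) add[OF ab(1,2), symmetric] g[OF ab(1)] g[OF ab(2)]
      by (rule g) (use ab in simp)
    show "?g (x \<otimes>\<^bsub>B\<^esub> y) = ?g x \<otimes>\<^bsub>A\<^esub> ?g y"
      unfolding ab(3,4) mult[OF ab(1,2), symmetric] g[OF ab(1)] g[OF ab(2)]
      by (rule g) (use ab in simp)
  qed
qed

lemma matrix_sums_column_span:
  fixes I :: "'x set set" and J :: "'y set set"
  assumes noeth: "noetherian_type TYPE('r :: comm_ring_1)"
  defines "M \<equiv> algebra_binary_sum (algebra_direct_sum I (matrix_algebra (\<lambda>c :: 'r. c)))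
    (algebra_direct_sum J (matrix_algebra (\<lambda>c :: 'r. Poly_Mapping.single 0 c :: 'r laurent)))"
  shows "nonunital_ring M" "carrier M \<subseteq> column_span M"
  unfolding M_def
  by (intro binary_sum_nonunital direct_sum_nonunital matrix_nonunital)
    (intro binary_sum_column_span direct_sum_column_span direct_sum_nonunital matrix_nonunital
      matrix_column_span noeth noetherian_laurent)

theorem theorem6p12:
  fixes E :: "('v, 'e) pre_digraph"
    and L :: "('r :: comm_ring_1, (('v, 'e) lpa_gen, 'r) alg_term set) module"
  assumes "wf_digraph E" and "verts E \<noteq> {}"
    and "L = leavitt_path_algebra E"
  shows
    "(categorically_left_noetherian L \<longleftrightarrow> categorically_right_noetherian L) \<and>
     (categorically_left_noetherian L \<longleftrightarrow> locally_left_noetherian L) \<and>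
     (categorically_left_noetherian L \<longleftrightarrow> locally_right_noetherian L) \<and>
     (categorically_left_noetherian L \<longleftrightarrow>
        noetherian_ring (ring_of_type :: 'r ring) \<and>
        (\<forall>v\<in>verts E. \<not> infinite_emitter E v) \<and>
        (\<forall>p. cycle_path E p \<longrightarrow> exits_finite E p = {}) \<and>
        (\<forall>\<alpha>. ray E \<alpha> \<longrightarrow> finite (exits_infinite E \<alpha>))) \<and>
     (categorically_left_noetherian L \<longleftrightarrow>
        algebra_isomorphic L
          (algebra_binary_sum
            (algebra_direct_sum (nonperiodic_orbits E) (matrix_algebra (\<lambda>c :: 'r. c)))
            (algebra_direct_sum (periodic_orbits E)
              (matrix_algebra (\<lambda>c :: 'r. Poly_Mapping.single 0 c :: 'r laurent)))) \<and>
        noetherian_ring (ring_of_type :: 'r ring))"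
    (is "_ \<and> _ \<and> _ \<and> (_ \<longleftrightarrow> ?R \<and> ?a \<and> ?b \<and> ?c) \<and> (_ \<longleftrightarrow> algebra_isomorphic L ?M \<and> _)")
proof -
  interpret wf_digraph E by (rule assms(1))
  have L: "L = presented_algebra (lpa_gens E) (lpa_relations E)"
    unfolding assms(3) leavitt_path_algebra_def ..
  obtain v where v: "v \<in> verts E" using assms(2) by blast
  have ring: "nonunital_ring L"
    unfolding L by (rule nonunital_algebra.axioms(1)[OF presented_nonunital_algebra])
  have units: "has_local_units L" unfolding L by (rule L_local_units)
  have R: "?R \<longleftrightarrow> noetherian_type TYPE('r)" by (rule noetherian_ring_of_type)
  have local: "locally_left_noetherian L" if "categorically_left_noetherian L"
    using nonunital_ring.categorically_imp_locally_left_noetherian[OF ring that units] .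
  have graph: "?R \<and> ?a \<and> ?b \<and> ?c" if "locally_left_noetherian L"
    unfolding R
    using locally_noetherian_graph_conditions[OF that[unfolded L]]
      locally_noetherian_coefficients[OF that[unfolded L] v] by blast
  have iso: "algebra_isomorphic L ?M" if "?a" "?b" "?c"
  proof -
    interpret exit_free_lpa E "TYPE('r)"
      by unfold_locales (use that in blast)+
    show ?thesis unfolding L by (rule L_isomorphic_matrices)
  qed
  have categorical: "categorically_left_noetherian L" if "algebra_isomorphic L ?M" "?R"
    using isomorphic_column_span_imp_categorically_noetherian[OF ring units
        matrix_sums_column_span(1)[OF that(2)[unfolded R]]
        matrix_sums_column_span(2)[OF that(2)[unfolded R]] that(1)] .
  show ?thesis
    using L_left_right[where 'r = 'r, folded L] local graph iso categorical by blast
qed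

end
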